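(* Let $(M^{2n},\omega_t,\beta_t,J)$ be a solution to pluriclosed flow. Then the associated family of generalized Hermitian metrics $G_t=G(\omega_t,\beta_t)$ on $\mathcal Q_{\sqrt{-1}\partial\omega_0}$ satisfies $$G^{-1}\frac{\partial}{\partial t}G=-S^G_g.$$
   Context: Hermitian conventions: for a Hermitian metric $g$ on $(M,J)$, $\omega(X,Y)=g(JX,Y)$, $d^c=\sqrt{-1}(\bar\partial-\partial)$; $g$ is pluriclosed if $\partial\bar\partial\omega=0$. Bismut connection: $g(\nabla^B_XY,Z)=g(\nabla_XY,Z)-\tfrac12d^c\omega(X,Y,Z)$ ($\nabla$ Levi-Civita), with curvature $R^B(X,Y)Z=\nabla^B_X\nabla^B_YZ-\nabla^B_Y\nabla^B_XZ-\nabla^B_{[X,Y]}Z$ and Bismut-Ricci form $\rho_B(X,Y)=\tfrac12\sum_i g(R^B(X,Y)Je_i,e_i)$ ($\{e_i\}$ orthonormal). A solution to pluriclosed flow is a one-parameter family $(\omega_t,\beta_t)$ of pluriclosed metrics $\omega_t$ (with Riemannian metric $g=g_t$) and $\beta_t\in\Lambda^{2,0}$ with $$\frac{\partial}{\partial t}\omega=-\rho_B^{1,1},\qquad\frac{\partial}{\partial t}\beta=-\rho_B^{2,0},$$ and with $\bar\partial\beta_t=\partial\omega_0-\partial\omega_t$ (this relation is preserved by the flow). The bundle $\mathcal Q_{\sqrt{-1}\partial\omega_0}$ is the smooth bundle $T^{1,0}\oplus T^*_{1,0}$ with pairing $\langle X+\xi,X+\xi\rangle=\xi(X)$ and Dolbeault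 operator $\bar\partial(X+\xi)=\bar\partial X+\bar\partial\xi-\sqrt{-1}\,i_X\partial\omega_0$ (the $(1,1)$-forms $\bar\partial\xi$, $i_X\partial\omega_0$ are viewed as $T^*_{1,0}$-valued $(0,1)$-forms by contracting a $(0,1)$-vector in the first slot). With $\beta(X)=i_X\beta$, the generalized Hermitian metric $G(\omega,\beta)$ is $$G(X+\xi,X+\xi)=g(X,\overline X)+g^{-1}\big(\xi+\sqrt{-1}\beta(X),\overline{\xi+\sqrt{-1}\beta(X)}\big).$$ With $\Omega^G$ the Chern curvature of $G$, $S^G_g=\sqrt{-1}\,\mathrm{tr}_\omega\Omega^G\in\operatorname{End}(\mathcal Q)$, i.e. $S^G_g=g^{\bar ji}\Omega^G(\partial_i,\partial_{\bar j})$ in coordinates. $G^{-1}\frac{\partial}{\partial t}G$ is the endomorphism $A$ with $G(Au,v)=(\frac{\partial}{\partial t}G)(u,v)$. *)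

theory Defs
  imports "HOL-Analysis.Analysis"
begin

text \<open>
  Tensor fields on a complex manifold are families of local representatives, one for each chart of
  a holomorphic atlas, related by the usual transformation laws.  All local operators are written
  on an open subset of \<open>\<complex>\<^sup>n\<close>; a vector of \<open>\<complex>\<^sup>n\<close> is also used as a real tangent vector, the complex
  structure \<open>J\<close> being multiplication by \<open>\<i>\<close>.
\<close>

section \<open>Smooth maps\<close>

primrec Ck_on :: "nat \<Rightarrow> 'a::real_normed_vector set \<Rightarrow> ('a \<Rightarrow> 'b::real_normed_vector) \<Rightarrow> bool" where
  "Ck_on 0 S f \<longleftrightarrow> continuous_on S f"
| "Ck_on (Suc k) S f \<longleftrightarrow>
     (\<forall>x\<in>S. f differentiable (at x)) \<and> (\<forall>v. Ck_on k S (\<lambda>x. frechet_derivative f (at x) v))"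

text \<open>Intended for open \<open>S\<close> only.\<close>
definition smooth_on :: "'a::real_normed_vector set \<Rightarrow> ('a \<Rightarrow> 'b::real_normed_vector) \<Rightarrow> bool" where
  "smooth_on S f \<longleftrightarrow> (\<forall>k. Ck_on k S f)"

text \<open>Joint smoothness on \<open>I \<times> V\<close>; as the time interval \<open>I\<close> may contain an end point, this means that
  local smooth extensions exist.\<close>
definition smooth_family ::
  "real set \<Rightarrow> 'a::real_normed_vector set \<Rightarrow> (real \<Rightarrow> 'a \<Rightarrow> 'b::real_normed_vector) \<Rightarrow> bool" where
  "smooth_family I V f \<longleftrightarrow>
     (\<forall>t\<in>I. \<forall>x\<in>V. \<exists>N h. open N \<and> (t, x) \<in> N \<and> smooth_on N h \<and>
        (\<forall>s y. (s, y) \<in> N \<longrightarrow> s \<in> I \<longrightarrow> y \<in> V \<longrightarrow> h (s, y) = f s y))"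

section \<open>Complex manifolds\<close>

type_synonym ('m, 'n) chart = "'m set \<times> ('m \<Rightarrow> complex^'n)"

definition chart_image :: "('m, 'n::finite) chart \<Rightarrow> (complex^'n) set" where
  "chart_image c = snd c ` fst c"

definition chart_overlap :: "('m, 'n::finite) chart \<Rightarrow> ('m, 'n) chart \<Rightarrow> (complex^'n) set" where
  "chart_overlap c c' = snd c ` (fst c \<inter> fst c')"

definition transition :: "('m, 'n::finite) chart \<Rightarrow> ('m, 'n) chart \<Rightarrow> complex^'n \<Rightarrow> complex^'n" where
  "transition c c' = snd c' \<circ> inv_into (fst c) (snd c)"

definition holomorphic_map_on :: "(complex^'n::finite) set \<Rightarrow> (complex^'n \<Rightarrow> complex^'n) \<Rightarrow> bool" where
  "holomorphic_map_on S f \<longleftrightarrow>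
     (\<forall>x\<in>S. \<exists>L. (f has_derivative L) (at x) \<and> (\<forall>c v. L (c *s v) = c *s L v))"

text \<open>The manifold is the whole type \<open>'m\<close>; its complex dimension is \<open>CARD('n)\<close>.\<close>
definition complex_atlas ::
  "('m::{t2_space, second_countable_topology}, 'n::finite) chart set \<Rightarrow> bool" where
  "complex_atlas \<A> \<longleftrightarrow>
     (\<Union>c\<in>\<A>. fst c) = UNIV \<and>
     (\<forall>c\<in>\<A>. open (fst c) \<and> open (chart_image c) \<and>
        homeomorphism (fst c) (chart_image c) (snd c) (inv_into (fst c) (snd c))) \<and>
     (\<forall>c\<in>\<A>. \<forall>c'\<in>\<A>. holomorphic_map_on (chart_overlap c c') (transition c c'))"

section \<open>Complexified tangent vectors and differential forms\<close>

text \<open>The pair \<open>(a, b)\<close> stands for \<open>\<Sum>i. a\<^sub>i \<partial>/\<partial>z\<^sub>i + b\<^sub>i \<partial>/\<partial>zbar\<^sub>i\<close>.\<close>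
type_synonym 'n ctan = "(complex^'n) \<times> (complex^'n)"

text \<open>A form of degree \<open>k\<close> is only meant to be evaluated on lists of length \<open>k\<close>.\<close>
type_synonym 'n cform = "complex^'n \<Rightarrow> 'n ctan list \<Rightarrow> complex"

definition cnjv :: "complex^'n::finite \<Rightarrow> complex^'n" where
  "cnjv v = (\<chi> i. cnj (v $ i))"

definition pscale :: "complex \<Rightarrow> (complex^'n::finite) \<times> (complex^'n) \<Rightarrow> (complex^'n) \<times> (complex^'n)" where
  "pscale c u = (c *s fst u, c *s snd u)"

definition clin :: "((complex^'n::finite) \<times> (complex^'n) \<Rightarrow> (complex^'n) \<times> (complex^'n)) \<Rightarrow> bool" where
  "clin L \<longleftrightarrow> (\<forall>u v. L (u + v) = L u + L v) \<and> (\<forall>c u. L (pscale c u) = pscale c (L u))"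

definition holo_vec :: "complex^'n::finite \<Rightarrow> 'n ctan" where
  "holo_vec a = (a, 0)"

definition antiholo_vec :: "complex^'n::finite \<Rightarrow> 'n ctan" where
  "antiholo_vec b = (0, b)"

definition ctan_conj :: "'n::finite ctan \<Rightarrow> 'n ctan" where
  "ctan_conj Z = (cnjv (snd Z), cnjv (fst Z))"

text \<open>The real tangent vector \<open>v\<close>, and the decomposition \<open>Z = X + \<i> Y\<close> with \<open>X\<close>, \<open>Y\<close> real.\<close>
definition real_tan :: "complex^'n::finite \<Rightarrow> 'n ctan" where
  "real_tan v = (v, cnjv v)"

definition re_tan :: "'n::finite ctan \<Rightarrow> complex^'n" where
  "re_tan Z = (1 / 2) *s (fst Z + cnjv (snd Z))"

definition im_tan :: "'n::finite ctan \<Rightarrow> complex^'n" where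
  "im_tan Z = (1 / (2 * \<i>)) *s (fst Z - cnjv (snd Z))"

definition cderiv :: "(complex^'n::finite \<Rightarrow> complex) \<Rightarrow> complex^'n \<Rightarrow> 'n ctan \<Rightarrow> complex" where
  "cderiv f x Z = frechet_derivative f (at x) (re_tan Z) + \<i> * frechet_derivative f (at x) (im_tan Z)"

text \<open>Complex bilinear extension of a real bilinear form.\<close>
definition cext :: "(complex^'n::finite \<Rightarrow> complex^'n \<Rightarrow> real) \<Rightarrow> 'n ctan \<Rightarrow> 'n ctan \<Rightarrow> complex" where
  "cext B Z W =
     complex_of_real (B (re_tan Z) (re_tan W) - B (im_tan Z) (im_tan W)) +
     \<i> * complex_of_real (B (re_tan Z) (im_tan W) + B (im_tan Z) (re_tan W))"

definition ctan_map :: "(complex^'n::finite \<Rightarrow> complex^'n) \<Rightarrow> 'n ctan \<Rightarrow> 'n ctan" where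
  "ctan_map L Z = real_tan (L (re_tan Z)) + pscale \<i> (real_tan (L (im_tan Z)))"

definition form_on :: "(complex^'n::finite) set \<Rightarrow> nat \<Rightarrow> 'n cform \<Rightarrow> bool" where
  "form_on V k \<alpha> \<longleftrightarrow>
     (\<forall>x\<in>V. \<forall>Zs. length Zs = k \<longrightarrow>
        (\<forall>i<k. \<forall>c Z W. \<alpha> x (Zs[i := pscale c Z + W]) = c * \<alpha> x (Zs[i := Z]) + \<alpha> x (Zs[i := W])) \<and>
        (\<forall>i<k. \<forall>j<k. i \<noteq> j \<longrightarrow> Zs ! i = Zs ! j \<longrightarrow> \<alpha> x Zs = 0)) \<and>
     (\<forall>Zs. length Zs = k \<longrightarrow> smooth_on V (\<lambda>x. \<alpha> x Zs))"

text \<open>The formula for the exterior derivative on constant vector fields.\<close>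
definition ext_d :: "'n::finite cform \<Rightarrow> 'n cform" where
  "ext_d \<alpha> x Zs =
     (\<Sum>i<length Zs. (- 1) ^ i * cderiv (\<lambda>y. \<alpha> y (take i Zs @ drop (Suc i) Zs)) x (Zs ! i))"

definition pq_part :: "nat \<Rightarrow> nat \<Rightarrow> 'n::finite cform \<Rightarrow> 'n cform" where
  "pq_part p q \<alpha> x Zs =
     (if length Zs = p + q
      then \<Sum>S | S \<subseteq> {..<p + q} \<and> card S = p.
             \<alpha> x (map (\<lambda>i. if i \<in> S then holo_vec (fst (Zs ! i)) else antiholo_vec (snd (Zs ! i))) [0..<p + q])
      else 0)"

text \<open>To be applied to forms of type \<open>(p, q)\<close>.\<close>
definition del :: "nat \<Rightarrow> nat \<Rightarrow> 'n::finite cform \<Rightarrow> 'n cform" where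
  "del p q \<alpha> = pq_part (Suc p) q (ext_d \<alpha>)"

definition delbar :: "nat \<Rightarrow> nat \<Rightarrow> 'n::finite cform \<Rightarrow> 'n cform" where
  "delbar p q \<alpha> = pq_part p (Suc q) (ext_d \<alpha>)"

section \<open>Local Hermitian geometry\<close>

type_synonym 'n metric = "complex^'n \<Rightarrow> complex^'n \<Rightarrow> complex^'n \<Rightarrow> real"
type_synonym 'n vfield = "complex^'n \<Rightarrow> complex^'n"

definition J :: "complex^'n::finite \<Rightarrow> complex^'n" where
  "J v = \<i> *s v"

definition hermitian_on :: "(complex^'n::finite) set \<Rightarrow> 'n metric \<Rightarrow> bool" where
  "hermitian_on V g \<longleftrightarrow>
     (\<forall>x\<in>V. bilinear (g x) \<and> (\<forall>v w. g x v w = g x w v) \<and> (\<forall>v. v \<noteq> 0 \<longrightarrow> g x v v > 0) \<and>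
        (\<forall>v w. g x (J v) (J w) = g x v w)) \<and>
     (\<forall>v w. smooth_on V (\<lambda>x. g x v w))"

definition fund_form :: "'n::finite metric \<Rightarrow> 'n cform" where
  "fund_form g x Zs = cext (\<lambda>v w. g x (J v) w) (Zs ! 0) (Zs ! 1)"

definition dc_fund_form :: "'n::finite metric \<Rightarrow> 'n cform" where
  "dc_fund_form g x Zs = \<i> * (delbar 1 1 (fund_form g) x Zs - del 1 1 (fund_form g) x Zs)"

text \<open>Christoffel symbols of the Levi-Civita connection: torsion-free and metric.\<close>
definition christoffel :: "'n::finite metric \<Rightarrow> complex^'n \<Rightarrow> complex^'n \<Rightarrow> complex^'n \<Rightarrow> complex^'n" where
  "christoffel g x = (THE \<Gamma>. bilinear \<Gamma> \<and> (\<forall>v w. \<Gamma> v w = \<Gamma> w v) \<and>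
     (\<forall>u v w. frechet_derivative (\<lambda>y. g y v w) (at x) u = g x (\<Gamma> u v) w + g x v (\<Gamma> u w)))"

definition levi_civita :: "'n::finite metric \<Rightarrow> 'n vfield \<Rightarrow> 'n vfield \<Rightarrow> 'n vfield" where
  "levi_civita g X Y x = frechet_derivative Y (at x) (X x) + christoffel g x (X x) (Y x)"

text \<open>\<open>d\<^sup>c\<omega>\<close> is a real form: \<open>Re\<close> only converts the type of its values on real vectors.\<close>
definition bismut :: "'n::finite metric \<Rightarrow> 'n vfield \<Rightarrow> 'n vfield \<Rightarrow> 'n vfield" where
  "bismut g X Y x = (THE w. \<forall>z. g x w z =
     g x (levi_civita g X Y x) z
       - 1 / 2 * Re (dc_fund_form g x [real_tan (X x), real_tan (Y x), real_tan z]))"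

definition lie_bracket :: "'n::finite vfield \<Rightarrow> 'n vfield \<Rightarrow> 'n vfield" where
  "lie_bracket X Y x = frechet_derivative Y (at x) (X x) - frechet_derivative X (at x) (Y x)"

definition bismut_curvature ::
  "'n::finite metric \<Rightarrow> 'n vfield \<Rightarrow> 'n vfield \<Rightarrow> 'n vfield \<Rightarrow> 'n vfield" where
  "bismut_curvature g X Y Z x =
     bismut g X (bismut g Y Z) x - bismut g Y (bismut g X Z) x - bismut g (lie_bracket X Y) Z x"

definition orthonormal_basis :: "(complex^'n::finite \<Rightarrow> complex^'n \<Rightarrow> real) \<Rightarrow> (complex^'n) set" where
  "orthonormal_basis b = (SOME B. finite B \<and> card B = DIM(complex^'n) \<and>
     (\<forall>e\<in>B. \<forall>f\<in>B. b e f = (if e = f then 1 else 0)))"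

text \<open>The curvature is tensorial, so tangent vectors are extended to constant vector fields.\<close>
definition bismut_ricci :: "'n::finite metric \<Rightarrow> complex^'n \<Rightarrow> complex^'n \<Rightarrow> complex^'n \<Rightarrow> real" where
  "bismut_ricci g x u v =
     1 / 2 * (\<Sum>e\<in>orthonormal_basis (g x).
       g x (bismut_curvature g (\<lambda>_. u) (\<lambda>_. v) (\<lambda>_. J e) x) e)"

definition bismut_ricci_form :: "'n::finite metric \<Rightarrow> 'n cform" where
  "bismut_ricci_form g x Zs = cext (bismut_ricci g x) (Zs ! 0) (Zs ! 1)"

section \<open>Pluriclosed flow on a complex manifold\<close>

definition hermitian_metric ::
  "('m, 'n::finite) chart set \<Rightarrow> (('m, 'n) chart \<Rightarrow> 'n metric) \<Rightarrow> bool" where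
  "hermitian_metric \<A> g \<longleftrightarrow>
     (\<forall>c\<in>\<A>. hermitian_on (chart_image c) (g c)) \<and>
     (\<forall>c\<in>\<A>. \<forall>c'\<in>\<A>. \<forall>x\<in>chart_overlap c c'. \<forall>v w.
        g c x v w = g c' (transition c c' x) (frechet_derivative (transition c c') (at x) v)
                                             (frechet_derivative (transition c c') (at x) w))"

definition pluriclosed_metric ::
  "('m, 'n::finite) chart set \<Rightarrow> (('m, 'n) chart \<Rightarrow> 'n metric) \<Rightarrow> bool" where
  "pluriclosed_metric \<A> g \<longleftrightarrow> hermitian_metric \<A> g \<and>
     (\<forall>c\<in>\<A>. \<forall>x\<in>chart_image c. \<forall>Zs. length Zs = 4 \<longrightarrow>
        del 1 2 (delbar 1 1 (fund_form (g c))) x Zs = 0)"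

definition form_20 ::
  "('m, 'n::finite) chart set \<Rightarrow> (('m, 'n) chart \<Rightarrow> 'n cform) \<Rightarrow> bool" where
  "form_20 \<A> \<beta> \<longleftrightarrow>
     (\<forall>c\<in>\<A>. form_on (chart_image c) 2 (\<beta> c) \<and>
        (\<forall>x\<in>chart_image c. \<forall>Zs. length Zs = 2 \<longrightarrow> pq_part 2 0 (\<beta> c) x Zs = \<beta> c x Zs)) \<and>
     (\<forall>c\<in>\<A>. \<forall>c'\<in>\<A>. \<forall>x\<in>chart_overlap c c'. \<forall>Zs. length Zs = 2 \<longrightarrow>
        \<beta> c x Zs = \<beta> c' (transition c c' x)
                        (map (ctan_map (frechet_derivative (transition c c') (at x))) Zs))"

definition pluriclosed_flow ::
  "('m, 'n::finite) chart set \<Rightarrow> real set \<Rightarrow> (real \<Rightarrow> ('m, 'n) chart \<Rightarrow> 'n metric) \<Rightarrow>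
   (real \<Rightarrow> ('m, 'n) chart \<Rightarrow> 'n cform) \<Rightarrow> bool" where
  "pluriclosed_flow \<A> I g \<beta> \<longleftrightarrow>
     (\<forall>t\<in>I. pluriclosed_metric \<A> (g t) \<and> form_20 \<A> (\<beta> t)) \<and>
     (\<forall>c\<in>\<A>. (\<forall>v w. smooth_family I (chart_image c) (\<lambda>t x. g t c x v w)) \<and>
        (\<forall>Zs. length Zs = 2 \<longrightarrow> smooth_family I (chart_image c) (\<lambda>t x. \<beta> t c x Zs))) \<and>
     (\<forall>c\<in>\<A>. \<forall>x\<in>chart_image c. \<forall>t\<in>I.
        (\<forall>Zs. length Zs = 2 \<longrightarrow>
           ((\<lambda>s. fund_form (g s c) x Zs) has_vector_derivative
              - pq_part 1 1 (bismut_ricci_form (g t c)) x Zs) (at t within I) \<and>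
           ((\<lambda>s. \<beta> s c x Zs) has_vector_derivative
              - pq_part 2 0 (bismut_ricci_form (g t c)) x Zs) (at t within I)) \<and>
        (\<forall>Zs. length Zs = 3 \<longrightarrow>
           delbar 2 0 (\<beta> t c) x Zs =
             del 1 1 (fund_form (g 0 c)) x Zs - del 1 1 (fund_form (g t c)) x Zs))"

section \<open>The bundle \<open>\<Q>\<close> and generalized Hermitian metrics\<close>

text \<open>In a chart, \<open>(X, \<xi>)\<close> stands for \<open>\<Sum>i. X\<^sub>i \<partial>/\<partial>z\<^sub>i + \<xi>\<^sub>i dz\<^sub>i\<close>, so that \<open>\<Q>\<close> is trivialized over the chart.\<close>
type_synonym 'n qfib = "(complex^'n) \<times> (complex^'n)"
type_synonym 'n qsec = "complex^'n \<Rightarrow> 'n qfib"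

definition covec_form :: "(complex^'n::finite \<Rightarrow> complex^'n) \<Rightarrow> 'n cform" where
  "covec_form \<xi> x Zs = (\<Sum>i\<in>UNIV. \<xi> x $ i * fst (Zs ! 0) $ i)"

definition contract :: "'n::finite vfield \<Rightarrow> 'n cform \<Rightarrow> 'n cform" where
  "contract X \<tau> x Zs = \<tau> x (holo_vec (X x) # Zs)"

text \<open>The Dolbeault operator of \<open>\<Q>\<close> with twist \<open>\<tau> = \<partial>\<omega>\<^sub>0\<close>, in the direction \<open>\<Sum>i. b\<^sub>i \<partial>/\<partial>zbar\<^sub>i\<close>.\<close>
definition q_dbar :: "'n::finite cform \<Rightarrow> complex^'n \<Rightarrow> 'n qsec \<Rightarrow> 'n qsec" where
  "q_dbar \<tau> b s x =
     (\<chi> i. cderiv (\<lambda>y. fst (s y) $ i) x (antiholo_vec b),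
      \<chi> i. delbar 1 0 (covec_form (\<lambda>y. snd (s y))) x [antiholo_vec b, holo_vec (axis i 1)]
           - \<i> * contract (\<lambda>y. fst (s y)) \<tau> x [antiholo_vec b, holo_vec (axis i 1)])"

text \<open>The matrix \<open>g(\<partial>/\<partial>z\<^sub>i, \<partial>/\<partial>zbar\<^sub>j)\<close>; row \<open>j\<close> and column \<open>i\<close> of its inverse carry the
  barred and the unbarred index, respectively.\<close>
definition metric_matrix :: "'n::finite metric \<Rightarrow> complex^'n \<Rightarrow> complex^'n^'n" where
  "metric_matrix g x = (\<chi> i j. cext (g x) (holo_vec (axis i 1)) (antiholo_vec (axis j 1)))"

definition beta_shift :: "'n::finite cform \<Rightarrow> complex^'n \<Rightarrow> 'n qfib \<Rightarrow> complex^'n" where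
  "beta_shift \<beta> x u = snd u + \<i> *s (\<chi> k. contract (\<lambda>_. fst u) \<beta> x [holo_vec (axis k 1)])"

text \<open>The sesquilinear form, antilinear in the second argument, of the quadratic expression defining \<open>G\<close>.\<close>
definition gen_metric ::
  "'n::finite metric \<Rightarrow> 'n cform \<Rightarrow> complex^'n \<Rightarrow> 'n qfib \<Rightarrow> 'n qfib \<Rightarrow> complex" where
  "gen_metric g \<beta> x u v =
     cext (g x) (holo_vec (fst u)) (ctan_conj (holo_vec (fst v))) +
     (\<Sum>i\<in>UNIV. \<Sum>j\<in>UNIV. matrix_inv (metric_matrix g x) $ j $ i *
        beta_shift \<beta> x u $ i * cnj (beta_shift \<beta> x v $ j))"

text \<open>Connection form \<open>\<theta>\<close> of the Chern connection \<open>D = d + \<theta>\<close> of a Hermitian metric \<open>G\<close> and a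
  Dolbeault operator \<open>\<delta>\<close>: its \<open>(0,1)\<close>-part is \<open>\<delta>\<close> and \<open>D\<close> preserves \<open>G\<close>.  By the Leibniz rule both
  conditions need only be stated for constant sections.\<close>
definition chern_form ::
  "(complex^'n::finite \<Rightarrow> 'n qsec \<Rightarrow> 'n qsec) \<Rightarrow> (complex^'n \<Rightarrow> 'n qfib \<Rightarrow> 'n qfib \<Rightarrow> complex) \<Rightarrow>
   complex^'n \<Rightarrow> 'n ctan \<Rightarrow> 'n qfib \<Rightarrow> 'n qfib" where
  "chern_form \<delta> G x = (THE \<theta>.
     (\<forall>u. clin (\<lambda>Z. \<theta> Z u)) \<and> (\<forall>Z. clin (\<theta> Z)) \<and>
     (\<forall>b u. \<theta> (antiholo_vec b) u = \<delta> b (\<lambda>_. u) x) \<and>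
     (\<forall>Z u v. cderiv (\<lambda>y. G y u v) x Z = G x (\<theta> Z u) v + G x u (\<theta> (ctan_conj Z) v)))"

type_synonym 'n cvfield = "complex^'n \<Rightarrow> 'n ctan"

definition pair_deriv ::
  "(complex^'n::finite \<Rightarrow> (complex^'n) \<times> (complex^'n)) \<Rightarrow> complex^'n \<Rightarrow> 'n ctan \<Rightarrow> (complex^'n) \<times> (complex^'n)" where
  "pair_deriv s x Z = (\<chi> i. cderiv (\<lambda>y. fst (s y) $ i) x Z, \<chi> i. cderiv (\<lambda>y. snd (s y) $ i) x Z)"

definition chern_conn ::
  "(complex^'n::finite \<Rightarrow> 'n qsec \<Rightarrow> 'n qsec) \<Rightarrow> (complex^'n \<Rightarrow> 'n qfib \<Rightarrow> 'n qfib \<Rightarrow> complex) \<Rightarrow>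
   'n cvfield \<Rightarrow> 'n qsec \<Rightarrow> 'n qsec" where
  "chern_conn \<delta> G Z s x = pair_deriv s x (Z x) + chern_form \<delta> G x (Z x) (s x)"

definition clie_bracket :: "'n::finite cvfield \<Rightarrow> 'n cvfield \<Rightarrow> 'n cvfield" where
  "clie_bracket Z W x = pair_deriv W x (Z x) - pair_deriv Z x (W x)"

definition chern_curvature ::
  "(complex^'n::finite \<Rightarrow> 'n qsec \<Rightarrow> 'n qsec) \<Rightarrow> (complex^'n \<Rightarrow> 'n qfib \<Rightarrow> 'n qfib \<Rightarrow> complex) \<Rightarrow>
   'n cvfield \<Rightarrow> 'n cvfield \<Rightarrow> 'n qsec \<Rightarrow> 'n qsec" where
  "chern_curvature \<delta> G Z W s x =
     chern_conn \<delta> G Z (chern_conn \<delta> G W s) x - chern_conn \<delta> G W (chern_conn \<delta> G Z s) x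
       - chern_conn \<delta> G (clie_bracket Z W) s x"

text \<open>\<open>S\<^sup>G\<^sub>g\<close> for the Dolbeault operator with twist \<open>\<tau>\<close> and the metric \<open>G(\<omega>, \<beta>)\<close>.\<close>
definition S_end ::
  "'n::finite cform \<Rightarrow> 'n metric \<Rightarrow> 'n cform \<Rightarrow> complex^'n \<Rightarrow> 'n qfib \<Rightarrow> 'n qfib" where
  "S_end \<tau> g \<beta> x u =
     (\<Sum>i\<in>UNIV. \<Sum>j\<in>UNIV. pscale (matrix_inv (metric_matrix g x) $ j $ i)
        (chern_curvature (q_dbar \<tau>) (gen_metric g \<beta>)
           (\<lambda>_. holo_vec (axis i 1)) (\<lambda>_. antiholo_vec (axis j 1)) (\<lambda>_. u) x))"

definition Ginv_dt ::
  "real set \<Rightarrow> (real \<Rightarrow> 'n qfib \<Rightarrow> 'n qfib \<Rightarrow> complex) \<Rightarrow> real \<Rightarrow> 'n::finite qfib \<Rightarrow> 'n qfib" where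
  "Ginv_dt I G t = (THE A. clin A \<and>
     (\<forall>u v. G t (A u) v = vector_derivative (\<lambda>s. G s u v) (at t within I)))"

end

theory Submission
  imports Defs
begin

text \<open>
  The automorphism \<open>(X, \<xi>) \<mapsto> (X, \<xi> + \<i>\<beta>(X))\<close> carries \<open>G(\<omega>, \<beta>)\<close> to the direct sum of \<open>g\<close> and its inverse and,
  since \<open>\<partial>bar \<beta> = \<partial>\<omega>\<^sub>0 - \<partial>\<omega>\<close>, turns the twist \<open>\<partial>\<omega>\<^sub>0\<close> of the Dolbeault operator into \<open>\<partial>\<omega>\<close>.  There the Chern
  connection is a block matrix: the Chern connections of \<open>g\<close> and of its inverse on the diagonal, \<open>\<partial>\<omega>\<close> and
  minus its adjoint off the diagonal.  As the Bismut connection is complex linear on \<open>T\<^sup>1\<^sup>0\<close>, its Ricci form is \<open>\<i>\<close> times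
  the exterior derivative of the trace of its connection form.  Comparing coefficients, the contracted
  off-diagonal block is a multiple of \<open>\<rho>\<^sub>B\<^sup>2\<^sup>0\<close> for every Hermitian metric, whereas for the diagonal block \<open>\<partial>\<partial>bar \<omega> = 0\<close> is needed to
  trade the contracted second derivatives of \<open>g\<close> for those in \<open>\<rho>\<^sub>B\<^sup>1\<^sup>1\<close>.  The other two blocks are the
  (skew-)adjoints of these.
\<close>

section \<open>Calculus on open sets\<close>

text \<open>All work is done in one chart with the coefficients h_{i jbar} = g(d_i, d_jbar)
  (\<open>hc\<close>), the inverse matrix (\<open>hi\<close>) and their Wirtinger derivatives up to
  second order. No normal coordinates are chosen, so besides the second derivatives of h the
  products of two first derivatives have to agree as well; these are brought to one normal form, a
  double contraction with the inverse metric.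

  The Christoffel symbols, the Bismut connection, the Chern connection form and G^{-1} dG/dt are
  definite descriptions. Each is replaced by an explicit candidate that satisfies the conditions,
  and nondegeneracy of g or of G leaves no other. The final equality is tested in the same way, by
  pairing with an arbitrary v.

  The constants fit because \<omega>(d_p, d_qbar) = i h_{p qbar} and the shift is i \<beta>: under
  the flow h moves by i \<rho>^{1,1} and the shift by -i \<rho>^{2,0}. As G depends on t only
  through h, its inverse and the shift, the product rule gives four terms, one for h, one for the
  inverse and one for the shift in each argument; these are the four blocks of the contracted
  curvature.\<close>

lemma Ck_on_cong:
  assumes "open S" "\<And>x. x \<in> S \<Longrightarrow> f x = g x" "Ck_on k S f"
  shows "Ck_on k S g"
  using assms(2,3)
proof (induction k arbitrary: f g)
  case 0
  then show ?case using continuous_on_cong[of S S f g] by auto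
next
  case (Suc k)
  have der: "frechet_derivative f (at x) = frechet_derivative g (at x)" if "x \<in> S" for x
    using frechet_derivative_transform_within_open[OF _ assms(1) that] Suc.prems that by auto
  have "g differentiable (at x)" if "x \<in> S" for x
  proof -
    from Suc.prems that obtain L where "(f has_derivative L) (at x)" by (auto simp: differentiable_def)
    then have "(g has_derivative L) (at x)"
      by (rule has_derivative_transform_within_open[OF _ assms(1) that]) (use Suc.prems in auto)
    then show ?thesis by (auto simp: differentiable_def)
  qed
  moreover have "Ck_on k S (\<lambda>x. frechet_derivative g (at x) v)" for v
    by (rule Suc.IH[of "\<lambda>x. frechet_derivative f (at x) v"]) (use Suc.prems der in auto)
  ultimately show ?case by simp
qed

lemma Ck_on_bounded_linear:
  assumes "open S" "bounded_linear L" "Ck_on k S f"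
  shows "Ck_on k S (\<lambda>x. L (f x))"
  using assms(3)
proof (induction k arbitrary: f)
  case 0
  then show ?case using assms(2) by (auto intro: bounded_linear.continuous_on)
next
  case (Suc k)
  have D: "((\<lambda>x. L (f x)) has_derivative (\<lambda>v. L (frechet_derivative f (at x) v))) (at x)" if "x \<in> S" for x
    using Suc.prems that
    by (auto intro!: bounded_linear.has_derivative[OF assms(2)] simp: frechet_derivative_works[symmetric])
  have "Ck_on k S (\<lambda>x. frechet_derivative (\<lambda>x. L (f x)) (at x) v)" for v
    by (rule Ck_on_cong[OF assms(1) _ Suc.IH[of "\<lambda>x. frechet_derivative f (at x) v"]])
      (use Suc.prems in \<open>auto simp: frechet_derivative_at[OF D, symmetric]\<close>)
  then show ?case using D by (auto simp: differentiable_def)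
qed

lemma Ck_on_add:
  assumes "open S" "Ck_on k S f" "Ck_on k S g"
  shows "Ck_on k S (\<lambda>x. f x + g x)"
  using assms(2,3)
proof (induction k arbitrary: f g)
  case 0
  then show ?case by (auto intro: continuous_intros)
next
  case (Suc k)
  have D: "((\<lambda>x. f x + g x) has_derivative
      (\<lambda>v. frechet_derivative f (at x) v + frechet_derivative g (at x) v)) (at x)" if "x \<in> S" for x
    using Suc.prems that by (auto intro!: has_derivative_add simp: frechet_derivative_works[symmetric])
  have "Ck_on k S (\<lambda>x. frechet_derivative (\<lambda>x. f x + g x) (at x) v)" for v
    by (rule Ck_on_cong[OF assms(1) _
          Suc.IH[of "\<lambda>x. frechet_derivative f (at x) v" "\<lambda>x. frechet_derivative g (at x) v"]])
      (use Suc.prems in \<open>auto simp: frechet_derivative_at[OF D, symmetric]\<close>)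
  then show ?case using D by (auto simp: differentiable_def)
qed

text \<open>The mean value theorem is applied twice, along \<open>u\<close> to the increment over
  \<open>h *\<^sub>R v\<close> and then along \<open>v\<close>. This turns the second difference
  into the mixed derivative at an intermediate point, which continuity compares with the one at
  \<open>x\<close>.\<close>

lemma second_difference:
  fixes f :: "'a::real_normed_vector \<Rightarrow> real"
  assumes "open S" "x \<in> S" "Ck_on (Suc (Suc 0)) S f" "e > 0"
  shows "\<exists>d>0. \<forall>h. 0 < h \<and> h < d \<longrightarrow>
    \<bar>(f (x + h *\<^sub>R u + h *\<^sub>R v) - f (x + h *\<^sub>R u) - f (x + h *\<^sub>R v) + f x) -
      h * h * frechet_derivative (\<lambda>y. frechet_derivative f (at y) u) (at x) v\<bar> \<le> h * h * e"
proof -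
  let ?D1 = "\<lambda>y. frechet_derivative f (at y) u"
  let ?D2 = "\<lambda>y. frechet_derivative ?D1 (at y) v"
  have f1: "(f has_derivative frechet_derivative f (at y)) (at y)" if "y \<in> S" for y
    using assms(3) that by (auto simp: frechet_derivative_works[symmetric])
  have f2: "(?D1 has_derivative frechet_derivative ?D1 (at y)) (at y)" if "y \<in> S" for y
    using assms(3) that by (auto simp: frechet_derivative_works[symmetric])
  have "continuous_on S ?D2" using assms(3) by auto
  then have "isCont ?D2 x" using assms(1,2) by (simp add: continuous_on_eq_continuous_at)
  then obtain d1 where d1: "d1 > 0" "\<And>y. dist y x < d1 \<Longrightarrow> dist (?D2 y) (?D2 x) < e"
    using \<open>e > 0\<close> unfolding continuous_at_eps_delta by blast
  obtain d2 where d2: "d2 > 0" "\<And>y. dist y x < d2 \<Longrightarrow> y \<in> S"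
    using assms(1,2) unfolding open_dist by blast
  \<comment> \<open>With this scale the whole parallelogram spanned by \<open>h *\<^sub>R u\<close>
    and \<open>h *\<^sub>R v\<close> lies in \<open>S\<close> and in the ball of continuity; the
    summand 1 keeps \<open>K\<close> positive when both vectors vanish.\<close>
  define K where "K = norm u + norm v + 1"
  define d where "d = min d1 d2 / K"
  have K: "K > 0" by (simp add: K_def add_nonneg_pos)
  have "d > 0" using d1(1) d2(1) K by (simp add: d_def)
  have near: "dist (x + s *\<^sub>R u + r *\<^sub>R v) x < min d1 d2" if "0 \<le> s" "s \<le> h" "0 \<le> r" "r \<le> h" "0 < h" "h < d" for s r h
  proof -
    have "dist (x + s *\<^sub>R u + r *\<^sub>R v) x = norm (s *\<^sub>R u + r *\<^sub>R v)" by (simp add: dist_norm add.assoc)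
    also have "\<dots> \<le> s * norm u + r * norm v"
      by (rule order.trans[OF norm_triangle_ineq]) (use that in auto)
    also have "\<dots> \<le> h * norm u + h * norm v" using that by (intro add_mono mult_right_mono) auto
    also have "\<dots> < h * K" using that by (simp add: K_def algebra_simps)
    also have "\<dots> < d * K" using that K by simp
    also have "\<dots> = min d1 d2" using K by (simp add: d_def)
    finally show ?thesis .
  qed
  have "\<bar>(f (x + h *\<^sub>R u + h *\<^sub>R v) - f (x + h *\<^sub>R u) - f (x + h *\<^sub>R v) + f x) - h * h * ?D2 x\<bar> \<le> h * h * e"
    if h: "0 < h" "h < d" for h
  proof -
    let ?p = "\<lambda>s. f (x + s *\<^sub>R u + h *\<^sub>R v) - f (x + s *\<^sub>R u)"
    have inS: "x + s *\<^sub>R u + r *\<^sub>R v \<in> S" if "0 \<le> s" "s \<le> h" "0 \<le> r" "r \<le> h" for s r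
      using near[OF that h] d2 by simp
    have line: "((\<lambda>s. f (x + s *\<^sub>R u + r *\<^sub>R v)) has_real_derivative ?D1 (x + s *\<^sub>R u + r *\<^sub>R v)) (at s)"
      if "0 \<le> s" "s \<le> h" "0 \<le> r" "r \<le> h" for s r
    proof -
      have "((\<lambda>s. f (x + s *\<^sub>R u + r *\<^sub>R v)) has_derivative
        (\<lambda>t. frechet_derivative f (at (x + s *\<^sub>R u + r *\<^sub>R v)) (t *\<^sub>R u))) (at s)"
        by (rule has_derivative_compose[of "\<lambda>s. x + s *\<^sub>R u + r *\<^sub>R v" "\<lambda>t. t *\<^sub>R u" s UNIV f])
          (use f1[OF inS[OF that]] in \<open>auto intro!: derivative_eq_intros\<close>)
      moreover have "frechet_derivative f (at (x + s *\<^sub>R u + r *\<^sub>R v)) (t *\<^sub>R u) = ?D1 (x + s *\<^sub>R u + r *\<^sub>R v) * t" for t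
        using linear_cmul[OF has_derivative_linear[OF f1[OF inS[OF that]]], of t u] by simp
      ultimately show ?thesis by (simp add: has_field_derivative_def)
    qed
    have "\<exists>s. 0 < s \<and> s < h \<and> ?p h - ?p 0 = (h - 0) * (?D1 (x + s *\<^sub>R u + h *\<^sub>R v) - ?D1 (x + s *\<^sub>R u))"
      by (rule MVT2[OF h(1)], rule DERIV_diff) (use h line[of _ h] line[of _ 0] in auto)
    then obtain s where s: "0 < s" "s < h" "?p h - ?p 0 = h * (?D1 (x + s *\<^sub>R u + h *\<^sub>R v) - ?D1 (x + s *\<^sub>R u))"
      by auto
    have line2: "((\<lambda>r. ?D1 (x + s *\<^sub>R u + r *\<^sub>R v)) has_real_derivative ?D2 (x + s *\<^sub>R u + r *\<^sub>R v)) (at r)"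
      if "0 \<le> r" "r \<le> h" for r
    proof -
      have in': "x + s *\<^sub>R u + r *\<^sub>R v \<in> S" using inS s that by simp
      have "((\<lambda>r. ?D1 (x + s *\<^sub>R u + r *\<^sub>R v)) has_derivative
        (\<lambda>t. frechet_derivative ?D1 (at (x + s *\<^sub>R u + r *\<^sub>R v)) (t *\<^sub>R v))) (at r)"
        by (rule has_derivative_compose[of "\<lambda>r. x + s *\<^sub>R u + r *\<^sub>R v" "\<lambda>t. t *\<^sub>R v" r UNIV ?D1])
          (use f2[OF in'] in \<open>auto intro!: derivative_eq_intros\<close>)
      moreover have "frechet_derivative ?D1 (at (x + s *\<^sub>R u + r *\<^sub>R v)) (t *\<^sub>R v) = ?D2 (x + s *\<^sub>R u + r *\<^sub>R v) * t" for t
        using linear_cmul[OF has_derivative_linear[OF f2[OF in']], of t v] by simp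
      ultimately show ?thesis by (simp add: has_field_derivative_def)
    qed
    have "\<exists>r. 0 < r \<and> r < h \<and> ?D1 (x + s *\<^sub>R u + h *\<^sub>R v) - ?D1 (x + s *\<^sub>R u + 0 *\<^sub>R v) =
        (h - 0) * ?D2 (x + s *\<^sub>R u + r *\<^sub>R v)"
      by (rule MVT2[OF h(1)]) (use line2 in auto)
    then obtain r where r: "0 < r" "r < h"
      "?D1 (x + s *\<^sub>R u + h *\<^sub>R v) - ?D1 (x + s *\<^sub>R u) = h * ?D2 (x + s *\<^sub>R u + r *\<^sub>R v)" by auto
    have eq: "f (x + h *\<^sub>R u + h *\<^sub>R v) - f (x + h *\<^sub>R u) - f (x + h *\<^sub>R v) + f x = h * h * ?D2 (x + s *\<^sub>R u + r *\<^sub>R v)"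
      using s(3) r(3) by (simp add: algebra_simps)
    have "\<bar>?D2 (x + s *\<^sub>R u + r *\<^sub>R v) - ?D2 x\<bar> \<le> e"
      using d1(2)[of "x + s *\<^sub>R u + r *\<^sub>R v"] near[of s h r] s r h by (auto simp: dist_real_def)
    then have "h * h * \<bar>?D2 (x + s *\<^sub>R u + r *\<^sub>R v) - ?D2 x\<bar> \<le> h * h * e"
      by (intro mult_left_mono) auto
    moreover have "\<bar>h * h * ?D2 (x + s *\<^sub>R u + r *\<^sub>R v) - h * h * ?D2 x\<bar> = h * h * \<bar>?D2 (x + s *\<^sub>R u + r *\<^sub>R v) - ?D2 x\<bar>"
      by (simp add: abs_mult right_diff_distrib[symmetric])
    ultimately show ?thesis using eq by simp
  qed
  then show ?thesis using \<open>d > 0\<close> by blast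
qed

text \<open>The second difference does not change when \<open>u\<close> and \<open>v\<close> are
  exchanged, and both mixed derivatives are its limit after division by \<open>h * h\<close>. A
  third of the supposed gap is the tolerance, since two errors then cannot fill the gap.\<close>

lemma real_second_derivative_symmetric:
  fixes f :: "'a::real_normed_vector \<Rightarrow> real"
  assumes "open S" "x \<in> S" "Ck_on (Suc (Suc 0)) S f"
  shows "frechet_derivative (\<lambda>y. frechet_derivative f (at y) u) (at x) v =
    frechet_derivative (\<lambda>y. frechet_derivative f (at y) v) (at x) u" (is "?a = ?b")
proof (rule ccontr)
  assume "?a \<noteq> ?b"
  define e where "e = \<bar>?a - ?b\<bar> / 3"
  have "e > 0" using \<open>?a \<noteq> ?b\<close> by (simp add: e_def)
  obtain d1 where d1: "d1 > 0" "\<And>h. 0 < h \<Longrightarrow> h < d1 \<Longrightarrow>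
      \<bar>(f (x + h *\<^sub>R u + h *\<^sub>R v) - f (x + h *\<^sub>R u) - f (x + h *\<^sub>R v) + f x) - h * h * ?a\<bar> \<le> h * h * e"
    using second_difference[OF assms \<open>e > 0\<close>, of u v] by blast
  obtain d2 where d2: "d2 > 0" "\<And>h. 0 < h \<Longrightarrow> h < d2 \<Longrightarrow>
      \<bar>(f (x + h *\<^sub>R v + h *\<^sub>R u) - f (x + h *\<^sub>R v) - f (x + h *\<^sub>R u) + f x) - h * h * ?b\<bar> \<le> h * h * e"
    using second_difference[OF assms \<open>e > 0\<close>, of v u] by blast
  define h where "h = min d1 d2 / 2"
  have h: "0 < h" "h < d1" "h < d2" using d1(1) d2(1) by (auto simp: h_def)
  have "\<bar>h * h * ?a - h * h * ?b\<bar> \<le> h * h * e + h * h * e"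
    using d1(2)[OF h(1,2)] d2(2)[OF h(1,3)] by (simp add: algebra_simps)
  moreover have "\<bar>h * h * ?a - h * h * ?b\<bar> = h * h * \<bar>?a - ?b\<bar>"
    by (simp add: abs_mult right_diff_distrib[symmetric])
  ultimately have "(h * h) * \<bar>?a - ?b\<bar> \<le> (h * h) * (2 * e)" by (simp add: algebra_simps)
  then have "\<bar>?a - ?b\<bar> \<le> 2 * e" using h(1) by (simp only: mult_le_cancel_left_pos mult_pos_pos)
  then show False using \<open>e > 0\<close> by (simp add: e_def)
qed

lemma complex_second_derivative_symmetric:
  fixes f :: "'a::real_normed_vector \<Rightarrow> complex"
  assumes "open S" "x \<in> S" "Ck_on (Suc (Suc 0)) S f"
  shows "frechet_derivative (\<lambda>y. frechet_derivative f (at y) u) (at x) v =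
    frechet_derivative (\<lambda>y. frechet_derivative f (at y) v) (at x) u"
proof -
  \<comment> \<open>A bounded linear functional commutes with both derivatives, so that the real
    case applies to the real and the imaginary part.\<close>
  have part: "L (frechet_derivative (\<lambda>y. frechet_derivative f (at y) u) (at x) v) =
      frechet_derivative (\<lambda>y. frechet_derivative (\<lambda>y. L (f y)) (at y) u) (at x) v"
    if L: "bounded_linear L" for L :: "complex \<Rightarrow> real" and u v
  proof -
    have 1: "frechet_derivative (\<lambda>y. L (f y)) (at y) u = L (frechet_derivative f (at y) u)" if "y \<in> S" for y
    proof -
      have "((\<lambda>x. L (f x)) has_derivative (\<lambda>v. L (frechet_derivative f (at y) v))) (at y)"
        using assms(3) that by (auto intro!: bounded_linear.has_derivative[OF L] simp: frechet_derivative_works[symmetric])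
      then show ?thesis by (simp add: frechet_derivative_at[symmetric])
    qed
    have "((\<lambda>y. L (frechet_derivative f (at y) u)) has_derivative
        (\<lambda>v. L (frechet_derivative (\<lambda>y. frechet_derivative f (at y) u) (at x) v))) (at x)"
      using assms(2,3) by (auto intro!: bounded_linear.has_derivative[OF L] simp: frechet_derivative_works[symmetric])
    then have "((\<lambda>y. frechet_derivative (\<lambda>y. L (f y)) (at y) u) has_derivative
        (\<lambda>v. L (frechet_derivative (\<lambda>y. frechet_derivative f (at y) u) (at x) v))) (at x)"
      by (rule has_derivative_transform_within_open[OF _ assms(1,2)]) (simp add: 1)
    then show ?thesis by (simp add: frechet_derivative_at[symmetric])
  qed
  show ?thesis
    by (rule complex_eqI)
      (simp_all add: part bounded_linear_Re bounded_linear_Im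
        real_second_derivative_symmetric[OF assms(1,2) Ck_on_bounded_linear[OF assms(1) _ assms(3)]])
qed

section \<open>Complex directional derivatives\<close>

lemma axis_expand: "(\<Sum>i\<in>UNIV. (v $ i) *s axis i 1) = (v :: complex^'n::finite)"
  by (rule basis_expansion)

lemma re_tan_add: "re_tan (Z + W) = re_tan Z + re_tan W"
  and im_tan_add: "im_tan (Z + W) = im_tan Z + im_tan W"
  by (simp_all add: re_tan_def im_tan_def cnjv_def vec_eq_iff field_simps)

lemma im_tan_eq: "im_tan Z = (- \<i> / 2) *s (fst Z - cnjv (snd Z))"
  by (simp add: im_tan_def vec_eq_iff field_simps)

lemma re_tan_pscale: "re_tan (pscale c Z) = Re c *\<^sub>R re_tan Z - Im c *\<^sub>R im_tan Z"
  and im_tan_pscale: "im_tan (pscale c Z) = Re c *\<^sub>R im_tan Z + Im c *\<^sub>R re_tan Z"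
  by (simp_all add: re_tan_def im_tan_eq cnjv_def pscale_def vec_eq_iff complex_eq_iff field_simps)

lemma re_tan_conj: "re_tan (ctan_conj Z) = re_tan Z"
  and im_tan_conj: "im_tan (ctan_conj Z) = - im_tan Z"
  by (simp_all add: re_tan_def im_tan_def cnjv_def ctan_conj_def vec_eq_iff complex_eq_iff field_simps)

lemma real_tan_parts: "re_tan (real_tan v) = v" "im_tan (real_tan v) = 0"
  by (simp_all add: re_tan_def im_tan_def cnjv_def real_tan_def vec_eq_iff)

lemma cderiv_eq:
  assumes "(f has_derivative L) (at x)"
  shows "cderiv f x Z = L (re_tan Z) + \<i> * L (im_tan Z)"
  by (simp add: cderiv_def frechet_derivative_at[OF assms, symmetric])

lemma cderiv_lin:
  assumes "f differentiable (at x)"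
  shows "cderiv f x (Z + W) = cderiv f x Z + cderiv f x W"
    and "cderiv f x (pscale c Z) = c * cderiv f x Z"
proof -
  let ?L = "frechet_derivative f (at x)"
  have L: "linear ?L" using assms by (rule linear_frechet_derivative)
  show "cderiv f x (Z + W) = cderiv f x Z + cderiv f x W"
    by (simp add: cderiv_def re_tan_add im_tan_add linear_add[OF L] algebra_simps)
  show "cderiv f x (pscale c Z) = c * cderiv f x Z"
    by (simp add: cderiv_def re_tan_pscale im_tan_pscale linear_add[OF L] linear_diff[OF L] linear_cmul[OF L]
        complex_eq_iff algebra_simps)
qed

text \<open>\<open>frechet_derivative\<close> is a choice from the predicate
  \<open>has_derivative\<close>, which depends on the germ only. Equal predicates give equal
  choices, so the equality holds even where there is no derivative.\<close>

lemma cderiv_cong: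
  assumes "open S" "x \<in> S" "\<And>y. y \<in> S \<Longrightarrow> f y = g y"
  shows "cderiv f x Z = cderiv g x Z"
proof -
  have eq: "(f has_derivative L) (at x) \<longleftrightarrow> (g has_derivative L) (at x)" for L
    using has_derivative_transform_within_open[OF _ assms(1,2), of f L UNIV g]
      has_derivative_transform_within_open[OF _ assms(1,2), of g L UNIV f] assms(3) by auto
  then show ?thesis by (simp add: cderiv_def frechet_derivative_def)
qed

lemma differentiable_cong_open:
  assumes "f differentiable (at x)" "open S" "x \<in> S" "\<And>y. y \<in> S \<Longrightarrow> f y = g y"
  shows "g differentiable (at x)"
  using assms has_derivative_transform_within_open[OF _ assms(2,3), of f _ UNIV g]
  by (auto simp: differentiable_def)

lemma cderiv_const [simp]: "cderiv (\<lambda>y. k) x Z = 0"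
  by (simp add: cderiv_eq[OF has_derivative_const])

lemma cderiv_add:
  assumes "f differentiable (at x)" "g differentiable (at x)"
  shows "cderiv (\<lambda>y. f y + g y) x Z = cderiv f x Z + cderiv g x Z"
  using cderiv_eq[OF has_derivative_add[OF assms[unfolded frechet_derivative_works]], of Z]
  by (simp add: cderiv_def algebra_simps)

lemma cderiv_diff:
  assumes "f differentiable (at x)" "g differentiable (at x)"
  shows "cderiv (\<lambda>y. f y - g y) x Z = cderiv f x Z - cderiv g x Z"
  using cderiv_eq[OF has_derivative_diff[OF assms[unfolded frechet_derivative_works]], of Z]
  by (simp add: cderiv_def algebra_simps)

lemma cderiv_mult:
  assumes "f differentiable (at x)" "g differentiable (at x)"
  shows "cderiv (\<lambda>y. f y * g y) x Z = cderiv f x Z * g x + f x * cderiv g x Z"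
  using cderiv_eq[OF has_derivative_mult[OF assms[unfolded frechet_derivative_works]], of Z]
  by (simp add: cderiv_def algebra_simps)

lemma cderiv_sum:
  assumes "\<And>i. i \<in> A \<Longrightarrow> f i differentiable (at x)"
  shows "cderiv (\<lambda>y. \<Sum>i\<in>A. f i y) x Z = (\<Sum>i\<in>A. cderiv (f i) x Z)"
proof -
  have "((\<lambda>y. \<Sum>i\<in>A. f i y) has_derivative (\<lambda>v. \<Sum>i\<in>A. frechet_derivative (f i) (at x) v)) (at x)"
    by (rule has_derivative_sum) (use assms in \<open>auto simp: frechet_derivative_works\<close>)
  from cderiv_eq[OF this, of Z] show ?thesis
    by (simp add: cderiv_def[of "f _"] sum.distrib sum_distrib_left)
qed

lemma differentiable_cnj:
  assumes "f differentiable (at x)"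
  shows "(\<lambda>y. cnj (f y)) differentiable (at x)"
  using assms bounded_linear.has_derivative[OF bounded_linear_cnj] unfolding differentiable_def by blast

lemma cderiv_cnj:
  assumes "f differentiable (at x)"
  shows "cderiv (\<lambda>y. cnj (f y)) x Z = cnj (cderiv f x (ctan_conj Z))"
proof -
  have "((\<lambda>y. cnj (f y)) has_derivative (\<lambda>v. cnj (frechet_derivative f (at x) v))) (at x)"
    using assms by (intro bounded_linear.has_derivative[OF bounded_linear_cnj]) (simp add: frechet_derivative_works)
  then show ?thesis
    by (simp add: cderiv_eq) (simp add: cderiv_def re_tan_conj im_tan_conj
        linear_neg[OF linear_frechet_derivative[OF assms]])
qed

section \<open>Wirtinger derivatives\<close>

definition dz :: "'n::finite \<Rightarrow> (complex^'n \<Rightarrow> complex) \<Rightarrow> complex^'n \<Rightarrow> complex" where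
  "dz k f x = cderiv f x (holo_vec (axis k 1))"

definition dzb :: "'n::finite \<Rightarrow> (complex^'n \<Rightarrow> complex) \<Rightarrow> complex^'n \<Rightarrow> complex" where
  "dzb k f x = cderiv f x (antiholo_vec (axis k 1))"

lemma cderiv_zero_vec: "f differentiable (at x) \<Longrightarrow> cderiv f x 0 = 0"
  using cderiv_lin(2)[of f x 0 0] by (simp add: pscale_def zero_prod_def)

lemma cderiv_vec_sum:
  assumes "f differentiable (at x)"
  shows "cderiv f x (\<Sum>i\<in>A. pscale (c i) (Z i)) = (\<Sum>i\<in>A. c i * cderiv f x (Z i))"
  by (induction A rule: infinite_finite_induct) (simp_all add: assms cderiv_lin cderiv_zero_vec)

lemma ctan_expand:
  "Z = (\<Sum>i\<in>UNIV. pscale (fst Z $ i) (holo_vec (axis i 1))) + (\<Sum>i\<in>UNIV. pscale (snd Z $ i) (antiholo_vec (axis i 1)))"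
  by (rule prod_eqI) (simp_all add: fst_sum snd_sum pscale_def holo_vec_def antiholo_vec_def axis_expand)

lemma cderiv_expand:
  assumes "f differentiable (at x)"
  shows "cderiv f x Z = (\<Sum>k\<in>UNIV. fst Z $ k * dz k f x) + (\<Sum>k\<in>UNIV. snd Z $ k * dzb k f x)"
  by (subst ctan_expand[of Z], subst cderiv_lin(1)[OF assms])
    (simp add: cderiv_vec_sum[OF assms] dz_def dzb_def)

lemma frechet_expand:
  assumes "f differentiable (at x)"
  shows "frechet_derivative f (at x) v = (\<Sum>k\<in>UNIV. v $ k * dz k f x) + (\<Sum>k\<in>UNIV. cnj (v $ k) * dzb k f x)"
  using cderiv_expand[OF assms, of "real_tan v"] linear_0[OF linear_frechet_derivative[OF assms]]
  by (simp add: cderiv_def real_tan_parts) (simp add: real_tan_def cnjv_def)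

lemma ctan_conj_basis:
  "ctan_conj (holo_vec (axis k 1)) = antiholo_vec (axis k 1)"
  "ctan_conj (antiholo_vec (axis k 1)) = holo_vec (axis k 1)"
  by (auto simp: ctan_conj_def holo_vec_def antiholo_vec_def cnjv_def axis_def vec_eq_iff)

lemma dz_cnj: "f differentiable (at x) \<Longrightarrow> dz k (\<lambda>y. cnj (f y)) x = cnj (dzb k f x)"
  and dzb_cnj: "f differentiable (at x) \<Longrightarrow> dzb k (\<lambda>y. cnj (f y)) x = cnj (dz k f x)"
  by (simp_all add: dz_def dzb_def cderiv_cnj ctan_conj_basis)

lemma cderiv_differentiable:
  assumes "open S" "x \<in> S" "Ck_on (Suc (Suc 0)) S f"
  shows "f differentiable (at x)" "(\<lambda>y. cderiv f y Z) differentiable (at x)"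
  using assms by (auto simp: cderiv_def intro!: differentiable_add differentiable_mult)

lemma cderiv_cderiv:
  assumes "open S" "x \<in> S" "Ck_on (Suc (Suc 0)) S f"
  shows "cderiv (\<lambda>y. cderiv f y Z) x W = cderiv (\<lambda>y. cderiv f y W) x Z"
proof -
  have d: "(\<lambda>y. frechet_derivative f (at y) v) differentiable (at x)" for v
    using assms by auto
  have "frechet_derivative (\<lambda>y. cderiv f y Z) (at x) v =
      frechet_derivative (\<lambda>y. frechet_derivative f (at y) (re_tan Z)) (at x) v +
      \<i> * frechet_derivative (\<lambda>y. frechet_derivative f (at y) (im_tan Z)) (at x) v" for v Z
  proof -
    have "((\<lambda>y. cderiv f y Z) has_derivative (\<lambda>v.
      frechet_derivative (\<lambda>y. frechet_derivative f (at y) (re_tan Z)) (at x) v +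
      \<i> * frechet_derivative (\<lambda>y. frechet_derivative f (at y) (im_tan Z)) (at x) v)) (at x)"
      unfolding cderiv_def
      by (intro has_derivative_add has_derivative_mult_right)
        (use d in \<open>simp_all add: frechet_derivative_works\<close>)
    then show ?thesis by (simp add: frechet_derivative_at[symmetric])
  qed
  then show ?thesis
    unfolding cderiv_def[of "\<lambda>y. cderiv f y Z"] cderiv_def[of "\<lambda>y. cderiv f y W"]
    by (simp add: complex_second_derivative_symmetric[OF assms] algebra_simps)
qed

lemma dz_dz:
  assumes "open S" "x \<in> S" "Ck_on (Suc (Suc 0)) S f"
  shows "dz k (dz l f) x = dz l (dz k f) x"
    and "dz k (dzb l f) x = dzb l (dz k f) x"
    and "dzb k (dzb l f) x = dzb l (dzb k f) x"
  using cderiv_cderiv[OF assms] by (simp_all add: dz_def[abs_def] dzb_def[abs_def])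

lemma dz_diff:
  assumes "f differentiable (at y)" "f' differentiable (at y)"
  shows "dz k (\<lambda>y. f y - f' y) y = dz k f y - dz k f' y"
  using assms by (simp add: dz_def cderiv_diff)

lemma dz_differentiable:
  assumes "open S" "x \<in> S" "Ck_on (Suc (Suc 0)) S f"
  shows "dz k f differentiable (at x)" "dzb k f differentiable (at x)"
  using cderiv_differentiable[OF assms] by (simp_all add: dz_def[abs_def] dzb_def[abs_def])

section \<open>Differentiating an inverse matrix\<close>

lemma matrix_inv_mult:
  fixes A :: "complex^'n::finite^'n"
  assumes "invertible A"
  shows "A ** matrix_inv A = mat 1" "matrix_inv A ** A = mat 1"
  using someI_ex[of "\<lambda>A'. A ** A' = mat 1 \<and> A' ** A = mat 1"] assms
  by (auto simp: invertible_def matrix_inv_def)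

lemma matrix_inv_sums:
  fixes A :: "complex^'n::finite^'n"
  assumes "invertible A"
  shows "(\<Sum>j\<in>UNIV. A $ i $ j * matrix_inv A $ j $ k) = (if i = k then 1 else 0)"
    and "(\<Sum>j\<in>UNIV. matrix_inv A $ i $ j * A $ j $ k) = (if i = k then 1 else 0)"
proof -
  have "(A ** matrix_inv A) $ i $ k = mat 1 $ i $ k" "(matrix_inv A ** A) $ i $ k = mat 1 $ i $ k"
    by (simp_all add: matrix_inv_mult assms)
  then show "(\<Sum>j\<in>UNIV. A $ i $ j * matrix_inv A $ j $ k) = (if i = k then 1 else 0)"
    "(\<Sum>j\<in>UNIV. matrix_inv A $ i $ j * A $ j $ k) = (if i = k then 1 else 0)"
    by (simp_all add: matrix_matrix_mult_def mat_def)
qed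

text \<open>This is the resolvent identity. The increment \<open>B - A\<close> vanishes at the base
  point, so differentiating it there needs no more than differentiability of the other
  factors.\<close>

lemma matrix_inv_difference:
  fixes A B :: "complex^'n::finite^'n"
  assumes "invertible A" "invertible B"
  shows "matrix_inv B $ i $ j = matrix_inv A $ i $ j -
    (\<Sum>a\<in>UNIV. \<Sum>b\<in>UNIV. matrix_inv B $ i $ a * (B $ a $ b - A $ a $ b) * matrix_inv A $ b $ j)"
proof -
  have "(\<Sum>a\<in>UNIV. \<Sum>b\<in>UNIV. matrix_inv B $ i $ a * B $ a $ b * matrix_inv A $ b $ j) =
      (\<Sum>b\<in>UNIV. (\<Sum>a\<in>UNIV. matrix_inv B $ i $ a * B $ a $ b) * matrix_inv A $ b $ j)"
    by (subst sum.swap) (simp add: sum_distrib_right)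
  moreover have "(\<Sum>a\<in>UNIV. \<Sum>b\<in>UNIV. matrix_inv B $ i $ a * A $ a $ b * matrix_inv A $ b $ j) =
      (\<Sum>a\<in>UNIV. matrix_inv B $ i $ a * (\<Sum>b\<in>UNIV. A $ a $ b * matrix_inv A $ b $ j))"
    by (simp add: sum_distrib_left mult.assoc)
  ultimately show ?thesis
    by (simp add: matrix_inv_sums assms right_diff_distrib left_diff_distrib sum_subtractf if_distrib
        if_distribR cong: if_cong)
qed

lemma differentiable_prod_finite:
  fixes f :: "'i \<Rightarrow> 'a::real_normed_vector \<Rightarrow> complex"
  assumes "\<And>i. i \<in> A \<Longrightarrow> f i differentiable (at x within S)"
  shows "(\<lambda>y. \<Prod>i\<in>A. f i y) differentiable (at x within S)"
  using assms by (induction A rule: infinite_finite_induct) (auto intro: differentiable_mult)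

lemma differentiable_sum_finite:
  fixes f :: "'i \<Rightarrow> 'a::real_normed_vector \<Rightarrow> complex"
  assumes "\<And>i. i \<in> A \<Longrightarrow> f i differentiable (at x within S)"
  shows "(\<lambda>y. \<Sum>i\<in>A. f i y) differentiable (at x within S)"
  using assms by (induction A rule: infinite_finite_induct) (auto intro: differentiable_add)

lemma det_differentiable:
  fixes A :: "'a::real_normed_vector \<Rightarrow> complex^'n::finite^'n"
  assumes "\<And>i j. (\<lambda>y. A y $ i $ j) differentiable (at x within S)"
  shows "(\<lambda>y. det (A y)) differentiable (at x within S)"
  unfolding det_def
  by (intro differentiable_sum_finite differentiable_mult differentiable_const differentiable_prod_finite assms)

text \<open>Cramer's rule makes every entry of the inverse a quotient of polynomials in the entries
  of the matrix; differentiability of the inverse follows from this.\<close>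

lemma matrix_inv_cramer:
  fixes A :: "complex^'n::finite^'n"
  assumes "invertible A"
  shows "matrix_inv A $ i $ j = det (\<chi> a b. if b = i then (if a = j then 1 else 0) else A $ a $ b) / det A"
proof -
  have "A *v (\<chi> k. matrix_inv A $ k $ j) = axis j 1"
    by (simp add: vec_eq_iff matrix_vector_mult_def matrix_inv_sums(1)[OF assms] axis_def)
  then have "(\<chi> k. matrix_inv A $ k $ j) = (\<chi> k. det (\<chi> a b. if b = k then axis j 1 $ a else A $ a $ b) / det A)"
    using cramer[of A] assms by (simp add: invertible_det_nz)
  then have "matrix_inv A $ i $ j = det (\<chi> a b. if b = i then axis j 1 $ a else A $ a $ b) / det A"
    by (simp add: vec_eq_iff)
  then show ?thesis
    by (simp add: axis_def cong: if_cong)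
qed

lemma matrix_inv_differentiable:
  fixes A :: "'a::real_normed_vector \<Rightarrow> complex^'n::finite^'n"
  assumes "\<And>i j. (\<lambda>y. A y $ i $ j) differentiable (at x within S)"
    and "x \<in> S" "\<And>y. y \<in> S \<Longrightarrow> invertible (A y)"
  shows "(\<lambda>y. matrix_inv (A y) $ i $ j) differentiable (at x within S)"
proof -
  have "(\<lambda>y. (\<chi> a b. if b = i then (if a = j then 1 else 0) else A y $ a $ b) $ k $ l) differentiable (at x within S)" for k l
    using assms(1) by (cases "l = i") auto
  then have "(\<lambda>y. det (\<chi> a b. if b = i then (if a = j then 1 else 0) else A y $ a $ b) / det (A y))
      differentiable (at x within S)"
    using assms by (intro differentiable_divide det_differentiable) (auto simp: invertible_det_nz)
  then obtain D where D: "((\<lambda>y. det (\<chi> a b. if b = i then (if a = j then 1 else 0) else A y $ a $ b) / det (A y))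
      has_derivative D) (at x within S)" by (auto simp: differentiable_def)
  have "((\<lambda>y. matrix_inv (A y) $ i $ j) has_derivative D) (at x within S)"
    by (rule has_derivative_transform[OF assms(2) _ D]) (simp add: matrix_inv_cramer assms)
  then show ?thesis by (auto simp: differentiable_def)
qed

text \<open>Stated within a set because it serves twice: for the derivatives in space on an open
  set, and for the derivative in time on an interval, possibly at an end point.\<close>

lemma matrix_inv_has_derivative:
  fixes A :: "'a::real_normed_vector \<Rightarrow> complex^'n::finite^'n"
  assumes D: "\<And>i j. ((\<lambda>y. A y $ i $ j) has_derivative D i j) (at x within S)"
    and S: "x \<in> S" "\<And>y. y \<in> S \<Longrightarrow> invertible (A y)"
  shows "((\<lambda>y. matrix_inv (A y) $ i $ j) has_derivative
    (\<lambda>v. - (\<Sum>a\<in>UNIV. \<Sum>b\<in>UNIV. matrix_inv (A x) $ i $ a * D a b v * matrix_inv (A x) $ b $ j))) (at x within S)"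
proof -
  have "(\<lambda>y. A y $ i $ j) differentiable (at x within S)" for i j
    using D by (auto simp: differentiable_def)
  then have "\<exists>E. ((\<lambda>y. matrix_inv (A y) $ i $ a) has_derivative E) (at x within S)" for a
    using matrix_inv_differentiable[of A, OF _ S] by (auto simp: differentiable_def)
  then obtain E where E: "((\<lambda>y. matrix_inv (A y) $ i $ a) has_derivative E a) (at x within S)" for a by metis
  \<comment> \<open>In the product rule the unknown derivative \<open>E\<close> of the inverse is
    multiplied by \<open>A x - A x\<close>, so only its existence matters.\<close>
  have "((\<lambda>y. matrix_inv (A x) $ i $ j - (\<Sum>a\<in>UNIV. \<Sum>b\<in>UNIV.
      matrix_inv (A y) $ i $ a * (A y $ a $ b - A x $ a $ b) * matrix_inv (A x) $ b $ j)) has_derivative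
    (\<lambda>v. 0 - (\<Sum>a\<in>UNIV. \<Sum>b\<in>UNIV. (matrix_inv (A x) $ i $ a * (D a b v - 0) +
      E a v * (A x $ a $ b - A x $ a $ b)) * matrix_inv (A x) $ b $ j))) (at x within S)"
    by (intro has_derivative_diff has_derivative_const has_derivative_sum has_derivative_mult_left
        has_derivative_mult E D)
  then have "((\<lambda>y. matrix_inv (A x) $ i $ j - (\<Sum>a\<in>UNIV. \<Sum>b\<in>UNIV.
      matrix_inv (A y) $ i $ a * (A y $ a $ b - A x $ a $ b) * matrix_inv (A x) $ b $ j)) has_derivative
    (\<lambda>v. - (\<Sum>a\<in>UNIV. \<Sum>b\<in>UNIV. matrix_inv (A x) $ i $ a * D a b v * matrix_inv (A x) $ b $ j))) (at x within S)"
    by simp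
  then show ?thesis
    by (rule has_derivative_transform[OF S(1), rotated])
      (simp add: matrix_inv_difference[OF S(2)[OF S(1)] S(2)])
qed

section \<open>Hermitian forms at a point\<close>

lemma J_J: "J (J v) = - v"
  by (simp add: J_def vec_eq_iff)

lemma complex_scale_J: "c *s v = Re c *\<^sub>R v + Im c *\<^sub>R J v"
  by (simp add: J_def vec_eq_iff complex_eq_iff)

lemma clinear_expand:
  assumes add: "\<And>u v. f (u + v) = f u + f v" and scale: "\<And>c u. f (c *s u) = c * f u"
  shows "f (u :: complex^'n::finite) = (\<Sum>i\<in>UNIV. u $ i * (f (axis i 1) :: complex))"
proof -
  have z: "f 0 = 0" using scale[of 0 0] by simp
  have "f (\<Sum>i\<in>A. (u $ i) *s axis i 1) = (\<Sum>i\<in>A. u $ i * f (axis i 1))" for A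
    by (induction A rule: infinite_finite_induct) (simp_all add: add scale z)
  from this[of UNIV] show ?thesis by (simp add: axis_expand)
qed

locale hermitian_form =
  fixes B :: "complex^'n::finite \<Rightarrow> complex^'n \<Rightarrow> real"
  assumes bil: "bilinear B" and sym: "B v w = B w v" and pos: "v \<noteq> 0 \<Longrightarrow> B v v > 0"
    and Jinv: "B (J v) (J w) = B v w"
begin

text \<open>The sesquilinear form B(v', conj w') on the (1,0)-parts v' = (v - i J v) / 2 and w' = (w
  - i J w) / 2; one factor 1/2 survives because \<open>B\<close> is
  \<open>J\<close>-invariant.\<close>

definition H :: "complex^'n \<Rightarrow> complex^'n \<Rightarrow> complex" where
  "H v w = (complex_of_real (B v w) + \<i> * complex_of_real (B v (J w))) / 2"

abbreviation mat_H :: "'n \<Rightarrow> 'n \<Rightarrow> complex" where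
  "mat_H i j \<equiv> cext B (holo_vec (axis i 1)) (antiholo_vec (axis j 1))"

lemma B_J_left: "B (J v) w = - B v (J w)"
  using Jinv[of v "J w"] by (simp add: J_J bilinear_rneg[OF bil])

lemma H_cnj: "H w v = cnj (H v w)"
  by (simp add: H_def complex_eq_iff sym[of w] B_J_left)

lemma H_add: "H (u + v) w = H u w + H v w"
  by (simp add: H_def bilinear_ladd[OF bil] algebra_simps add_divide_distrib)

lemma H_scale: "H (c *s v) w = c * H v w"
  by (simp add: H_def complex_scale_J bilinear_ladd[OF bil] bilinear_lmul[OF bil] B_J_left J_J
      bilinear_rneg[OF bil] complex_eq_iff field_simps)

lemma H_axis: "H (axis i 1) (axis j 1) = mat_H i j"
proof -
  have re: "re_tan (holo_vec a) = (1/2) *\<^sub>R a" "im_tan (holo_vec a) = (- 1/2) *\<^sub>R J a" for a :: "complex^'n"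
    by (simp_all add: re_tan_def im_tan_eq holo_vec_def cnjv_def J_def vec_eq_iff complex_eq_iff)
  have cj: "cnjv (axis j 1) = axis j 1"
    by (simp add: cnjv_def axis_def vec_eq_iff)
  have im: "re_tan (antiholo_vec (axis j 1)) = (1/2) *\<^sub>R axis j 1"
    "im_tan (antiholo_vec (axis j 1)) = (1/2) *\<^sub>R J (axis j 1)"
    by (simp_all add: re_tan_def im_tan_eq antiholo_vec_def cj J_def vec_eq_iff complex_eq_iff)
  show ?thesis
    by (simp only: cext_def re im bilinear_lmul[OF bil] bilinear_rmul[OF bil] B_J_left J_J H_def
        bilinear_rneg[OF bil]) (simp add: complex_eq_iff)
qed

lemma H_expand: "H v w = (\<Sum>i\<in>UNIV. \<Sum>j\<in>UNIV. mat_H i j * v $ i * cnj (w $ j))"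
proof -
  have "H v w = (\<Sum>i\<in>UNIV. v $ i * H (axis i 1) w)"
    by (rule clinear_expand[of "\<lambda>v. H v w"]) (simp_all add: H_add H_scale)
  moreover have "H (axis i 1) w = (\<Sum>j\<in>UNIV. cnj (w $ j) * H (axis i 1) (axis j 1))" for i
  proof -
    have "H w (axis i 1) = (\<Sum>j\<in>UNIV. w $ j * H (axis j 1) (axis i 1))"
      by (rule clinear_expand[of "\<lambda>v. H v _"]) (simp_all add: H_add H_scale)
    then show ?thesis by (simp add: H_cnj[of "axis i 1" w] H_cnj[of "axis i 1" "axis _ 1"])
  qed
  ultimately show ?thesis by (simp add: H_axis sum_distrib_left mult_ac)
qed

lemma mat_H_cnj: "cnj (mat_H i j) = mat_H j i"
  by (simp only: H_axis[symmetric] H_cnj[of "axis j 1"])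

lemma form_eq_H: "complex_of_real (B v w) = H v w + H w v"
  by (simp add: H_cnj[of w v]) (simp add: H_def complex_eq_iff)

lemma form_expand:
  "complex_of_real (B v w) = (\<Sum>i\<in>UNIV. \<Sum>j\<in>UNIV. mat_H i j * (1 * v $ i * cnj (w $ j) + 1 * w $ i * cnj (v $ j)))"
  by (simp add: form_eq_H H_expand sum.distrib distrib_left mult_ac)

lemma form_Re: "B v w = 2 * Re (H v w)"
  by (simp add: H_def)

lemma form_J_expand:
  "complex_of_real (B (J v) w) =
    (\<Sum>i\<in>UNIV. \<Sum>j\<in>UNIV. mat_H i j * (\<i> * v $ i * cnj (w $ j) + (- \<i>) * w $ i * cnj (v $ j)))"
  by (simp add: form_expand J_def mult_ac)

text \<open>A vector \<open>v\<close> in the kernel of the transpose has \<open>H v v = 0\<close>,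
  hence \<open>B v v = 0\<close>, against positivity. The transpose enters because the first
  argument of \<open>H\<close> is contracted with the row index.\<close>

lemma invertible_mat_H: "invertible (\<chi> i j. mat_H i j)"
proof -
  let ?A = "transpose (\<chi> i j. mat_H i j)"
  have "v = 0" if "?A *v v = 0" for v
  proof (rule ccontr)
    assume "v \<noteq> 0"
    have "H v v = (\<Sum>j\<in>UNIV. (?A *v v) $ j * cnj (v $ j))"
      by (subst H_expand, subst sum.swap) (simp add: matrix_vector_mult_def transpose_def sum_distrib_right)
    then have "B v v = 0" using that by (simp only: form_Re) simp
    then show False using pos[OF \<open>v \<noteq> 0\<close>] by simp
  qed
  then have "\<exists>C. C ** ?A = mat 1" by (subst matrix_left_invertible_ker) blast
  then show ?thesis
    by (metis invertible_right_inverse matrix_transpose_mul transpose_mat transpose_transpose)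
qed

lemma nondegenerate: "(\<And>z. B w z = B w' z) \<Longrightarrow> w = w'"
  using pos[of "w - w'"] bilinear_lsub[OF bil, of w w' "w - w'"] by (cases "w = w'") auto

end

text \<open>Complex bilinear extension replaces a component of a real vector by the
  \<open>fst\<close> component and its conjugate by the \<open>snd\<close> component. The weights p,
  q cover both the metric (1, 1) and its fundamental form (i, -i).\<close>

lemma cext_formula:
  assumes "\<And>v w. complex_of_real (B v w) =
    (\<Sum>i\<in>UNIV. \<Sum>j\<in>UNIV. c i j * (p * v $ i * cnj (w $ j) + q * w $ i * cnj (v $ j)))"
  shows "cext B Z W =
    (\<Sum>i\<in>UNIV. \<Sum>j\<in>UNIV. c i j * (p * fst Z $ i * snd W $ j + q * fst W $ i * snd Z $ j))"
proof -
  have parts: "fst Z $ i = re_tan Z $ i + \<i> * im_tan Z $ i"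
    "snd Z $ i = cnj (re_tan Z $ i) + \<i> * cnj (im_tan Z $ i)" for Z :: "'a ctan" and i
    by (simp_all add: re_tan_def im_tan_eq cnjv_def complex_eq_iff field_simps)
  show ?thesis
    unfolding cext_def of_real_add of_real_diff assms parts
    by (simp add: sum_distrib_left sum.distrib[symmetric] sum_subtractf[symmetric])
      (intro sum.cong refl, simp add: algebra_simps)
qed

section \<open>Evaluating forms\<close>

lemma subsets_card_1: "{S. S \<subseteq> {..<n::nat} \<and> card S = 1} = (\<lambda>i. {i}) ` {..<n}"
  by (auto simp: card_1_singleton_iff)

lemma subsets_card_2: "{S. S \<subseteq> {..<n::nat} \<and> card S = 2} = (\<lambda>(i, j). {i, j}) ` {(i, j). i < j \<and> j < n}"
proof (intro equalityI subsetI)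
  fix S assume "S \<in> {S. S \<subseteq> {..<n} \<and> card S = 2}"
  then obtain i j where S: "S = {i, j}" "i \<noteq> j" "i < n" "j < n" by (auto simp: card_2_iff)
  show "S \<in> (\<lambda>(i, j). {i, j}) ` {(i, j). i < j \<and> j < n}"
  proof (cases "i < j")
    case True
    then show ?thesis using S by (intro image_eqI[of _ _ "(i, j)"]) simp_all
  next
    case False
    then show ?thesis using S by (intro image_eqI[of _ _ "(j, i)"]) (simp_all add: insert_commute)
  qed
qed auto

lemma less_pairs:
  "{(i, j). i < j \<and> j < (2::nat)} = {(0,1)}"
  "{(i, j). i < j \<and> j < (3::nat)} = {(0,1),(0,2),(1,2)}"
  "{(i, j). i < j \<and> j < (4::nat)} = {(0,1),(0,2),(0,3),(1,2),(1,3),(2,3)}"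
proof -
  have Suc: "{(i, j). i < j \<and> j < Suc n} = {(i, j). i < j \<and> j < n} \<union> (\<lambda>i. (i, n)) ` {..<n}" for n
    by (auto simp: less_Suc_eq)
  have "{(i, j). i < j \<and> j < Suc 0} = {}" by auto
  with Suc[of "Suc 0"] show 2: "{(i, j). i < j \<and> j < (2::nat)} = {(0,1)}"
    by (auto simp: numeral_2_eq_2 lessThan_Suc)
  with Suc[of 2] show 3: "{(i, j). i < j \<and> j < (3::nat)} = {(0,1),(0,2),(1,2)}"
    by (simp add: lessThan_nat_numeral lessThan_Suc insert_commute)
  with Suc[of 3] show "{(i, j). i < j \<and> j < (4::nat)} = {(0,1),(0,2),(0,3),(1,2),(1,3),(2,3)}"
    by (simp add: lessThan_nat_numeral lessThan_Suc insert_commute)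
qed

text \<open>The possible positions of the (1,0)-arguments for the types (1,1), (2,0), (1,2), (2,1)
  and (2,2), the only ones that occur.\<close>

lemma subsets_card:
  "{S. S \<subseteq> {..<2::nat} \<and> card S = 1} = {{0},{1}}"
  "{S. S \<subseteq> {..<2::nat} \<and> card S = 2} = {{0,1}}"
  "{S. S \<subseteq> {..<3::nat} \<and> card S = 1} = {{0},{1},{2}}"
  "{S. S \<subseteq> {..<3::nat} \<and> card S = 2} = {{0,1},{0,2},{1,2}}"
  "{S. S \<subseteq> {..<4::nat} \<and> card S = 2} = {{0,1},{0,2},{0,3},{1,2},{1,3},{2,3}}"
  unfolding subsets_card_1 subsets_card_2 less_pairs
  by (simp_all add: lessThan_Suc numeral_2_eq_2 numeral_3_eq_3 insert_commute)

lemma pq_part_11: "pq_part 1 1 \<alpha> x [Z, W] =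
    \<alpha> x [holo_vec (fst Z), antiholo_vec (snd W)] + \<alpha> x [antiholo_vec (snd Z), holo_vec (fst W)]"
  by (simp add: pq_part_def subsets_card[simplified] numeral_2_eq_2[symmetric] upt_rec)

lemma pq_part_20: "pq_part 2 0 \<alpha> x [Z, W] = \<alpha> x [holo_vec (fst Z), holo_vec (fst W)]"
  by (simp add: pq_part_def subsets_card[simplified] upt_rec)

lemma pq_part_21: "pq_part 2 1 \<alpha> x [Z, W, U] =
    \<alpha> x [holo_vec (fst Z), holo_vec (fst W), antiholo_vec (snd U)] +
    \<alpha> x [holo_vec (fst Z), antiholo_vec (snd W), holo_vec (fst U)] +
    \<alpha> x [antiholo_vec (snd Z), holo_vec (fst W), holo_vec (fst U)]"
  by (simp add: pq_part_def subsets_card[simplified] upt_rec insert_eq_iff doubleton_eq_iff)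

lemma pq_part_12: "pq_part 1 2 \<alpha> x [Z, W, U] =
    \<alpha> x [holo_vec (fst Z), antiholo_vec (snd W), antiholo_vec (snd U)] +
    \<alpha> x [antiholo_vec (snd Z), holo_vec (fst W), antiholo_vec (snd U)] +
    \<alpha> x [antiholo_vec (snd Z), antiholo_vec (snd W), holo_vec (fst U)]"
  by (simp add: pq_part_def subsets_card[simplified, unfolded numeral_3_eq_3] upt_rec)

lemma pq_part_22: "pq_part 2 2 \<alpha> x [Z, W, U, Y] =
    \<alpha> x [holo_vec (fst Z), holo_vec (fst W), antiholo_vec (snd U), antiholo_vec (snd Y)] +
    \<alpha> x [holo_vec (fst Z), antiholo_vec (snd W), holo_vec (fst U), antiholo_vec (snd Y)] +
    \<alpha> x [holo_vec (fst Z), antiholo_vec (snd W), antiholo_vec (snd U), holo_vec (fst Y)] +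
    \<alpha> x [antiholo_vec (snd Z), holo_vec (fst W), holo_vec (fst U), antiholo_vec (snd Y)] +
    \<alpha> x [antiholo_vec (snd Z), holo_vec (fst W), antiholo_vec (snd U), holo_vec (fst Y)] +
    \<alpha> x [antiholo_vec (snd Z), antiholo_vec (snd W), holo_vec (fst U), holo_vec (fst Y)]"
  by (simp add: pq_part_def subsets_card[simplified] upt_rec insert_eq_iff doubleton_eq_iff)

lemma ext_d_1: "ext_d \<alpha> x [Z, W] = cderiv (\<lambda>y. \<alpha> y [W]) x Z - cderiv (\<lambda>y. \<alpha> y [Z]) x W"
  by (simp add: ext_d_def numeral_2_eq_2)

lemma ext_d_2: "ext_d \<alpha> x [Z, W, U] =
    cderiv (\<lambda>y. \<alpha> y [W, U]) x Z - cderiv (\<lambda>y. \<alpha> y [Z, U]) x W + cderiv (\<lambda>y. \<alpha> y [Z, W]) x U"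
  by (simp add: ext_d_def numeral_2_eq_2)

lemma ext_d_3: "ext_d \<alpha> x [Z, W, U, Y] =
    cderiv (\<lambda>y. \<alpha> y [W, U, Y]) x Z - cderiv (\<lambda>y. \<alpha> y [Z, U, Y]) x W +
    cderiv (\<lambda>y. \<alpha> y [Z, W, Y]) x U - cderiv (\<lambda>y. \<alpha> y [Z, W, U]) x Y"
  by (simp add: ext_d_def numeral_2_eq_2)

lemma fst_snd_vec [simp]:
  "fst (holo_vec a) = a" "snd (holo_vec a) = 0" "fst (antiholo_vec b) = 0" "snd (antiholo_vec b) = b"
  by (simp_all add: holo_vec_def antiholo_vec_def)

section \<open>Hermitian metrics in a chart\<close>

locale hermitian_chart =
  fixes V :: "(complex^'n::finite) set" and g :: "'n metric"
  assumes open_V: "open V" and herm: "hermitian_on V g"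
begin

definition hc :: "'n \<Rightarrow> 'n \<Rightarrow> complex^'n \<Rightarrow> complex" where
  "hc i j y = metric_matrix g y $ i $ j"

definition hi :: "'n \<Rightarrow> 'n \<Rightarrow> complex^'n \<Rightarrow> complex" where
  "hi i j y = matrix_inv (metric_matrix g y) $ i $ j"

lemma hermitian_form_at: "y \<in> V \<Longrightarrow> hermitian_form (g y)"
  using herm by unfold_locales (auto simp: hermitian_on_def)

lemma hc_form: "hc i j y = cext (g y) (holo_vec (axis i 1)) (antiholo_vec (axis j 1))"
  by (simp add: hc_def metric_matrix_def)

lemma invertible_metric_matrix: "y \<in> V \<Longrightarrow> invertible (metric_matrix g y)"
  using hermitian_form.invertible_mat_H[OF hermitian_form_at[of y]] by (simp add: metric_matrix_def)

lemma hc_hi: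
  assumes "y \<in> V"
  shows "(\<Sum>j\<in>UNIV. hc i j y * hi j k y) = (if i = k then 1 else 0)"
    and "(\<Sum>j\<in>UNIV. hi i j y * hc j k y) = (if i = k then 1 else 0)"
  using matrix_inv_sums[OF invertible_metric_matrix[OF assms]] by (simp_all add: hc_def hi_def)

lemma hc_cnj: "y \<in> V \<Longrightarrow> cnj (hc i j y) = hc j i y"
  using hermitian_form.mat_H_cnj[OF hermitian_form_at[of y]] by (simp add: hc_form)

text \<open>The conjugate transpose of the inverse is again an inverse of the Hermitian matrix
  \<open>hc\<close>, and inverses are unique.\<close>

lemma hi_cnj:
  assumes "y \<in> V"
  shows "cnj (hi i j y) = hi j i y"
proof -
  have "cnj (hi i j y) = (\<Sum>k\<in>UNIV. (\<Sum>l\<in>UNIV. hi j l y * hc l k y) * cnj (hi i k y))"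
    by (simp add: hc_hi assms if_distrib if_distribR cong: if_cong)
  also have "\<dots> = (\<Sum>l\<in>UNIV. hi j l y * (\<Sum>k\<in>UNIV. hc l k y * cnj (hi i k y)))"
    by (simp add: sum_distrib_left sum_distrib_right mult.assoc) (rule sum.swap)
  also have "\<dots> = (\<Sum>l\<in>UNIV. hi j l y * cnj (\<Sum>k\<in>UNIV. hi i k y * hc k l y))"
    by (simp add: hc_cnj assms mult.commute)
  also have "\<dots> = hi j i y"
    by (simp only: hc_hi assms) (simp add: if_distrib cong: if_cong)
  finally show ?thesis .
qed

lemma hc_eq_H:
  assumes "y \<in> V"
  shows "hc i j y = (of_real (g y (axis i 1) (axis j 1)) + \<i> * of_real (g y (axis i 1) (J (axis j 1)))) / 2"
  using hermitian_form.H_axis[OF hermitian_form_at[OF assms], of i j]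
  by (simp add: hc_form hermitian_form.H_def[OF hermitian_form_at[OF assms]])

lemma Ck_hc: "Ck_on (Suc (Suc 0)) V (hc i j)"
proof -
  have S: "Ck_on (Suc (Suc 0)) V (\<lambda>x. g x v w)" for v w
    using herm by (simp add: hermitian_on_def smooth_on_def del: Ck_on.simps)
  have "Ck_on (Suc (Suc 0)) V (\<lambda>y. of_real (g y (axis i 1) (axis j 1)) / 2 +
      \<i> * of_real (g y (axis i 1) (J (axis j 1))) / 2)"
    by (intro Ck_on_add open_V Ck_on_bounded_linear[OF open_V _ S, of "\<lambda>r. of_real r / 2"]
        Ck_on_bounded_linear[OF open_V _ S, of "\<lambda>r. \<i> * of_real r / 2"])
      (auto intro!: bounded_linear_intros bounded_linear_of_real
         bounded_linear_compose[OF bounded_linear_divide] bounded_linear_compose[OF bounded_linear_mult_right])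
  then show ?thesis
    by (rule Ck_on_cong[OF open_V, rotated]) (simp add: hc_eq_H add_divide_distrib)
qed

lemma hc_diff [simp]: "y \<in> V \<Longrightarrow> hc i j differentiable (at y)"
  and dhc_diff [simp]: "y \<in> V \<Longrightarrow> dz k (hc i j) differentiable (at y)" "y \<in> V \<Longrightarrow> dzb k (hc i j) differentiable (at y)"
  using cderiv_differentiable(1)[OF open_V _ Ck_hc] dz_differentiable[OF open_V _ Ck_hc] by auto

lemma dhc_cnj:
  assumes "y \<in> V"
  shows "cnj (dz k (hc i j) y) = dzb k (hc j i) y" "cnj (dzb k (hc i j) y) = dz k (hc j i) y"
  using dzb_cnj[OF hc_diff[OF assms], of k i j] dz_cnj[OF hc_diff[OF assms], of k i j]
    cderiv_cong[OF open_V assms, of "\<lambda>y. cnj (hc i j y)" "hc j i"] hc_cnj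
  by (auto simp: dz_def dzb_def)

lemma hi_diff [simp]: "y \<in> V \<Longrightarrow> hi i j differentiable (at y)"
  using matrix_inv_differentiable[of "metric_matrix g" y V i j] hc_diff[of y]
  unfolding hc_def[abs_def] hi_def[abs_def]
  by (simp add: at_within_open[OF _ open_V] invertible_metric_matrix)

lemma cderiv_hi:
  assumes "y \<in> V"
  shows "cderiv (hi i j) y Z = - (\<Sum>a\<in>UNIV. \<Sum>b\<in>UNIV. hi i a y * cderiv (hc a b) y Z * hi b j y)"
proof -
  have "((\<lambda>y. metric_matrix g y $ i $ j) has_derivative frechet_derivative (hc i j) (at y)) (at y within V)" for i j
    using hc_diff[OF assms, of i j] unfolding frechet_derivative_works hc_def[abs_def]
    by (simp add: at_within_open[OF assms open_V])
  from matrix_inv_has_derivative[OF this assms invertible_metric_matrix, of i j]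
  have "(hi i j has_derivative (\<lambda>v. - (\<Sum>a\<in>UNIV. \<Sum>b\<in>UNIV.
      hi i a y * frechet_derivative (hc a b) (at y) v * hi b j y))) (at y)"
    by (simp add: hi_def[abs_def] at_within_open[OF assms open_V])
  from cderiv_eq[OF this, of Z] show ?thesis
    by (simp add: cderiv_def[of "hc _ _"] algebra_simps sum.distrib sum_distrib_left)
qed

lemma metric_Re:
  assumes "y \<in> V"
  shows "g y v w = 2 * Re (\<Sum>i\<in>UNIV. \<Sum>j\<in>UNIV. hc i j y * v $ i * cnj (w $ j))"
  using hermitian_form.form_Re[OF hermitian_form_at[OF assms]] hermitian_form.H_expand[OF hermitian_form_at[OF assms]]
  by (simp add: hc_form)

lemma fund_form_eq:
  assumes "y \<in> V"
  shows "fund_form g y [Z, W] =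
    (\<Sum>i\<in>UNIV. \<Sum>j\<in>UNIV. hc i j y * (\<i> * fst Z $ i * snd W $ j + (- \<i>) * fst W $ i * snd Z $ j))"
  unfolding fund_form_def nth_Cons_0 One_nat_def nth_Cons_Suc hc_form
  by (rule cext_formula) (rule hermitian_form.form_J_expand[OF hermitian_form_at[OF assms]])

end

lemma sum_axis: "(\<Sum>k\<in>UNIV. axis i 1 $ k * f k) = (f i :: complex)"
proof -
  have "axis i 1 $ k * f k = (if k = i then f k else 0)" for k by (simp add: axis_def)
  then show ?thesis by simp
qed

lemma has_derivative_vec:
  fixes f :: "'n::finite \<Rightarrow> 'a::real_normed_vector \<Rightarrow> complex"
  assumes "\<And>m. (f m has_derivative D m) (at x)"
  shows "((\<lambda>y. \<chi> m. f m y) has_derivative (\<lambda>v. \<chi> m. D m v)) (at x)"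
proof -
  have "linear (axis m :: complex \<Rightarrow> complex^'n)" for m
    by (rule linearI) (simp_all add: axis_def vec_eq_iff)
  then have bl: "bounded_linear (axis m :: complex \<Rightarrow> complex^'n)" for m
    by (simp add: linear_conv_bounded_linear)
  have eq: "(\<chi> m. c m) = (\<Sum>m\<in>UNIV. axis m (c m))" for c :: "'n \<Rightarrow> complex"
    by (simp add: vec_eq_iff axis_def)
  show ?thesis
    unfolding eq by (intro has_derivative_sum bounded_linear.has_derivative[OF bl] assms)
qed

lemma sum_mult_swap:
  fixes a :: "'n::finite \<Rightarrow> complex"
  shows "(\<Sum>m\<in>UNIV. a m * (\<Sum>i\<in>(UNIV::'k::finite set). b m i * c i)) = (\<Sum>i\<in>UNIV. (\<Sum>m\<in>UNIV. a m * b m i) * c i)"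
  by (simp add: sum_distrib_left sum_distrib_right mult.assoc) (rule sum.swap)

lemma sum_rotate: "(\<Sum>i\<in>A. \<Sum>j\<in>B. \<Sum>k\<in>C. f i j k) = (\<Sum>k\<in>C. \<Sum>i\<in>A. \<Sum>j\<in>B. f i j k)"
proof -
  have "(\<Sum>i\<in>A. \<Sum>j\<in>B. \<Sum>k\<in>C. f i j k) = (\<Sum>i\<in>A. \<Sum>k\<in>C. \<Sum>j\<in>B. f i j k)"
    by (rule sum.cong[OF refl], rule sum.swap)
  also have "\<dots> = (\<Sum>k\<in>C. \<Sum>i\<in>A. \<Sum>j\<in>B. f i j k)" by (rule sum.swap)
  finally show ?thesis .
qed

context hermitian_form
begin

text \<open>A real functional f is the real part of the complex linear functional f - i f(J .),
  which the invertible matrix \<open>mat_H\<close> represents. This supplies the existence of the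
  Christoffel symbols.\<close>

lemma riesz:
  assumes "linear f"
  shows "\<exists>w. \<forall>z. B w z = f z"
proof -
  define F where "F z = complex_of_real (f z) - \<i> * complex_of_real (f (J z))" for z
  have F: "F z = (\<Sum>i\<in>UNIV. z $ i * F (axis i 1))" for z
  proof (rule clinear_expand)
    show "F (u + v) = F u + F v" for u v
      by (simp add: F_def J_def linear_add[OF assms] vec.scale_right_distrib algebra_simps)
    show "F (c *s u) = c * F u" for c u
    proof -
      have "J (c *s u) = Re c *\<^sub>R J u - Im c *\<^sub>R u"
        by (simp add: J_def vec_eq_iff complex_eq_iff)
      then have "f (J (c *s u)) = Re c * f (J u) - Im c * f u"
        by (simp add: linear_diff[OF assms] linear_cmul[OF assms])
      moreover have "f (c *s u) = Re c * f u + Im c * f (J u)"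
        by (simp add: complex_scale_J linear_add[OF assms] linear_cmul[OF assms])
      ultimately show ?thesis
        by (simp add: F_def complex_eq_iff)
    qed
  qed
  let ?A = "\<chi> i j. mat_H i j"
  \<comment> \<open>The conjugate is due to \<open>H z w\<close> being antilinear in
    \<open>w\<close>, and the division by 2 cancels the factor in
    \<open>B z w = 2 * Re (H z w)\<close>.\<close>
  define w where "w = cnjv (matrix_inv ?A *v (\<chi> i. F (axis i 1) / 2))"
  have w: "(\<Sum>j\<in>UNIV. mat_H i j * cnj (w $ j)) = F (axis i 1) / 2" for i
  proof -
    have "(?A *v (matrix_inv ?A *v (\<chi> i. F (axis i 1) / 2))) $ i = F (axis i 1) / 2"
      by (simp add: matrix_vector_mul_assoc matrix_inv_mult[OF invertible_mat_H])
    then show ?thesis by (subst (asm) matrix_vector_mult_def) (simp add: w_def cnjv_def)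
  qed
  have "B w z = f z" for z
  proof -
    have "H z w = (\<Sum>i\<in>UNIV. z $ i * (\<Sum>j\<in>UNIV. mat_H i j * cnj (w $ j)))"
      by (simp add: H_expand sum_distrib_left mult_ac)
    also have "\<dots> = F z / 2" by (subst F) (simp add: w sum_divide_distrib)
    finally have "Re (H z w) = Re (F z / 2)" by (rule arg_cong)
    then have "Re (H z w) = f z / 2" by (simp only: F_def Re_divide_numeral minus_complex.sel) simp
    then show ?thesis by (subst sym) (simp add: form_Re)
  qed
  then show ?thesis by blast
qed

end

section \<open>The Bismut connection in a chart\<close>

context hermitian_chart
begin

text \<open>The first vector is the direction of differentiation. The slots of type (0,1), namely
  \<open>c\<close> here and both \<open>a\<close> and \<open>c\<close> in \<open>dbh3\<close>, take
  coefficients with respect to d/dzbar, so both expressions are trilinear over the complex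
  numbers.\<close>

definition dh3 :: "complex^'n \<Rightarrow> complex^'n \<Rightarrow> complex^'n \<Rightarrow> complex^'n \<Rightarrow> complex" where
  "dh3 y a b c = (\<Sum>i\<in>UNIV. \<Sum>j\<in>UNIV. \<Sum>k\<in>UNIV. dz k (hc i j) y * a $ k * b $ i * c $ j)"

definition dbh3 :: "complex^'n \<Rightarrow> complex^'n \<Rightarrow> complex^'n \<Rightarrow> complex^'n \<Rightarrow> complex" where
  "dbh3 y a b c = (\<Sum>i\<in>UNIV. \<Sum>j\<in>UNIV. \<Sum>k\<in>UNIV. dzb k (hc i j) y * a $ k * b $ i * c $ j)"

lemma dh3_zero [simp]: "dh3 y 0 b c = 0" "dh3 y a 0 c = 0" "dh3 y a b 0 = 0"
  "dbh3 y 0 b c = 0" "dbh3 y a 0 c = 0" "dbh3 y a b 0 = 0"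
  by (simp_all add: dh3_def dbh3_def)

lemma cnj_dh3:
  assumes "y \<in> V"
  shows "cnj (dh3 y a b (cnjv c)) = dbh3 y (cnjv a) c (cnjv b)"
  unfolding dh3_def dbh3_def
  by (subst (2) sum.swap) (simp add: dhc_cnj[OF assms] cnjv_def mult_ac)

lemma cderiv_fund_form:
  assumes "y \<in> V"
  shows "cderiv (\<lambda>y. fund_form g y [Z, W]) y U =
    \<i> * (dh3 y (fst U) (fst Z) (snd W) + dbh3 y (snd U) (fst Z) (snd W)
        - dh3 y (fst U) (fst W) (snd Z) - dbh3 y (snd U) (fst W) (snd Z))"
proof -
  have "cderiv (\<lambda>y. fund_form g y [Z, W]) y U = cderiv (\<lambda>y. \<Sum>i\<in>UNIV. \<Sum>j\<in>UNIV.
      hc i j y * (\<i> * fst Z $ i * snd W $ j + (- \<i>) * fst W $ i * snd Z $ j)) y U"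
    by (rule cderiv_cong[OF open_V assms]) (rule fund_form_eq)
  also have "\<dots> = (\<Sum>i\<in>UNIV. \<Sum>j\<in>UNIV.
      cderiv (hc i j) y U * (\<i> * fst Z $ i * snd W $ j + (- \<i>) * fst W $ i * snd Z $ j))"
    by (simp add: cderiv_sum cderiv_mult differentiable_sum_finite differentiable_mult assms)
  also have "\<dots> = \<i> * (dh3 y (fst U) (fst Z) (snd W) + dbh3 y (snd U) (fst Z) (snd W)
        - dh3 y (fst U) (fst W) (snd Z) - dbh3 y (snd U) (fst W) (snd Z))"
    unfolding dh3_def dbh3_def cderiv_expand[OF hc_diff[OF assms]]
    by (simp add: sum_distrib_left sum_distrib_right sum.distrib sum_subtractf algebra_simps)
  finally show ?thesis .
qed

lemma del_fund_form:
  assumes "y \<in> V"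
  shows "del 1 1 (fund_form g) y [Z, W, U] = \<i> *
    (dh3 y (fst Z) (fst W) (snd U) - dh3 y (fst W) (fst Z) (snd U)
   + dh3 y (fst W) (fst U) (snd Z) - dh3 y (fst U) (fst W) (snd Z)
   + dh3 y (fst U) (fst Z) (snd W) - dh3 y (fst Z) (fst U) (snd W))"
  unfolding del_def Suc_1 pq_part_21 ext_d_2 cderiv_fund_form[OF assms] by (simp add: algebra_simps)

lemma delbar_fund_form:
  assumes "y \<in> V"
  shows "delbar 1 1 (fund_form g) y [Z, W, U] = \<i> *
    (dbh3 y (snd U) (fst Z) (snd W) - dbh3 y (snd W) (fst Z) (snd U)
   + dbh3 y (snd Z) (fst W) (snd U) - dbh3 y (snd U) (fst W) (snd Z)
   + dbh3 y (snd W) (fst U) (snd Z) - dbh3 y (snd Z) (fst U) (snd W))"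
  unfolding delbar_def Suc_1 pq_part_12 ext_d_2 cderiv_fund_form[OF assms] by (simp add: algebra_simps)

text \<open>The one real trilinear expression to which the derivatives of the metric, the form d^c
  \<omega> and the Christoffel symbols all reduce; comparing connections then becomes linear
  arithmetic in its six permutations.\<close>

definition pr :: "complex^'n \<Rightarrow> complex^'n \<Rightarrow> complex^'n \<Rightarrow> complex^'n \<Rightarrow> real" where
  "pr y u v w = Re (dh3 y u v (cnjv w))"

lemma Re_dbh3: "y \<in> V \<Longrightarrow> Re (dbh3 y (cnjv u) v (cnjv w)) = pr y u w v"
  using arg_cong[OF cnj_dh3[of y u w v], of Re] by (simp add: pr_def)

lemma pr_linear:
  "pr y (u + u') v w = pr y u v w + pr y u' v w" "pr y (r *\<^sub>R u) v w = r * pr y u v w"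
  "pr y u (v + v') w = pr y u v w + pr y u v' w" "pr y u (r *\<^sub>R v) w = r * pr y u v w"
  "pr y u v (w + w') = pr y u v w + pr y u v w'" "pr y u v (r *\<^sub>R w) = r * pr y u v w"
  by (simp_all add: pr_def dh3_def cnjv_def algebra_simps sum.distrib sum_distrib_left)

lemma Re_dc_fund_form:
  assumes "y \<in> V"
  shows "Re (dc_fund_form g y [real_tan u, real_tan v, real_tan z]) =
    2 * (pr y u v z - pr y v u z + pr y v z u - pr y z v u + pr y z u v - pr y u z v)"
  unfolding dc_fund_form_def del_fund_form[OF assms] delbar_fund_form[OF assms] real_tan_def
  by (simp add: Re_dbh3[OF assms] pr_def[symmetric] algebra_simps)

lemma frechet_metric:
  assumes "y \<in> V"
  shows "frechet_derivative (\<lambda>y. g y v w) (at y) u = 2 * (pr y u v w + pr y u w v)"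
proof -
  let ?D = "\<lambda>u. 2 * Re (\<Sum>i\<in>UNIV. \<Sum>j\<in>UNIV. frechet_derivative (hc i j) (at y) u * v $ i * cnj (w $ j))"
  have "((\<lambda>y. 2 * Re (\<Sum>i\<in>UNIV. \<Sum>j\<in>UNIV. hc i j y * v $ i * cnj (w $ j))) has_derivative ?D) (at y)"
    by (intro has_derivative_mult_right bounded_linear.has_derivative[OF bounded_linear_Re] has_derivative_sum
        has_derivative_mult_left) (use hc_diff[OF assms] in \<open>simp add: frechet_derivative_works\<close>)
  then have "((\<lambda>y. g y v w) has_derivative ?D) (at y)"
    by (rule has_derivative_transform_within_open[OF _ open_V assms]) (simp add: metric_Re)
  then have "frechet_derivative (\<lambda>y. g y v w) (at y) u = ?D u"
    by (simp add: frechet_derivative_at[symmetric])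
  also have "(\<Sum>i\<in>UNIV. \<Sum>j\<in>UNIV. frechet_derivative (hc i j) (at y) u * v $ i * cnj (w $ j)) =
      dh3 y u v (cnjv w) + dbh3 y (cnjv u) v (cnjv w)"
    unfolding frechet_expand[OF hc_diff[OF assms]] dh3_def dbh3_def
    by (simp add: cnjv_def sum_distrib_right sum_distrib_left sum.distrib distrib_right distrib_left mult_ac)
  finally show ?thesis by (simp add: Re_dbh3[OF assms] pr_def)
qed

text \<open>The Koszul expression, half of d_u g(v,z) + d_v g(u,z) - d_z g(u,v). Each derivative of
  g is twice a sum of two values of \<open>pr\<close>, so the factor 1/2 disappears.\<close>

definition koszul :: "complex^'n \<Rightarrow> complex^'n \<Rightarrow> complex^'n \<Rightarrow> complex^'n \<Rightarrow> real" where
  "koszul y u v z = pr y u v z + pr y u z v + pr y v u z + pr y v z u - pr y z u v - pr y z v u"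

text \<open>The metric condition at three permuted triples, combined with symmetry, forces the
  Koszul value; conversely the Riesz representative of the Koszul functional is symmetric and
  metric.\<close>

lemma christoffel_koszul:
  assumes "y \<in> V"
  shows "g y (christoffel g y u v) z = koszul y u v z"
proof -
  interpret F: hermitian_form "g y" by (rule hermitian_form_at[OF assms])
  let ?P = "\<lambda>\<Gamma>. bilinear \<Gamma> \<and> (\<forall>v w. \<Gamma> v w = \<Gamma> w v) \<and>
     (\<forall>u v w. frechet_derivative (\<lambda>y. g y v w) (at y) u = g y (\<Gamma> u v) w + g y v (\<Gamma> u w))"
  have unique: "g y (\<Gamma> u v) z = koszul y u v z" if "?P \<Gamma>" for \<Gamma> u v z
  proof -
    have D: "2 * (pr y u v w + pr y u w v) = g y (\<Gamma> u v) w + g y v (\<Gamma> u w)" for u v w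
    proof -
      have "frechet_derivative (\<lambda>y. g y v w) (at y) u = g y (\<Gamma> u v) w + g y v (\<Gamma> u w)"
        using that by blast
      then show ?thesis by (simp only: frechet_metric[OF assms])
    qed
    have S: "\<Gamma> v w = \<Gamma> w v" for v w using that by blast
    show ?thesis
      using D[of u v z] D[of v u z] D[of z u v] F.sym[of v "\<Gamma> u z"] F.sym[of u "\<Gamma> v z"]
      unfolding koszul_def S[of v u] S[of z u] S[of z v] by simp
  qed
  have "linear (koszul y u v)" for u v
    by (rule linearI) (simp_all add: koszul_def pr_linear algebra_simps)
  then have "\<exists>w. \<forall>z. g y w z = koszul y u v z" for u v by (rule F.riesz)
  then obtain \<Gamma> where \<Gamma>: "\<And>u v z. g y (\<Gamma> u v) z = koszul y u v z" by metis
  have "?P \<Gamma>"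
  proof (intro conjI allI)
    show "bilinear \<Gamma>"
      unfolding bilinear_def
      by (intro conjI allI linearI; rule F.nondegenerate)
        (simp_all add: \<Gamma> bilinear_ladd[OF F.bil] bilinear_lmul[OF F.bil] koszul_def pr_linear algebra_simps)
    show "\<Gamma> v w = \<Gamma> w v" for v w
      by (rule F.nondegenerate) (simp add: \<Gamma> koszul_def)
    show "frechet_derivative (\<lambda>y. g y v w) (at y) u = g y (\<Gamma> u v) w + g y v (\<Gamma> u w)" for u v w
      by (simp add: frechet_metric[OF assms] F.sym[of v] \<Gamma> koszul_def)
  qed
  moreover have "\<Gamma>' = \<Gamma>" if "?P \<Gamma>'" for \<Gamma>'
    by (intro ext F.nondegenerate) (simp add: \<Gamma> unique[OF that])
  ultimately have "christoffel g y = \<Gamma>"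
    unfolding christoffel_def by (rule the_equality)
  then show ?thesis by (simp add: \<Gamma>)
qed

text \<open>The Bismut connection preserves the \<open>(1,0)\<close>-vectors:
  \<open>\<nabla>\<^sub>k \<partial>\<^sub>i = bis k i m \<partial>\<^sub>m\<close> and \<open>\<nabla>\<^sub>k\<^sub>b\<^sub>a\<^sub>r \<partial>\<^sub>i = bisb k i m \<partial>\<^sub>m\<close>.\<close>
definition bis :: "'n \<Rightarrow> 'n \<Rightarrow> 'n \<Rightarrow> complex^'n \<Rightarrow> complex" where
  "bis k i m y = (\<Sum>j\<in>UNIV. hi j m y * dz i (hc k j) y)"

definition bisb :: "'n \<Rightarrow> 'n \<Rightarrow> 'n \<Rightarrow> complex^'n \<Rightarrow> complex" where
  "bisb k i m y = (\<Sum>j\<in>UNIV. hi j m y * (dzb k (hc i j) y - dzb j (hc i k) y))"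

definition bis_mat :: "complex^'n \<Rightarrow> 'n \<Rightarrow> 'n \<Rightarrow> complex^'n \<Rightarrow> complex" where
  "bis_mat u m i y = (\<Sum>k\<in>UNIV. u $ k * bis k i m y + cnj (u $ k) * bisb k i m y)"

lemma bis_lower:
  assumes "y \<in> V"
  shows "(\<Sum>m\<in>UNIV. hc m l y * bis k i m y) = dz i (hc k l) y"
    and "(\<Sum>m\<in>UNIV. hc m l y * bisb k i m y) = dzb k (hc i l) y - dzb l (hc i k) y"
proof -
  have *: "(\<Sum>m\<in>UNIV. hc m l y * (\<Sum>j\<in>UNIV. hi j m y * c j)) = c l" for c
  proof -
    have "(\<Sum>m\<in>UNIV. hc m l y * (\<Sum>j\<in>UNIV. hi j m y * c j)) = (\<Sum>j\<in>UNIV. (\<Sum>m\<in>UNIV. hi j m y * hc m l y) * c j)"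
      by (simp add: sum_distrib_left sum_distrib_right mult_ac) (rule sum.swap)
    then show ?thesis by (simp add: hc_hi assms if_distrib if_distribR cong: if_cong)
  qed
  show "(\<Sum>m\<in>UNIV. hc m l y * bis k i m y) = dz i (hc k l) y"
    "(\<Sum>m\<in>UNIV. hc m l y * bisb k i m y) = dzb k (hc i l) y - dzb l (hc i k) y"
    unfolding bis_def bisb_def by (simp_all only: *)
qed

text \<open>The right-hand side is what remains of the Koszul expression after half of d^c \<omega>
  is subtracted: three of the six terms cancel and the other three double. What survives is the
  pairing with a complex linear function of \<open>v\<close>, whose matrix is
  \<open>bis_mat\<close>.\<close>

lemma bis_mat_metric:
  assumes "y \<in> V"
  shows "g y (\<chi> m. \<Sum>i\<in>UNIV. bis_mat u m i y * v $ i) z = 2 * (pr y v u z + pr y u z v - pr y z u v)"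
proof -
  have low: "(\<Sum>m\<in>UNIV. hc m l y * bis_mat u m i y) =
      (\<Sum>k\<in>UNIV. u $ k * (\<Sum>m\<in>UNIV. hc m l y * bis k i m y) + cnj (u $ k) * (\<Sum>m\<in>UNIV. hc m l y * bisb k i m y))" for l i
  proof -
    have "(\<Sum>m\<in>UNIV. hc m l y * bis_mat u m i y) =
      (\<Sum>m\<in>UNIV. \<Sum>k\<in>UNIV. u $ k * (hc m l y * bis k i m y) + cnj (u $ k) * (hc m l y * bisb k i m y))"
      unfolding bis_mat_def sum_distrib_left by (intro sum.cong refl) (simp add: algebra_simps)
    also have "\<dots> = (\<Sum>k\<in>UNIV. \<Sum>m\<in>UNIV. u $ k * (hc m l y * bis k i m y) + cnj (u $ k) * (hc m l y * bisb k i m y))"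
      by (rule sum.swap)
    finally show ?thesis by (simp only: sum.distrib sum_distrib_left)
  qed
  have "(\<Sum>m\<in>UNIV. \<Sum>l\<in>UNIV. hc m l y * (\<Sum>i\<in>UNIV. bis_mat u m i y * v $ i) * cnj (z $ l)) =
    (\<Sum>l\<in>UNIV. (\<Sum>m\<in>UNIV. hc m l y * (\<Sum>i\<in>UNIV. bis_mat u m i y * v $ i)) * cnj (z $ l))"
    unfolding sum_distrib_right by (rule sum.swap)
  also have "\<dots> = (\<Sum>l\<in>UNIV. \<Sum>i\<in>UNIV. \<Sum>k\<in>UNIV. (u $ k * dz i (hc k l) y +
       cnj (u $ k) * (dzb k (hc i l) y - dzb l (hc i k) y)) * v $ i * cnj (z $ l))"
    unfolding sum_mult_swap low bis_lower[OF assms] sum_distrib_right ..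
  also have "\<dots> = dh3 y v u (cnjv z) + dbh3 y (cnjv u) v (cnjv z) - dbh3 y (cnjv z) v (cnjv u)"
  proof -
    have 1: "dh3 y v u (cnjv z) = (\<Sum>l\<in>UNIV. \<Sum>i\<in>UNIV. \<Sum>k\<in>UNIV. u $ k * dz i (hc k l) y * v $ i * cnj (z $ l))"
    proof -
      have "dh3 y v u (cnjv z) = (\<Sum>k\<in>UNIV. \<Sum>l\<in>UNIV. \<Sum>i\<in>UNIV. u $ k * dz i (hc k l) y * v $ i * cnj (z $ l))"
        unfolding dh3_def by (intro sum.cong refl) (simp add: cnjv_def mult_ac)
      then show ?thesis by (rule trans) (rule sum_rotate[symmetric])
    qed
    have 2: "dbh3 y (cnjv u) v (cnjv z) = (\<Sum>l\<in>UNIV. \<Sum>i\<in>UNIV. \<Sum>k\<in>UNIV. cnj (u $ k) * dzb k (hc i l) y * v $ i * cnj (z $ l))"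
      unfolding dbh3_def by (subst sum.swap) (simp add: cnjv_def mult_ac)
    have 3: "dbh3 y (cnjv z) v (cnjv u) = (\<Sum>l\<in>UNIV. \<Sum>i\<in>UNIV. \<Sum>k\<in>UNIV. cnj (u $ k) * dzb l (hc i k) y * v $ i * cnj (z $ l))"
      unfolding dbh3_def
      by (subst sum_rotate) (simp add: cnjv_def mult_ac)
    show ?thesis unfolding 1 2 3
      by (simp add: sum.distrib sum_subtractf algebra_simps)
  qed
  finally show ?thesis by (simp add: metric_Re[OF assms] pr_def[symmetric] Re_dbh3[OF assms])
qed

lemma bismut_eq:
  assumes "y \<in> V"
  shows "bismut g X Y y = frechet_derivative Y (at y) (X y) + (\<chi> m. \<Sum>i\<in>UNIV. bis_mat (X y) m i y * Y y $ i)"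
proof -
  interpret F: hermitian_form "g y" by (rule hermitian_form_at[OF assms])
  have "g y (frechet_derivative Y (at y) (X y) + (\<chi> m. \<Sum>i\<in>UNIV. bis_mat (X y) m i y * Y y $ i)) z =
     g y (levi_civita g X Y y) z
       - 1 / 2 * Re (dc_fund_form g y [real_tan (X y), real_tan (Y y), real_tan z])" for z
    unfolding levi_civita_def Re_dc_fund_form[OF assms] bilinear_ladd[OF F.bil] christoffel_koszul[OF assms]
      bis_mat_metric[OF assms] koszul_def by (simp add: field_simps)
  then show ?thesis
    unfolding bismut_def
    by (intro the_equality allI F.nondegenerate) simp_all
qed

end

section \<open>Traces over an orthonormal basis\<close>

context hermitian_form
begin

definition orthonormal :: "(complex^'n) set \<Rightarrow> bool" where
  "orthonormal S \<longleftrightarrow> finite S \<and> (\<forall>e\<in>S. \<forall>f\<in>S. B e f = (if e = f then 1 else 0))"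

lemma form_sum_left: "B (\<Sum>i\<in>A. f i) w = (\<Sum>i\<in>A. B (f i) w)"
  by (induction A rule: infinite_finite_induct) (simp_all add: bilinear_lzero[OF bil] bilinear_ladd[OF bil])

lemma orthonormal_coeff:
  assumes "orthonormal S" "f \<in> S"
  shows "B (\<Sum>e\<in>S. c e *\<^sub>R e) f = c f"
proof -
  have "(\<Sum>e\<in>S. c e * B e f) = (\<Sum>e\<in>S. if e = f then c e else 0)"
    by (rule sum.cong) (use assms in \<open>auto simp: orthonormal_def\<close>)
  then show ?thesis
    using assms by (simp add: form_sum_left bilinear_lmul[OF bil] orthonormal_def)
qed

lemma orthonormal_independent:
  assumes "orthonormal S"
  shows "independent S"
proof (rule real_vector.independent_if_scalars_zero)
  show "finite S" using assms by (simp add: orthonormal_def)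
  show "c e = 0" if "(\<Sum>e\<in>S. c e *\<^sub>R e) = 0" "e \<in> S" for c e
    using orthonormal_coeff[OF assms that(2), of c] that(1) by (simp add: bilinear_lzero[OF bil])
qed

text \<open>One Gram-Schmidt step for \<open>B\<close>. Since \<open>orthonormal_basis\<close> is a
  choice, its properties depend on the existence of such a basis.\<close>

lemma orthonormal_extend:
  assumes "orthonormal S" "card S < DIM(complex^'n)"
  shows "\<exists>v. v \<notin> S \<and> orthonormal (insert v S)"
proof -
  have fin: "finite S" using assms by (simp add: orthonormal_def)
  have "dim (span S) = card S"
    by (rule dim_span_eq_card_independent[OF orthonormal_independent[OF assms(1)]])
  then have "span S \<noteq> UNIV" using assms(2) dim_UNIV[where 'a="complex^'n"] by force
  then obtain w where w: "w \<notin> span S" by blast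
  define w' where "w' = w - (\<Sum>e\<in>S. B w e *\<^sub>R e)"
  have "w' \<noteq> 0"
  proof
    assume "w' = 0"
    then have "w = (\<Sum>e\<in>S. B w e *\<^sub>R e)" by (simp add: w'_def)
    moreover have "(\<Sum>e\<in>S. B w e *\<^sub>R e) \<in> span S"
      by (intro span_sum span_scale span_base)
    ultimately show False using w by simp
  qed
  then have p: "B w' w' > 0" by (rule pos)
  have o: "B w' f = 0" if "f \<in> S" for f
    by (simp add: w'_def bilinear_lsub[OF bil] orthonormal_coeff[OF assms(1) that])
  define v where "v = (1 / sqrt (B w' w')) *\<^sub>R w'"
  have "B v v = 1"
    using p by (simp add: v_def bilinear_lmul[OF bil] bilinear_rmul[OF bil])
  moreover have vf: "B v f = 0" "B f v = 0" if "f \<in> S" for f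
    using sym[of v f] by (simp_all add: v_def bilinear_lmul[OF bil] o that)
  moreover have "v \<notin> S" using vf(1)[of v] \<open>B v v = 1\<close> by auto
  ultimately have "orthonormal (insert v S)"
    using assms(1) unfolding orthonormal_def by auto
  then show ?thesis using \<open>v \<notin> S\<close> by blast
qed

lemma orthonormal_exists: "k \<le> DIM(complex^'n) \<Longrightarrow> \<exists>S. orthonormal S \<and> card S = k"
proof (induction k)
  case 0
  show ?case by (rule exI[of _ "{}"]) (simp add: orthonormal_def)
next
  case (Suc k)
  then obtain S where S: "orthonormal S" "card S = k" by auto
  then obtain v where "v \<notin> S" "orthonormal (insert v S)" using orthonormal_extend[OF S(1)] Suc.prems by auto
  then show ?case using S by (intro exI[of _ "insert v S"]) (simp add: orthonormal_def)
qed

lemma orthonormal_basis: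
  "orthonormal (orthonormal_basis B)" "card (orthonormal_basis B) = DIM(complex^'n)"
proof -
  have "\<exists>S. finite S \<and> card S = DIM(complex^'n) \<and> (\<forall>e\<in>S. \<forall>f\<in>S. B e f = (if e = f then 1 else 0))"
    using orthonormal_exists[OF order_refl] unfolding orthonormal_def by blast
  from someI_ex[OF this]
  show "orthonormal (orthonormal_basis B)" "card (orthonormal_basis B) = DIM(complex^'n)"
    unfolding orthonormal_basis_def orthonormal_def by blast+
qed

lemma orthonormal_basis_expand: "(\<Sum>e\<in>orthonormal_basis B. B w e *\<^sub>R e) = w"
proof -
  let ?S = "orthonormal_basis B"
  have "UNIV \<subseteq> span ?S"
    by (rule card_ge_dim_independent[OF subset_UNIV orthonormal_independent]) (simp_all add: orthonormal_basis)
  then have "w \<in> span ?S" by blast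
  moreover have "finite ?S" using orthonormal_basis(1) by (simp add: orthonormal_def)
  ultimately obtain c where c: "w = (\<Sum>e\<in>?S. c e *\<^sub>R e)" by (auto simp: span_finite)
  have "B w e = c e" if "e \<in> ?S" for e
    using orthonormal_coeff[OF orthonormal_basis(1) that, of c] by (simp only: c[symmetric])
  then have "(\<Sum>e\<in>?S. B w e *\<^sub>R e) = (\<Sum>e\<in>?S. c e *\<^sub>R e)" by (intro sum.cong) auto
  then show ?thesis by (rule trans) (rule c[symmetric])
qed

text \<open>A real orthonormal basis has twice as many elements as the complex dimension, which the
  factor 1/2 in \<open>H\<close> compensates: summing 2 H(w,e) e gives w - i J w = 2 w.\<close>

lemma orthonormal_basis_complex_expand:
  "(\<Sum>e\<in>orthonormal_basis B. H w e * e $ m) = w $ m"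
proof -
  have comp: "(\<Sum>e\<in>orthonormal_basis B. of_real (B w e) * e $ m) = w $ m" for w
  proof -
    have "(\<Sum>e\<in>orthonormal_basis B. of_real (B w e) * e $ m) = (\<Sum>e\<in>orthonormal_basis B. B w e *\<^sub>R e) $ m"
      by (simp add: scaleR_conv_of_real[where 'a=complex])
    then show ?thesis by (simp add: orthonormal_basis_expand)
  qed
  have "2 * H w e = of_real (B w e) - \<i> * of_real (B (J w) e)" for e
    by (simp add: H_def B_J_left)
  then have "2 * (\<Sum>e\<in>orthonormal_basis B. H w e * e $ m) =
      (\<Sum>e\<in>orthonormal_basis B. of_real (B w e) * e $ m) - \<i> * (\<Sum>e\<in>orthonormal_basis B. of_real (B (J w) e) * e $ m)"
    by (simp add: sum_distrib_left sum_subtractf[symmetric] mult.assoc[symmetric] left_diff_distrib)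
  also have "\<dots> = 2 * w $ m" by (simp only: comp) (simp add: J_def)
  finally show ?thesis by simp
qed

text \<open>The sum is the real trace of the complex linear map i M, that is, twice the real part of
  its complex trace. The 2 cancels the 1/2 in the definition of the Bismut-Ricci form.\<close>

lemma orthonormal_basis_trace:
  "(\<Sum>e\<in>orthonormal_basis B. B (\<chi> m. \<Sum>i\<in>UNIV. M m i * J e $ i) e) = - 2 * Im (\<Sum>m\<in>UNIV. M m m)"
proof -
  have e: "H (\<chi> m. \<Sum>i\<in>UNIV. M m i * J e $ i) e = (\<Sum>i\<in>UNIV. \<Sum>m\<in>UNIV. \<i> * M m i * (H (axis m 1) e * e $ i))" for e
  proof -
    have Hv: "H v e = (\<Sum>m\<in>UNIV. v $ m * H (axis m 1) e)" for v
      by (rule clinear_expand[of "\<lambda>v. H v e"]) (simp_all add: H_add H_scale)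
    have "H (\<chi> m. \<Sum>i\<in>UNIV. M m i * J e $ i) e = (\<Sum>m\<in>UNIV. \<Sum>i\<in>UNIV. \<i> * M m i * (H (axis m 1) e * e $ i))"
      by (subst Hv) (simp add: J_def sum_distrib_left mult_ac)
    then show ?thesis by (rule trans) (rule sum.swap)
  qed
  have "(\<Sum>e\<in>orthonormal_basis B. H (\<chi> m. \<Sum>i\<in>UNIV. M m i * J e $ i) e) =
      (\<Sum>i\<in>UNIV. \<Sum>m\<in>UNIV. \<i> * M m i * (\<Sum>e\<in>orthonormal_basis B. H (axis m 1) e * e $ i))"
    unfolding e sum_distrib_left
    by (subst sum.swap, rule sum.cong[OF refl], rule sum.swap)
  also have "\<dots> = (\<Sum>i\<in>UNIV. \<i> * M i i)"
    by (simp add: orthonormal_basis_complex_expand axis_def if_distrib cong: if_cong)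
  finally have "Re (\<Sum>e\<in>orthonormal_basis B. H (\<chi> m. \<Sum>i\<in>UNIV. M m i * J e $ i) e) = - Im (\<Sum>m\<in>UNIV. M m m)"
    by (simp add: Re_sum Im_sum sum_negf)
  then show ?thesis by (simp only: form_Re Re_sum sum_distrib_left[symmetric])
qed

end

section \<open>The Bismut-Ricci form\<close>

context hermitian_chart
begin

lemma bis_diff [simp]:
  assumes "y \<in> V"
  shows "bis k i m differentiable (at y)" "bisb k i m differentiable (at y)" "bis_mat u m i differentiable (at y)"
proof -
  show 1: "bis k i m differentiable (at y)" for k
    unfolding bis_def[abs_def]
    by (intro differentiable_sum_finite differentiable_mult hi_diff dhc_diff assms)
  show 2: "bisb k i m differentiable (at y)" for k
    unfolding bisb_def[abs_def]
    by (intro differentiable_sum_finite differentiable_mult differentiable_diff hi_diff dhc_diff assms)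
  show "bis_mat u m i differentiable (at y)"
    unfolding bis_mat_def[abs_def]
    by (intro differentiable_sum_finite differentiable_add differentiable_mult differentiable_const 1 2)
qed

lemma bismut_const:
  assumes "y \<in> V"
  shows "bismut g (\<lambda>_. u) (\<lambda>_. w) y = (\<chi> m. \<Sum>i\<in>UNIV. bis_mat u m i y * w $ i)"
  by (simp add: bismut_eq[OF assms])

lemma bismut_twice:
  assumes "y \<in> V"
  shows "bismut g (\<lambda>_. u) (bismut g (\<lambda>_. v) (\<lambda>_. w)) y =
    (\<chi> m. \<Sum>i\<in>UNIV. (frechet_derivative (bis_mat v m i) (at y) u + (\<Sum>l\<in>UNIV. bis_mat u m l y * bis_mat v l i y)) * w $ i)"
proof -
  have "((\<lambda>y. \<chi> m. \<Sum>i\<in>UNIV. bis_mat v m i y * w $ i) has_derivative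
      (\<lambda>u. \<chi> m. \<Sum>i\<in>UNIV. frechet_derivative (bis_mat v m i) (at y) u * w $ i)) (at y)"
    by (intro has_derivative_vec has_derivative_sum has_derivative_mult_left)
      (use bis_diff(3)[OF assms] in \<open>simp add: frechet_derivative_works\<close>)
  then have "(bismut g (\<lambda>_. v) (\<lambda>_. w) has_derivative
      (\<lambda>u. \<chi> m. \<Sum>i\<in>UNIV. frechet_derivative (bis_mat v m i) (at y) u * w $ i)) (at y)"
    by (rule has_derivative_transform_within_open[OF _ open_V assms]) (simp add: bismut_const)
  then have "frechet_derivative (bismut g (\<lambda>_. v) (\<lambda>_. w)) (at y) u =
      (\<chi> m. \<Sum>i\<in>UNIV. frechet_derivative (bis_mat v m i) (at y) u * w $ i)"
    by (simp add: frechet_derivative_at[symmetric])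
  moreover have "(\<Sum>l\<in>UNIV. bis_mat u m l y * (\<Sum>i\<in>UNIV. bis_mat v l i y * w $ i)) =
      (\<Sum>i\<in>UNIV. (\<Sum>l\<in>UNIV. bis_mat u m l y * bis_mat v l i y) * w $ i)" for m
    by (rule sum_mult_swap)
  ultimately show ?thesis
    by (simp add: bismut_eq[OF assms] bismut_const[OF assms] vec_eq_iff sum.distrib distrib_right)
qed

definition bis_curv :: "complex^'n \<Rightarrow> complex^'n \<Rightarrow> 'n \<Rightarrow> 'n \<Rightarrow> complex^'n \<Rightarrow> complex" where
  "bis_curv u v m i y = (frechet_derivative (bis_mat v m i) (at y) u + (\<Sum>l\<in>UNIV. bis_mat u m l y * bis_mat v l i y)) -
    (frechet_derivative (bis_mat u m i) (at y) v + (\<Sum>l\<in>UNIV. bis_mat v m l y * bis_mat u l i y))"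

lemma bismut_curvature_const:
  assumes "y \<in> V"
  shows "bismut_curvature g (\<lambda>_. u) (\<lambda>_. v) (\<lambda>_. w) y = (\<chi> m. \<Sum>i\<in>UNIV. bis_curv u v m i y * w $ i)"
proof -
  have lb: "lie_bracket (\<lambda>_. u) (\<lambda>_. v) = (\<lambda>_. 0)"
    by (simp add: lie_bracket_def fun_eq_iff)
  have "bismut g (\<lambda>_. 0) (\<lambda>_. w) y = 0"
    by (simp add: bismut_const[OF assms] bis_mat_def vec_eq_iff)
  then show ?thesis
    unfolding bismut_curvature_def lb bismut_twice[OF assms] bis_curv_def
    by (simp add: vec_eq_iff sum_subtractf[symmetric] left_diff_distrib)
qed

definition bis_trace :: "'n \<Rightarrow> complex^'n \<Rightarrow> complex" where "bis_trace k y = (\<Sum>m\<in>UNIV. bis k m m y)"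

definition bisb_trace :: "'n \<Rightarrow> complex^'n \<Rightarrow> complex" where "bisb_trace k y = (\<Sum>m\<in>UNIV. bisb k m m y)"

lemma bis_trace_diff [simp]: "y \<in> V \<Longrightarrow> bis_trace k differentiable (at y)" "y \<in> V \<Longrightarrow> bisb_trace k differentiable (at y)"
  unfolding bis_trace_def[abs_def] bisb_trace_def[abs_def] by (auto intro: differentiable_sum_finite)

lemma bis_mat_trace: "(\<Sum>m\<in>UNIV. bis_mat u m m y) = (\<Sum>k\<in>UNIV. u $ k * bis_trace k y + cnj (u $ k) * bisb_trace k y)"
  unfolding bis_mat_def bis_trace_def bisb_trace_def
  by (subst sum.swap) (simp add: sum.distrib sum_distrib_left)

text \<open>The derivative, in the real direction \<open>u\<close>, of the traced connection form on
  the constant field \<open>v\<close>. Antisymmetrized it is the exterior derivative of that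
  form.\<close>

definition dth :: "complex^'n \<Rightarrow> complex^'n \<Rightarrow> complex^'n \<Rightarrow> complex" where
  "dth y u v = (\<Sum>k\<in>UNIV. v $ k * frechet_derivative (bis_trace k) (at y) u + cnj (v $ k) * frechet_derivative (bisb_trace k) (at y) u)"

text \<open>The quadratic part of the curvature is a commutator of matrices and has trace zero, so
  only the derivatives of the traced connection form remain.\<close>

lemma bis_curv_trace:
  assumes "y \<in> V"
  shows "(\<Sum>m\<in>UNIV. bis_curv u v m m y) = dth y u v - dth y v u"
proof -
  have fd: "(\<Sum>m\<in>UNIV. frechet_derivative (bis_mat v m m) (at y) u) = dth y u v" for u v
  proof -
    have "((\<lambda>y. \<Sum>m\<in>UNIV. bis_mat v m m y) has_derivative (\<lambda>u. \<Sum>m\<in>UNIV. frechet_derivative (bis_mat v m m) (at y) u)) (at y)"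
      by (intro has_derivative_sum) (use bis_diff(3)[OF assms] in \<open>simp add: frechet_derivative_works\<close>)
    moreover have "((\<lambda>y. \<Sum>k\<in>UNIV. v $ k * bis_trace k y + cnj (v $ k) * bisb_trace k y) has_derivative (\<lambda>u. dth y u v)) (at y)"
      unfolding dth_def
      by (intro has_derivative_sum has_derivative_add has_derivative_mult_right)
        (use bis_trace_diff[OF assms] in \<open>simp_all add: frechet_derivative_works\<close>)
    ultimately have "(\<lambda>u. \<Sum>m\<in>UNIV. frechet_derivative (bis_mat v m m) (at y) u) = (\<lambda>u. dth y u v)"
      unfolding bis_mat_trace by (rule has_derivative_unique)
    then show ?thesis by (rule fun_cong)
  qed
  have "(\<Sum>m\<in>UNIV. \<Sum>l\<in>UNIV. bis_mat u m l y * bis_mat v l m y) = (\<Sum>m\<in>UNIV. \<Sum>l\<in>UNIV. bis_mat v m l y * bis_mat u l m y)"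
    by (subst sum.swap) (simp add: mult.commute)
  then show ?thesis by (simp add: bis_curv_def sum_subtractf sum.distrib fd)
qed

lemma bismut_ricci_eq:
  assumes "y \<in> V"
  shows "bismut_ricci g y u v = - Im (dth y u v - dth y v u)"
proof -
  interpret F: hermitian_form "g y" by (rule hermitian_form_at[OF assms])
  show ?thesis
    unfolding bismut_ricci_def bismut_curvature_const[OF assms] F.orthonormal_basis_trace bis_curv_trace[OF assms]
    by simp
qed

end

section \<open>The Bismut-Ricci form on coordinate vectors\<close>

context hermitian_chart
begin

text \<open>\<open>tors l i j = - \<i> \<partial>\<omega>(\<partial>\<^sub>i, \<partial>\<^sub>l\<^sub>b\<^sub>a\<^sub>r, \<partial>\<^sub>j)\<close>, the off-diagonal term of the Dolbeault operator with twist \<open>\<partial>\<omega>\<close>.\<close>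
definition tors :: "'n \<Rightarrow> 'n \<Rightarrow> 'n \<Rightarrow> complex^'n \<Rightarrow> complex" where
  "tors l i j y = dz j (hc i l) y - dz i (hc j l) y"

text \<open>The Chern connection of g on (1,0)-vectors: the derivative of d_i along d_k has the
  component \<open>chern_coeff k i j\<close> along d_j. The coefficients \<open>bis\<close> are the
  same with the two lower indices exchanged.\<close>

definition chern_coeff :: "'n \<Rightarrow> 'n \<Rightarrow> 'n \<Rightarrow> complex^'n \<Rightarrow> complex" where
  "chern_coeff k i j y = (\<Sum>m\<in>UNIV. dz k (hc i m) y * hi m j y)"

text \<open>Complex multiples of axis vectors are needed because the real and imaginary parts of d_p
  and d_pbar are 1/2 and -i/2 or i/2 times the same axis vector.\<close>

lemma dth_axis:
  assumes "y \<in> V"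
  shows "dth y (c *s axis p 1) (d *s axis q 1) =
    d * c * dz p (bis_trace q) y + d * cnj c * dzb p (bis_trace q) y +
    cnj d * c * dz p (bisb_trace q) y + cnj d * cnj c * dzb p (bisb_trace q) y"
proof -
  have fr: "frechet_derivative f (at y) (c *s axis p 1) = c * dz p f y + cnj c * dzb p f y"
    if "f differentiable (at y)" for f
    unfolding frechet_expand[OF that]
    by (simp add: axis_def if_distrib if_distribR cong: if_cong)
  show ?thesis
    unfolding dth_def fr[OF bis_trace_diff(1)[OF assms]] fr[OF bis_trace_diff(2)[OF assms]]
    by (simp add: axis_def if_distrib if_distribR sum.distrib algebra_simps cong: if_cong)
qed

lemma tan_parts_axis:
  "re_tan (holo_vec (axis p 1)) = (1/2) *s axis p 1" "im_tan (holo_vec (axis p 1)) = (- \<i>/2) *s axis p 1"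
  "re_tan (antiholo_vec (axis p 1)) = (1/2) *s axis p 1" "im_tan (antiholo_vec (axis p 1)) = (\<i>/2) *s axis p 1"
  by (simp_all add: re_tan_def im_tan_eq cnjv_def axis_def vec_eq_iff)

text \<open>The conjugates come from the imaginary part in \<open>bismut_ricci_eq\<close>. They are
  removed below with the help of the second derivatives of log det h.\<close>

lemma bismut_ricci_form_raw:
  assumes "y \<in> V"
  shows "bismut_ricci_form g y [holo_vec (axis p 1), antiholo_vec (axis q 1)] =
      \<i> / 2 * (dz p (bisb_trace q) y - dzb q (bis_trace p) y - cnj (dzb p (bis_trace q) y) + cnj (dz q (bisb_trace p) y))"
    and "bismut_ricci_form g y [holo_vec (axis p 1), holo_vec (axis q 1)] =
      \<i> / 2 * (dz p (bis_trace q) y - dz q (bis_trace p) y - cnj (dzb p (bisb_trace q) y) + cnj (dzb q (bisb_trace p) y))"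
  unfolding bismut_ricci_form_def cext_def nth_Cons_0 One_nat_def nth_Cons_Suc tan_parts_axis
    bismut_ricci_eq[OF assms] dth_axis[OF assms]
  by (simp_all add: complex_eq_iff field_simps)

text \<open>By Jacobi's formula this is the derivative of log det h along d/dzbar_k. Working with
  the trace avoids determinants and logarithms.\<close>

definition dlogdet :: "'n \<Rightarrow> complex^'n \<Rightarrow> complex" where
  "dlogdet k y = (\<Sum>m\<in>UNIV. \<Sum>j\<in>UNIV. hi j m y * dzb k (hc m j) y)"

text \<open>This is the trace of the compatibility of the Bismut connection with the metric.\<close>

lemma bisb_trace_eq:
  assumes "y \<in> V"
  shows "bisb_trace k y = dlogdet k y - cnj (bis_trace k y)"
proof -
  have "cnj (bis_trace k y) = (\<Sum>m\<in>UNIV. \<Sum>j\<in>UNIV. hi m j y * dzb m (hc j k) y)"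
    by (simp add: bis_trace_def bis_def hi_cnj[OF assms] dhc_cnj[OF assms])
  also have "\<dots> = (\<Sum>m\<in>UNIV. \<Sum>j\<in>UNIV. hi j m y * dzb j (hc m k) y)" by (rule sum.swap)
  finally show ?thesis
    by (simp add: bisb_trace_def bisb_def dlogdet_def right_diff_distrib sum_subtractf)
qed

lemma cderiv_th:
  assumes "y \<in> V"
  shows "cderiv (bis_trace q) y Z = (\<Sum>m\<in>UNIV. \<Sum>j\<in>UNIV.
    cderiv (hi j m) y Z * dz m (hc q j) y + hi j m y * cderiv (dz m (hc q j)) y Z)"
  unfolding bis_trace_def[abs_def] bis_def
  by (simp add: cderiv_sum cderiv_mult differentiable_sum_finite differentiable_mult assms)

lemma cderiv_dlogdet:
  assumes "y \<in> V"
  shows "cderiv (dlogdet q) y Z = (\<Sum>m\<in>UNIV. \<Sum>j\<in>UNIV.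
    cderiv (hi j m) y Z * dzb q (hc m j) y + hi j m y * cderiv (dzb q (hc m j)) y Z)"
  unfolding dlogdet_def[abs_def]
  by (simp add: cderiv_sum cderiv_mult differentiable_sum_finite differentiable_mult assms)

lemma cderiv_thb:
  assumes "y \<in> V"
  shows "cderiv (bisb_trace q) y Z = (\<Sum>m\<in>UNIV. \<Sum>j\<in>UNIV.
    cderiv (hi j m) y Z * (dzb q (hc m j) y - dzb j (hc m q) y) +
    hi j m y * (cderiv (dzb q (hc m j)) y Z - cderiv (dzb j (hc m q)) y Z))"
  unfolding bisb_trace_def[abs_def] bisb_def
  by (simp add: cderiv_sum cderiv_mult cderiv_diff differentiable_sum_finite differentiable_mult differentiable_diff assms)

lemma dlogdet_diff [simp]: "y \<in> V \<Longrightarrow> dlogdet k differentiable (at y)"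
  unfolding dlogdet_def[abs_def] by (intro differentiable_sum_finite differentiable_mult hi_diff dhc_diff)

lemma ddh_cnj:
  assumes "y \<in> V"
  shows "cnj (dz q (dzb p (hc i j)) y) = dzb q (dz p (hc j i)) y"
proof -
  have "dzb q (\<lambda>y. cnj (dzb p (hc i j) y)) y = dzb q (dz p (hc j i)) y"
    unfolding dzb_def[of q] by (rule cderiv_cong[OF open_V assms]) (simp add: dhc_cnj)
  then show ?thesis by (simp add: dzb_cnj assms)
qed

lemma dz_hc_commute:
  assumes "y \<in> V"
  shows "dz k (dz l (hc i j)) y = dz l (dz k (hc i j)) y"
    "dzb l (dz k (hc i j)) y = dz k (dzb l (hc i j)) y"
    "dzb k (dzb l (hc i j)) y = dzb l (dzb k (hc i j)) y"
  using dz_dz[OF open_V assms Ck_hc] by metis+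

text \<open>The normal form of all terms quadratic in first derivatives of h: two index pairs, each
  contracted with the inverse metric. Relabelling the two pairs (\<open>quad_swap\<close>) is the
  symmetry by which such terms are identified.\<close>

definition quad :: "complex^'n \<Rightarrow> ('n \<Rightarrow> 'n \<Rightarrow> 'n \<Rightarrow> 'n \<Rightarrow> complex) \<Rightarrow> complex" where
  "quad y f = (\<Sum>k\<in>UNIV. \<Sum>l\<in>UNIV. \<Sum>s\<in>UNIV. \<Sum>c\<in>UNIV. hi l k y * hi c s y * f k l s c)"

lemma quad_diff: "quad y (\<lambda>k l s c. f k l s c - f' k l s c) = quad y f - quad y f'"
  by (simp add: quad_def right_diff_distrib sum_subtractf)

lemma quad_swap: "quad y f = quad y (\<lambda>k l s c. f s c k l)"
proof -
  have "quad y f = (\<Sum>s\<in>UNIV. \<Sum>k\<in>UNIV. \<Sum>l\<in>UNIV. \<Sum>c\<in>UNIV. hi l k y * hi c s y * f k l s c)"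
    unfolding quad_def by (rule sum_rotate)
  also have "\<dots> = (\<Sum>s\<in>UNIV. \<Sum>c\<in>UNIV. \<Sum>k\<in>UNIV. \<Sum>l\<in>UNIV. hi l k y * hi c s y * f k l s c)"
    by (rule sum.cong[OF refl], rule sum_rotate)
  finally show ?thesis by (simp add: quad_def mult_ac)
qed

lemma quad_perm1: "(\<Sum>s\<in>UNIV. \<Sum>l\<in>UNIV. \<Sum>k\<in>UNIV. \<Sum>c\<in>UNIV. hi l k y * hi c s y * f k l s c) = quad y f"
proof -
  have "(\<Sum>s\<in>UNIV. \<Sum>l\<in>UNIV. \<Sum>k\<in>UNIV. \<Sum>c\<in>UNIV. hi l k y * hi c s y * f k l s c) =
      (\<Sum>k\<in>UNIV. \<Sum>s\<in>UNIV. \<Sum>l\<in>UNIV. \<Sum>c\<in>UNIV. hi l k y * hi c s y * f k l s c)"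
    by (rule sum_rotate)
  also have "\<dots> = quad y f" unfolding quad_def by (rule sum.cong[OF refl], rule sum.swap)
  finally show ?thesis .
qed

lemma quad_inverse_derivative:
  assumes "y \<in> V"
  shows "(\<Sum>m\<in>UNIV. \<Sum>j\<in>UNIV. cderiv (hi j m) y Z * f m j) = - quad y (\<lambda>k l s c. cderiv (hc k c) y Z * f s l)"
proof -
  have "(\<Sum>m\<in>UNIV. \<Sum>j\<in>UNIV. cderiv (hi j m) y Z * f m j) =
      - (\<Sum>s\<in>UNIV. \<Sum>l\<in>UNIV. \<Sum>k\<in>UNIV. \<Sum>c\<in>UNIV. hi l k y * hi c s y * (cderiv (hc k c) y Z * f s l))"
    unfolding cderiv_hi[OF assms]
    by (simp add: sum_negf sum_distrib_left sum_distrib_right mult_ac)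
  then show ?thesis by (simp only: quad_perm1)
qed

lemma cderiv_dlogdet_quad:
  assumes "y \<in> V"
  shows "cderiv (dlogdet q) y Z = - quad y (\<lambda>k l s c. cderiv (hc k c) y Z * dzb q (hc s l) y) +
    (\<Sum>m\<in>UNIV. \<Sum>j\<in>UNIV. hi j m y * cderiv (dzb q (hc m j)) y Z)"
  unfolding cderiv_dlogdet[OF assms] sum.distrib
  by (subst quad_inverse_derivative[OF assms]) simp

lemma quad_cnj:
  assumes "y \<in> V"
  shows "cnj (quad y f) = quad y (\<lambda>k l s c. cnj (f l k c s))"
proof -
  have "cnj (quad y f) = (\<Sum>k\<in>UNIV. \<Sum>l\<in>UNIV. \<Sum>s\<in>UNIV. \<Sum>c\<in>UNIV. hi k l y * hi s c y * cnj (f k l s c))"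
    by (simp add: quad_def hi_cnj[OF assms])
  also have "\<dots> = (\<Sum>l\<in>UNIV. \<Sum>k\<in>UNIV. \<Sum>s\<in>UNIV. \<Sum>c\<in>UNIV. hi k l y * hi s c y * cnj (f k l s c))"
    by (rule sum.swap)
  also have "\<dots> = (\<Sum>l\<in>UNIV. \<Sum>k\<in>UNIV. \<Sum>c\<in>UNIV. \<Sum>s\<in>UNIV. hi k l y * hi s c y * cnj (f k l s c))"
    by (rule sum.cong[OF refl], rule sum.cong[OF refl], rule sum.swap)
  finally show ?thesis by (simp add: quad_def)
qed

text \<open>Since log det h is real, its mixed second derivatives form a Hermitian matrix. In terms
  of coefficients the derivative of the inverse metric gives a quadratic term that conjugation
  reproduces up to the order of its factors.\<close>

lemma dz_dlogdet_cnj: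
  assumes "y \<in> V"
  shows "cnj (dz q (dlogdet p) y) = dz p (dlogdet q) y"
proof -
  have "cnj (dz q (dlogdet p) y) =
      - quad y (\<lambda>k l s c. dzb q (hc s l) y * dz p (hc k c) y) +
      (\<Sum>m\<in>UNIV. \<Sum>j\<in>UNIV. hi m j y * dzb q (dz p (hc j m)) y)"
    unfolding dz_def[of q "dlogdet p"] cderiv_dlogdet_quad[OF assms]
    unfolding dz_def[symmetric]
    by (simp add: quad_cnj[OF assms] dhc_cnj[OF assms] hi_cnj[OF assms] ddh_cnj[OF assms])
  also have "(\<Sum>m\<in>UNIV. \<Sum>j\<in>UNIV. hi m j y * dzb q (dz p (hc j m)) y) =
      (\<Sum>m\<in>UNIV. \<Sum>j\<in>UNIV. hi j m y * dz p (dzb q (hc m j)) y)"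
    by (subst sum.swap) (simp add: dz_hc_commute[OF assms])
  finally show ?thesis
    unfolding dz_def[of p "dlogdet q"] cderiv_dlogdet_quad[OF assms]
    unfolding dz_def[symmetric]
    by (simp add: mult.commute)
qed

text \<open>The second derivatives of log det h commute; the quadratic term is symmetric in p and q
  by exchange of the two contracted pairs.\<close>

lemma dzb_dlogdet_sym:
  assumes "y \<in> V"
  shows "dzb q (dlogdet p) y = dzb p (dlogdet q) y"
  unfolding dzb_def[of q "dlogdet p"] dzb_def[of p "dlogdet q"] cderiv_dlogdet_quad[OF assms]
  unfolding dzb_def[symmetric]
  by (subst quad_swap) (simp add: dz_hc_commute[OF assms, of q p] mult.commute)

lemma cderiv_bisb_trace_dlogdet:
  assumes "y \<in> V"
  shows "dz k (bisb_trace q) y = dz k (dlogdet q) y - cnj (dzb k (bis_trace q) y)"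
    "dzb k (bisb_trace q) y = dzb k (dlogdet q) y - cnj (dz k (bis_trace q) y)"
proof -
  have "cderiv (bisb_trace q) y Z = cderiv (dlogdet q) y Z - cnj (cderiv (bis_trace q) y (ctan_conj Z))" for Z
  proof -
    have "cderiv (bisb_trace q) y Z = cderiv (\<lambda>y. dlogdet q y - cnj (bis_trace q y)) y Z"
      by (rule cderiv_cong[OF open_V assms]) (rule bisb_trace_eq)
    then show ?thesis by (simp add: cderiv_diff differentiable_cnj cderiv_cnj assms)
  qed
  then show "dz k (bisb_trace q) y = dz k (dlogdet q) y - cnj (dzb k (bis_trace q) y)"
    "dzb k (bisb_trace q) y = dzb k (dlogdet q) y - cnj (dz k (bis_trace q) y)"
    by (simp_all add: dz_def dzb_def ctan_conj_basis)
qed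

text \<open>By the traced metric compatibility the two conjugated terms duplicate the other two,
  because the mixed second derivatives of log det h are Hermitian. This absorbs the factor
  1/2.\<close>

lemma bismut_ricci_form_11:
  assumes "y \<in> V"
  shows "bismut_ricci_form g y [holo_vec (axis p 1), antiholo_vec (axis q 1)] =
    \<i> * (dz p (bisb_trace q) y - dzb q (bis_trace p) y)"
  unfolding bismut_ricci_form_raw[OF assms] cderiv_bisb_trace_dlogdet[OF assms]
  by (simp add: dz_dlogdet_cnj[OF assms, of q p])

text \<open>The conjugated terms again duplicate the others; here the derivatives of log det h
  cancel by symmetry in p and q.\<close>

lemma bismut_ricci_form_20:
  assumes "y \<in> V"
  shows "bismut_ricci_form g y [holo_vec (axis p 1), holo_vec (axis q 1)] =
    \<i> * (dz p (bis_trace q) y - dz q (bis_trace p) y)"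
  unfolding bismut_ricci_form_raw[OF assms] cderiv_bisb_trace_dlogdet[OF assms]
  by (simp add: dzb_dlogdet_sym[OF assms, of q p])

lemma quad_connection:
  "(\<Sum>k\<in>UNIV. \<Sum>l\<in>UNIV. hi l k y * (\<Sum>r\<in>UNIV. f l r k * chern_coeff k q r y)) =
    quad y (\<lambda>k l s c. f l s k * dz k (hc q c) y)"
  unfolding quad_def chern_coeff_def
  by (intro sum.cong refl) (simp add: sum_distrib_left mult_ac)

text \<open>The bracket is the derivative of the torsion along d_k, with the Chern connection acting
  on both holomorphic indices. The second derivatives match because holomorphic derivatives commute.
  Of the four quadratic terms two cancel after relabelling, and the other two come from
  differentiating the inverse metric in the traces.\<close>

lemma ricci_20_identity:
  assumes "y \<in> V"
  shows "dz p (bis_trace q) y - dz q (bis_trace p) y = - (\<Sum>k\<in>UNIV. \<Sum>l\<in>UNIV. hi l k y *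
    (dz k (tors l p q) y - (\<Sum>r\<in>UNIV. tors l p r y * chern_coeff k q r y) - (\<Sum>r\<in>UNIV. chern_coeff k p r y * tors l r q y)))"
proof -
  have dth: "dz p (bis_trace q) y = - quad y (\<lambda>k l s c. dz p (hc k c) y * dz s (hc q l) y) +
      (\<Sum>k\<in>UNIV. \<Sum>l\<in>UNIV. hi l k y * dz p (dz k (hc q l)) y)" for p q
    unfolding dz_def[of p "bis_trace q"] cderiv_th[OF assms] sum.distrib
    by (subst quad_inverse_derivative[OF assms]) (simp add: dz_def[symmetric])
  have dgam: "dz k (tors l p q) y = dz q (dz k (hc p l)) y - dz p (dz k (hc q l)) y" for k l
    unfolding tors_def[abs_def]
    by (subst dz_diff) (simp_all add: assms dz_hc_commute(1)[OF assms, of k])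
  have q1: "(\<Sum>k\<in>UNIV. \<Sum>l\<in>UNIV. hi l k y * (\<Sum>r\<in>UNIV. tors l p r y * chern_coeff k q r y)) =
      quad y (\<lambda>k l s c. dz s (hc p l) y * dz k (hc q c) y) - quad y (\<lambda>k l s c. dz p (hc s l) y * dz k (hc q c) y)"
    unfolding quad_connection unfolding tors_def left_diff_distrib quad_diff ..
  have q2: "(\<Sum>k\<in>UNIV. \<Sum>l\<in>UNIV. hi l k y * (\<Sum>r\<in>UNIV. chern_coeff k p r y * tors l r q y)) =
      quad y (\<lambda>k l s c. dz q (hc s l) y * dz k (hc p c) y) - quad y (\<lambda>k l s c. dz s (hc q l) y * dz k (hc p c) y)"
    unfolding mult.commute[of "chern_coeff _ _ _ _"] quad_connection
    unfolding tors_def left_diff_distrib quad_diff ..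
  have s1: "quad y (\<lambda>k l s c. dz s (hc q l) y * dz k (hc p c) y) = quad y (\<lambda>k l s c. dz s (hc p l) y * dz k (hc q c) y)"
    by (subst quad_swap) (simp add: mult.commute)
  have s2: "quad y (\<lambda>k l s c. dz p (hc s l) y * dz k (hc q c) y) = quad y (\<lambda>k l s c. dz p (hc k c) y * dz s (hc q l) y)" for p q
    by (subst quad_swap) simp
  show ?thesis
    unfolding right_diff_distrib sum_subtractf q1 q2 dgam dth s1 s2
    by (simp add: algebra_simps)
qed

text \<open>The first two terms of the bracket are, up to sign, the Chern curvature of g with its
  last index lowered; the third is the product of the two off-diagonal blocks of the connection. Its
  four quadratic terms supply what the traced Bismut curvature has beyond the Chern term.\<close>

lemma ricci_11_identity:
  assumes "y \<in> V"
    and plc: "\<And>k l p q. dz k (dzb l (hc p q)) y =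
      dz p (dzb l (hc k q)) y + dz k (dzb q (hc p l)) y - dz p (dzb q (hc k l)) y"
  shows "dzb q (bis_trace p) y - dz p (bisb_trace q) y = (\<Sum>k\<in>UNIV. \<Sum>l\<in>UNIV. hi l k y *
    (dz k (dzb l (hc p q)) y - (\<Sum>r\<in>UNIV. chern_coeff k p r y * dzb l (hc r q) y)
      - (\<Sum>s\<in>UNIV. \<Sum>c\<in>UNIV. tors l p s y * hi c s y * cnj (tors k c q y))))"
proof -
  have dth: "dzb q (bis_trace p) y = - quad y (\<lambda>k l s c. dzb q (hc k c) y * dz s (hc p l) y) +
      (\<Sum>k\<in>UNIV. \<Sum>l\<in>UNIV. hi l k y * dz k (dzb q (hc p l)) y)"
    unfolding dzb_def[of q "bis_trace p"] cderiv_th[OF assms(1)] sum.distrib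
    by (subst quad_inverse_derivative[OF assms(1)]) (simp add: dzb_def[symmetric] dz_hc_commute[OF assms(1)])
  have dthb: "dz p (bisb_trace q) y =
      - (quad y (\<lambda>k l s c. dz p (hc k c) y * dzb q (hc s l) y) - quad y (\<lambda>k l s c. dz p (hc k c) y * dzb l (hc s q) y)) +
      (\<Sum>k\<in>UNIV. \<Sum>l\<in>UNIV. hi l k y * (dz p (dzb q (hc k l)) y - dz p (dzb l (hc k q)) y))"
    unfolding dz_def[of p "bisb_trace q"] cderiv_thb[OF assms(1)] sum.distrib
    by (subst quad_inverse_derivative[OF assms(1)]) (simp add: dz_def[symmetric] right_diff_distrib quad_diff)
  have q1: "(\<Sum>k\<in>UNIV. \<Sum>l\<in>UNIV. hi l k y * (\<Sum>r\<in>UNIV. chern_coeff k p r y * dzb l (hc r q) y)) =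
      quad y (\<lambda>k l s c. dzb l (hc s q) y * dz k (hc p c) y)"
    unfolding mult.commute[of "chern_coeff _ _ _ _"] quad_connection ..
  have cg: "cnj (tors k c q y) = dzb q (hc k c) y - dzb c (hc k q) y" for k c
    by (simp add: tors_def dhc_cnj[OF assms(1)])
  have q2: "(\<Sum>k\<in>UNIV. \<Sum>l\<in>UNIV. hi l k y * (\<Sum>s\<in>UNIV. \<Sum>c\<in>UNIV. tors l p s y * hi c s y * cnj (tors k c q y))) =
      quad y (\<lambda>k l s c. (dz s (hc p l) y * dzb q (hc k c) y - dz s (hc p l) y * dzb c (hc k q) y) -
        (dz p (hc s l) y * dzb q (hc k c) y - dz p (hc s l) y * dzb c (hc k q) y))"
    unfolding quad_def cg unfolding tors_def
    by (intro sum.cong refl) (simp add: sum_distrib_left algebra_simps)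
  have s1: "quad y (\<lambda>k l s c. dz s (hc p l) y * dzb c (hc k q) y) = quad y (\<lambda>k l s c. dzb l (hc s q) y * dz k (hc p c) y)"
    by (subst quad_swap) (simp add: mult.commute)
  have s2: "quad y (\<lambda>k l s c. dz p (hc k c) y * dzb q (hc s l) y) = quad y (\<lambda>k l s c. dz p (hc s l) y * dzb q (hc k c) y)"
    by (subst quad_swap) simp
  have s3: "quad y (\<lambda>k l s c. dz p (hc k c) y * dzb l (hc s q) y) = quad y (\<lambda>k l s c. dz p (hc s l) y * dzb c (hc k q) y)"
    by (subst quad_swap) simp
  have s4: "quad y (\<lambda>k l s c. dzb q (hc k c) y * dz s (hc p l) y) = quad y (\<lambda>k l s c. dz s (hc p l) y * dzb q (hc k c) y)"
    by (simp add: mult.commute)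
  \<comment> \<open>The single use of \<open>plc\<close>. The quadratic terms have been matched
    independently of it.\<close>
  have second: "(\<Sum>k\<in>UNIV. \<Sum>l\<in>UNIV. hi l k y * dz k (dzb l (hc p q)) y) =
      (\<Sum>k\<in>UNIV. \<Sum>l\<in>UNIV. hi l k y * dz k (dzb q (hc p l)) y) -
      (\<Sum>k\<in>UNIV. \<Sum>l\<in>UNIV. hi l k y * (dz p (dzb q (hc k l)) y - dz p (dzb l (hc k q)) y))"
    unfolding plc[of _ _ p q] sum_subtractf[symmetric] by (simp add: algebra_simps)
  show ?thesis
    unfolding right_diff_distrib[of "hi _ _ _" "_ - _"] right_diff_distrib[of "hi _ _ _" "dz _ (dzb _ (hc p q)) y"]
      sum_subtractf q1 q2 dth dthb quad_diff s1 s2 s3 s4 second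
    by (simp add: algebra_simps)
qed

end

section \<open>Pluriclosed metrics\<close>

context hermitian_chart
begin

definition ddbh3 :: "complex^'n \<Rightarrow> 'n ctan \<Rightarrow> complex^'n \<Rightarrow> complex^'n \<Rightarrow> complex^'n \<Rightarrow> complex" where
  "ddbh3 y T a b c = (\<Sum>i\<in>UNIV. \<Sum>j\<in>UNIV. \<Sum>k\<in>UNIV. cderiv (dzb k (hc i j)) y T * a $ k * b $ i * c $ j)"

lemma dbh3_cderiv:
  assumes "y \<in> V"
  shows "(\<lambda>y. dbh3 y a b c) differentiable (at y)" "cderiv (\<lambda>y. dbh3 y a b c) y T = ddbh3 y T a b c"
proof -
  show "(\<lambda>y. dbh3 y a b c) differentiable (at y)"
    unfolding dbh3_def
    by (intro differentiable_sum_finite differentiable_mult differentiable_const dhc_diff assms)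
  show "cderiv (\<lambda>y. dbh3 y a b c) y T = ddbh3 y T a b c"
    unfolding dbh3_def ddbh3_def
    by (simp add: cderiv_sum cderiv_mult differentiable_sum_finite differentiable_mult assms)
qed

lemma ddbh3_zero:
  assumes "y \<in> V"
  shows "ddbh3 y T 0 b c = 0" "ddbh3 y T a 0 c = 0" "ddbh3 y T a b 0 = 0"
    "ddbh3 y (holo_vec 0) a b c = 0" "ddbh3 y (antiholo_vec 0) a b c = 0"
proof -
  have "holo_vec 0 = (0 :: 'n ctan)" "antiholo_vec 0 = (0 :: 'n ctan)"
    by (simp_all add: holo_vec_def antiholo_vec_def zero_prod_def)
  then show "ddbh3 y T 0 b c = 0" "ddbh3 y T a 0 c = 0" "ddbh3 y T a b 0 = 0"
    "ddbh3 y (holo_vec 0) a b c = 0" "ddbh3 y (antiholo_vec 0) a b c = 0"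
    by (simp_all add: ddbh3_def cderiv_zero_vec assms)
qed

lemma cderiv_delbar_fund_form:
  assumes "y \<in> V"
  shows "cderiv (\<lambda>y. delbar 1 1 (fund_form g) y [Z, W, U]) y T = \<i> *
    (ddbh3 y T (snd U) (fst Z) (snd W) - ddbh3 y T (snd W) (fst Z) (snd U)
   + ddbh3 y T (snd Z) (fst W) (snd U) - ddbh3 y T (snd U) (fst W) (snd Z)
   + ddbh3 y T (snd W) (fst U) (snd Z) - ddbh3 y T (snd Z) (fst U) (snd W))"
proof -
  have "cderiv (\<lambda>y. delbar 1 1 (fund_form g) y [Z, W, U]) y T = cderiv (\<lambda>y. \<i> *
    (dbh3 y (snd U) (fst Z) (snd W) - dbh3 y (snd W) (fst Z) (snd U)
   + dbh3 y (snd Z) (fst W) (snd U) - dbh3 y (snd U) (fst W) (snd Z)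
   + dbh3 y (snd W) (fst U) (snd Z) - dbh3 y (snd Z) (fst U) (snd W))) y T"
    by (rule cderiv_cong[OF open_V assms]) (rule delbar_fund_form)
  then show ?thesis
    by (simp add: cderiv_mult cderiv_add cderiv_diff differentiable_mult differentiable_add differentiable_diff
      dbh3_cderiv assms)
qed

lemma del_delbar_fund_form:
  assumes "y \<in> V"
  shows "del 1 2 (delbar 1 1 (fund_form g)) y
     [holo_vec (axis p 1), holo_vec (axis k 1), antiholo_vec (axis q 1), antiholo_vec (axis l 1)] =
    \<i> * (dz p (dzb l (hc k q)) y - dz p (dzb q (hc k l)) y - dz k (dzb l (hc p q)) y + dz k (dzb q (hc p l)) y)"
proof -
  have ax: "ddbh3 y T (axis l 1) (axis k 1) (axis q 1) = cderiv (dzb l (hc k q)) y T" for T l k q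
  proof -
    have "ddbh3 y T a b c = (\<Sum>i\<in>UNIV. b $ i * (\<Sum>j\<in>UNIV. c $ j * (\<Sum>k\<in>UNIV. a $ k * cderiv (dzb k (hc i j)) y T)))"
      for a b c
      unfolding ddbh3_def sum_distrib_left by (simp only: mult_ac)
    then show ?thesis by (simp only: sum_axis)
  qed
  show ?thesis
    unfolding del_def Suc_1 pq_part_22 ext_d_3 cderiv_delbar_fund_form[OF assms]
    by (simp add: ddbh3_zero[OF assms] ax dz_def[symmetric] algebra_simps)
qed

text \<open>The vanishing of \<partial>\<partial>bar \<omega> on coordinate vectors, solved for the
  second derivative that the contracted Chern curvature contains.\<close>

lemma pluriclosed_identity:
  assumes "y \<in> V"
    and "\<And>Zs. length Zs = 4 \<Longrightarrow> del 1 2 (delbar 1 1 (fund_form g)) y Zs = 0"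
  shows "dz k (dzb l (hc p q)) y =
      dz p (dzb l (hc k q)) y + dz k (dzb q (hc p l)) y - dz p (dzb q (hc k l)) y"
proof -
  have "\<i> * (dz p (dzb l (hc k q)) y - dz p (dzb q (hc k l)) y - dz k (dzb l (hc p q)) y + dz k (dzb q (hc p l)) y) = 0"
    unfolding del_delbar_fund_form[OF assms(1), symmetric] by (rule assms(2)) simp
  then have "dz p (dzb l (hc k q)) y - dz p (dzb q (hc k l)) y - dz k (dzb l (hc p q)) y + dz k (dzb q (hc p l)) y = 0"
    by simp
  then show ?thesis by (simp add: algebra_simps)
qed

end

section \<open>Matrix calculus\<close>

definition cnj_mat :: "complex^'n^'m \<Rightarrow> complex^'n^'m" where
  "cnj_mat A = (\<chi> i j. cnj (A $ i $ j))"

text \<open>Bilinear without conjugation: conjugates are inserted by \<open>cnjv\<close> and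
  \<open>cnj_mat\<close>, so that transposing and conjugating can be carried out separately.\<close>

definition bilin :: "complex^'n::finite \<Rightarrow> complex^'n^'n \<Rightarrow> complex^'n \<Rightarrow> complex" where
  "bilin X A Y = (\<Sum>i\<in>UNIV. \<Sum>j\<in>UNIV. A $ i $ j * X $ i * Y $ j)"

lemma cnj_mat_simps [simp]: "cnj_mat (A ** B) = cnj_mat A ** cnj_mat B" "cnj_mat (transpose A) = transpose (cnj_mat A)" "cnj_mat (cnj_mat A) = A"
  by (simp_all add: cnj_mat_def matrix_matrix_mult_def transpose_def vec_eq_iff)

lemma cnjv_cnjv [simp]: "cnjv (cnjv x) = x"
  by (simp add: cnjv_def vec_eq_iff)

lemma cnjv_vm: "cnjv (x v* A) = cnjv x v* cnj_mat A"
  by (simp add: cnjv_def cnj_mat_def vector_matrix_mult_def vec_eq_iff)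

lemma vm_component: "((x :: complex^'m::finite) v* A) $ j = (\<Sum>i\<in>UNIV. A $ i $ j * x $ i)"
  by (simp add: vector_matrix_mult_def mult.commute)

lemma bilin_left: "bilin (X v* B) A Y = bilin X (B ** A) Y"
proof -
  have "bilin (X v* B) A Y = (\<Sum>m\<in>UNIV. \<Sum>j\<in>UNIV. \<Sum>i\<in>UNIV. B $ i $ m * A $ m $ j * X $ i * Y $ j)"
    unfolding bilin_def vm_component by (intro sum.cong refl) (simp add: sum_distrib_left sum_distrib_right mult_ac)
  also have "\<dots> = (\<Sum>i\<in>UNIV. \<Sum>m\<in>UNIV. \<Sum>j\<in>UNIV. B $ i $ m * A $ m $ j * X $ i * Y $ j)"
    by (rule sum_rotate)
  also have "\<dots> = (\<Sum>i\<in>UNIV. \<Sum>j\<in>UNIV. \<Sum>m\<in>UNIV. B $ i $ m * A $ m $ j * X $ i * Y $ j)"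
    by (rule sum.cong[OF refl], rule sum.swap)
  finally show ?thesis
    by (simp add: bilin_def matrix_matrix_mult_def sum_distrib_right)
qed

lemma bilin_transpose: "bilin X A Y = bilin Y (transpose A) X"
  unfolding bilin_def transpose_def by (subst sum.swap) (simp add: mult_ac)

lemma bilin_right: "bilin X A (Y v* B) = bilin X (A ** transpose B) Y"
  by (simp add: bilin_transpose[of X] bilin_left matrix_transpose_mul)

lemma bilin_cnj: "cnj (bilin X A Y) = bilin (cnjv X) (cnj_mat A) (cnjv Y)"
  by (simp add: bilin_def cnj_mat_def cnjv_def)

lemma bilin_add: "bilin (X + X') A Y = bilin X A Y + bilin X' A Y" "bilin X (A + A') Y = bilin X A Y + bilin X A' Y"
  "bilin X A (Y + Y') = bilin X A Y + bilin X A Y'"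
  by (simp_all add: bilin_def sum.distrib algebra_simps)

lemma bilin_diff: "bilin (X - X') A Y = bilin X A Y - bilin X' A Y" "bilin X (A - A') Y = bilin X A Y - bilin X A' Y"
  "bilin X A (Y - Y') = bilin X A Y - bilin X A Y'"
  by (simp_all add: bilin_def sum_subtractf algebra_simps)

lemma bilin_minus: "bilin (- X) A Y = - bilin X A Y" "bilin X (- A) Y = - bilin X A Y"
  by (simp_all add: bilin_def sum_negf)

lemma bilin_scale: "bilin (c *s X) A Y = c * bilin X A Y"
  by (simp add: bilin_def sum_distrib_left mult_ac)

lemma bilin_zero [simp]: "bilin 0 A Y = 0" "bilin X 0 Y = 0"
  by (simp_all add: bilin_def)

section \<open>Entrywise derivatives of matrices and vectors\<close>

definition mderiv :: "(complex^'n::finite \<Rightarrow> complex^'k^'m) \<Rightarrow> complex^'n \<Rightarrow> 'n ctan \<Rightarrow> complex^'k^'m" where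
  "mderiv A x Z = (\<chi> i j. cderiv (\<lambda>y. A y $ i $ j) x Z)"

definition vderiv :: "(complex^'n::finite \<Rightarrow> complex^'k) \<Rightarrow> complex^'n \<Rightarrow> 'n ctan \<Rightarrow> complex^'k" where
  "vderiv F x Z = (\<chi> i. cderiv (\<lambda>y. F y $ i) x Z)"

definition mdiff :: "(complex^'n::finite \<Rightarrow> complex^'k^'m) \<Rightarrow> complex^'n \<Rightarrow> bool" where
  "mdiff A x \<longleftrightarrow> (\<forall>i j. (\<lambda>y. A y $ i $ j) differentiable (at x))"

definition vdiff :: "(complex^'n::finite \<Rightarrow> complex^'k) \<Rightarrow> complex^'n \<Rightarrow> bool" where
  "vdiff F x \<longleftrightarrow> (\<forall>i. (\<lambda>y. F y $ i) differentiable (at x))"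

lemma vderiv_add: "vdiff F x \<Longrightarrow> vdiff G x \<Longrightarrow> vderiv (\<lambda>y. F y + G y) x Z = vderiv F x Z + vderiv G x Z"
  and vderiv_diff: "vdiff F x \<Longrightarrow> vdiff G x \<Longrightarrow> vderiv (\<lambda>y. F y - G y) x Z = vderiv F x Z - vderiv G x Z"
  by (simp_all add: vderiv_def vdiff_def vec_eq_iff cderiv_add cderiv_diff)

lemma vderiv_const [simp]: "vderiv (\<lambda>y. c) x Z = 0"
  by (simp add: vderiv_def vec_eq_iff)

lemma vdiff_const [simp]: "vdiff (\<lambda>y. c) x"
  by (simp add: vdiff_def)

lemma vdiff_add: "vdiff F x \<Longrightarrow> vdiff G x \<Longrightarrow> vdiff (\<lambda>y. F y + G y) x"
  and vdiff_diff: "vdiff F x \<Longrightarrow> vdiff G x \<Longrightarrow> vdiff (\<lambda>y. F y - G y) x"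
  by (simp_all add: vdiff_def differentiable_add differentiable_diff)

lemma vdiff_vm: "vdiff F x \<Longrightarrow> mdiff A x \<Longrightarrow> vdiff (\<lambda>y. F y v* A y) x"
  unfolding vdiff_def mdiff_def vm_component
  by (intro allI differentiable_sum_finite differentiable_mult) auto

lemma vderiv_vm:
  assumes "vdiff F x" "mdiff A x"
  shows "vderiv (\<lambda>y. F y v* A y) x Z = vderiv F x Z v* A x + F x v* mderiv A x Z"
  using assms
  by (simp add: vderiv_def vdiff_def mderiv_def mdiff_def vec_eq_iff vm_component cderiv_sum cderiv_mult
      differentiable_mult sum.distrib add.commute)

lemma mdiff_mm: "mdiff A x \<Longrightarrow> mdiff B x \<Longrightarrow> mdiff (\<lambda>y. A y ** B y) x"
  unfolding mdiff_def matrix_matrix_mult_def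
  by (auto intro!: differentiable_sum_finite differentiable_mult)

lemma mderiv_mm:
  assumes "mdiff A x" "mdiff B x"
  shows "mderiv (\<lambda>y. A y ** B y) x Z = mderiv A x Z ** B x + A x ** mderiv B x Z"
  using assms
  by (simp add: mderiv_def mdiff_def vec_eq_iff matrix_matrix_mult_def cderiv_sum cderiv_mult
      differentiable_mult sum.distrib)

lemma mdiff_transpose: "mdiff A x \<Longrightarrow> mdiff (\<lambda>y. transpose (A y)) x"
  by (simp add: mdiff_def transpose_def)

lemma mderiv_transpose: "mderiv (\<lambda>y. transpose (A y)) x Z = transpose (mderiv A x Z)"
  by (simp add: mderiv_def transpose_def)

lemma mdiff_cm: "mdiff A x \<Longrightarrow> mdiff (\<lambda>y. cnj_mat (A y)) x"
  by (simp add: mdiff_def cnj_mat_def differentiable_cnj)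

lemma mderiv_cm: "mdiff A x \<Longrightarrow> mderiv (\<lambda>y. cnj_mat (A y)) x Z = cnj_mat (mderiv A x (ctan_conj Z))"
  by (simp add: mdiff_def mderiv_def cnj_mat_def cderiv_cnj)

lemma mderiv_cong:
  assumes "open S" "x \<in> S" "\<And>y. y \<in> S \<Longrightarrow> A y = B y"
  shows "mderiv A x Z = mderiv B x Z"
  unfolding mderiv_def using assms(3) by (auto simp: vec_eq_iff intro!: cderiv_cong[OF assms(1,2)])

section \<open>The Chern connection of a generalized metric\<close>

locale gen_chart = hermitian_chart V g for V :: "(complex^'n::finite) set" and g +
  fixes \<beta> \<tau> :: "'n cform"
  assumes beta_form: "form_on V 2 \<beta>"
    and beta_20: "\<And>x Zs. x \<in> V \<Longrightarrow> length Zs = 2 \<Longrightarrow> pq_part 2 0 \<beta> x Zs = \<beta> x Zs"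
    and twist: "\<And>x Zs. x \<in> V \<Longrightarrow> length Zs = 3 \<Longrightarrow>
      delbar 2 0 \<beta> x Zs = \<tau> x Zs - del 1 1 (fund_form g) x Zs"
begin

definition bt :: "'n \<Rightarrow> 'n \<Rightarrow> complex^'n \<Rightarrow> complex" where
  "bt i j y = \<beta> y [holo_vec (axis i 1), holo_vec (axis j 1)]"

lemma beta_linear:
  assumes "y \<in> V"
  shows "\<beta> y [pscale c Z + Z', W] = c * \<beta> y [Z, W] + \<beta> y [Z', W]"
    and "\<beta> y [Z, pscale c W + W'] = c * \<beta> y [Z, W] + \<beta> y [Z, W']"
proof -
  have lin: "\<beta> y (Zs[i := pscale c Z + W]) = c * \<beta> y (Zs[i := Z]) + \<beta> y (Zs[i := W])"
    if "length Zs = 2" "i < 2" for Zs i Z W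
    using beta_form assms that unfolding form_on_def by blast
  show "\<beta> y [pscale c Z + Z', W] = c * \<beta> y [Z, W] + \<beta> y [Z', W]"
    using lin[of "[Z, W]" 0 Z Z'] by simp
  show "\<beta> y [Z, pscale c W + W'] = c * \<beta> y [Z, W] + \<beta> y [Z, W']"
    using lin[of "[Z, W]" 1 W W'] by simp
qed

lemma holo_vec_linear: "holo_vec (u + v) = pscale 1 (holo_vec u) + holo_vec v" "holo_vec (c *s u) = pscale c (holo_vec u) + holo_vec 0"
  by (simp_all add: holo_vec_def pscale_def)

lemma beta_zero:
  assumes "y \<in> V"
  shows "\<beta> y [holo_vec 0, W] = 0" "\<beta> y [W, holo_vec 0] = 0"
proof -
  have *: "pscale 1 (holo_vec 0) + holo_vec 0 = (holo_vec 0 :: 'n ctan)"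
    by (simp add: holo_vec_def pscale_def)
  show "\<beta> y [holo_vec 0, W] = 0" "\<beta> y [W, holo_vec 0] = 0"
    using beta_linear(1)[OF assms, where c = 1 and Z = "holo_vec 0" and Z' = "holo_vec 0" and W = W]
      beta_linear(2)[OF assms, where c = 1 and W = "holo_vec 0" and W' = "holo_vec 0" and Z = W]
    unfolding * by simp_all
qed

lemma beta_expand:
  assumes "y \<in> V"
  shows "\<beta> y [Z, W] = (\<Sum>i\<in>UNIV. fst Z $ i * (\<Sum>j\<in>UNIV. fst W $ j * bt i j y))"
proof -
  have "\<beta> y [Z, W] = \<beta> y [holo_vec (fst Z), holo_vec (fst W)]"
    using beta_20[OF assms, of "[Z, W]"] by (simp add: pq_part_20)
  also have "\<dots> = (\<Sum>i\<in>UNIV. fst Z $ i * \<beta> y [holo_vec (axis i 1), holo_vec (fst W)])"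
    by (rule clinear_expand[of "\<lambda>u. \<beta> y [holo_vec u, holo_vec (fst W)]"])
      (simp_all only: holo_vec_linear beta_linear[OF assms] beta_zero[OF assms], simp_all)
  moreover have "\<beta> y [holo_vec (axis i 1), holo_vec (fst W)] = (\<Sum>j\<in>UNIV. fst W $ j * bt i j y)" for i
    unfolding bt_def
    by (rule clinear_expand[of "\<lambda>u. \<beta> y [holo_vec (axis i 1), holo_vec u]"])
      (simp_all only: holo_vec_linear beta_linear[OF assms] beta_zero[OF assms], simp_all)
  ultimately show ?thesis by simp
qed

lemma Ck_bt: "Ck_on (Suc (Suc 0)) V (bt i j)"
  using beta_form unfolding form_on_def smooth_on_def bt_def[abs_def] by (simp del: Ck_on.simps)

text \<open>In the row convention \<open>X v* Nm y\<close> is i \<beta>(X), the shift that occurs in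
  the generalized metric.\<close>

definition Nm :: "complex^'n \<Rightarrow> complex^'n^'n" where
  "Nm y = (\<chi> i j. \<i> * bt i j y)"

lemma bt_diff [simp]: "y \<in> V \<Longrightarrow> bt i j differentiable (at y)"
  "y \<in> V \<Longrightarrow> dz k (bt i j) differentiable (at y)" "y \<in> V \<Longrightarrow> dzb k (bt i j) differentiable (at y)"
  using cderiv_differentiable(1)[OF open_V _ Ck_bt] dz_differentiable[OF open_V _ Ck_bt] by auto

lemma Nm_diff [simp]: "y \<in> V \<Longrightarrow> mdiff Nm y"
  by (simp add: mdiff_def Nm_def differentiable_mult)

lemma mderiv_Nm: "y \<in> V \<Longrightarrow> mderiv Nm y Z = (\<chi> i j. \<i> * cderiv (bt i j) y Z)"
  by (simp add: mderiv_def Nm_def cderiv_mult vec_eq_iff)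

lemma mderiv_Nm_diff [simp]: "y \<in> V \<Longrightarrow> mdiff (\<lambda>y. mderiv Nm y Z) y"
proof -
  assume y: "y \<in> V"
  have "(\<lambda>y. mderiv Nm y Z $ i $ j) differentiable (at y)" for i j
  proof (rule differentiable_cong_open[OF _ open_V y])
    show "(\<lambda>y. \<i> * cderiv (bt i j) y Z) differentiable (at y)"
      using cderiv_differentiable(2)[OF open_V y Ck_bt] by (simp add: differentiable_mult)
  qed (simp add: mderiv_Nm)
  then show ?thesis by (simp add: mdiff_def)
qed

text \<open>This cancels the second derivatives of \<beta> in the curvature: a change of frame
  creates no curvature.\<close>

lemma mderiv_mderiv_Nm:
  assumes "y \<in> V"
  shows "mderiv (\<lambda>y. mderiv Nm y Z) y W = mderiv (\<lambda>y. mderiv Nm y W) y Z"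
proof -
  have "mderiv (\<lambda>y. mderiv Nm y Z) y W = (\<chi> i j. \<i> * cderiv (\<lambda>y. cderiv (bt i j) y Z) y W)" for Z W
  proof -
    have "mderiv (\<lambda>y. mderiv Nm y Z) y W = mderiv (\<lambda>y. \<chi> i j. \<i> * cderiv (bt i j) y Z) y W"
      by (rule mderiv_cong[OF open_V assms]) (rule mderiv_Nm)
    also have "\<dots> = (\<chi> i j. \<i> * cderiv (\<lambda>y. cderiv (bt i j) y Z) y W)"
      using cderiv_differentiable(2)[OF open_V assms Ck_bt] by (simp add: mderiv_def cderiv_mult vec_eq_iff)
    finally show ?thesis .
  qed
  then show ?thesis by (simp add: cderiv_cderiv[OF open_V assms Ck_bt])
qed

text \<open>Vectors and covectors are rows, so endomorphisms multiply from the right.  \<open>Am\<close> is the Chern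
  connection form of \<open>g\<close> on \<open>T\<^sup>1\<^sup>0\<close>, and \<open>- Mm\<close> is the adjoint of \<open>Gm\<close> with respect to \<open>g\<close> and its inverse.\<close>
definition Hm :: "complex^'n \<Rightarrow> complex^'n^'n" where "Hm y = (\<chi> i j. hc i j y)"
definition Km :: "complex^'n \<Rightarrow> complex^'n^'n" where "Km y = (\<chi> i j. hi i j y)"
definition Dm :: "complex^'n \<Rightarrow> complex^'n \<Rightarrow> complex^'n^'n" where
  "Dm a y = (\<chi> i j. \<Sum>k\<in>UNIV. a $ k * dz k (hc i j) y)"
definition Em :: "complex^'n \<Rightarrow> complex^'n \<Rightarrow> complex^'n^'n" where
  "Em b y = (\<chi> i j. \<Sum>k\<in>UNIV. b $ k * dzb k (hc i j) y)"
definition Gm :: "complex^'n \<Rightarrow> complex^'n \<Rightarrow> complex^'n^'n" where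
  "Gm b y = (\<chi> i j. \<Sum>l\<in>UNIV. b $ l * tors l i j y)"
definition Am :: "complex^'n \<Rightarrow> complex^'n \<Rightarrow> complex^'n^'n" where
  "Am a y = Dm a y ** Km y"
definition Mm :: "complex^'n \<Rightarrow> complex^'n \<Rightarrow> complex^'n^'n" where
  "Mm a y = transpose (Km y) ** cnj_mat (Gm (cnjv a) y) ** Km y"

lemma H_K:
  assumes "y \<in> V"
  shows "Hm y ** Km y = mat 1" "Km y ** Hm y = mat 1" "cnj_mat (Hm y) = transpose (Hm y)" "cnj_mat (Km y) = transpose (Km y)"
  by (simp_all add: Hm_def Km_def matrix_matrix_mult_def mat_def transpose_def cnj_mat_def vec_eq_iff
      hc_hi[OF assms] hc_cnj[OF assms] hi_cnj[OF assms])

lemma Gm_antisym: "transpose (Gm b y) = - Gm b y"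
  by (simp add: Gm_def transpose_def vec_eq_iff tors_def sum_negf[symmetric] algebra_simps)

lemma Dm_cnj_mat: "y \<in> V \<Longrightarrow> cnj_mat (Dm (cnjv b) y) = transpose (Em b y)"
  by (simp add: Dm_def Em_def cnj_mat_def transpose_def vec_eq_iff cnjv_def dhc_cnj)

lemma AH: "y \<in> V \<Longrightarrow> Am a y ** Hm y = Dm a y"
  by (simp add: Am_def matrix_mul_assoc[symmetric] H_K)

lemma MH: "y \<in> V \<Longrightarrow> Mm a y ** Hm y = transpose (Km y) ** cnj_mat (Gm (cnjv a) y)"
  by (simp add: Mm_def matrix_mul_assoc[symmetric] H_K)

lemma gen_metric_eq:
  assumes "y \<in> V"
  shows "gen_metric g \<beta> y u v = bilin (fst u) (Hm y) (cnjv (fst v)) +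
    bilin (snd u + fst u v* Nm y) (transpose (Km y)) (cnjv (snd v + fst v v* Nm y))"
proof -
  have "cext (g y) Z W = (\<Sum>i\<in>UNIV. \<Sum>j\<in>UNIV. hc i j y * (1 * fst Z $ i * snd W $ j + 1 * fst W $ i * snd Z $ j))" for Z W
    unfolding hc_form
    by (rule cext_formula) (rule hermitian_form.form_expand[OF hermitian_form_at[OF assms]])
  moreover have bs: "beta_shift \<beta> y u = snd u + fst u v* Nm y" for u
    by (simp add: beta_shift_def contract_def beta_expand[OF assms] vec_eq_iff vm_component Nm_def
        axis_def if_distrib if_distribR sum_distrib_left mult_ac cong: if_cong)
  ultimately show ?thesis
    by (simp add: gen_metric_def ctan_conj_def bs bilin_def Hm_def Km_def hi_def transpose_def cnjv_def mult_ac)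
qed

text \<open>In the frame shifted by \<open>\<beta>\<close>, where \<open>\<eta> = \<xi> + \<i>\<beta>(X)\<close> replaces \<open>\<xi>\<close>, the metric is \<open>g\<close> plus its inverse, the twist
  is \<open>\<partial>\<omega>\<close> and the connection form maps \<open>(X, \<eta>)\<close> to \<open>(X Am + \<eta> Mm, X Gm - \<eta> Am\<^sup>T)\<close>; the last two terms undo the shift.\<close>
definition theta :: "complex^'n \<Rightarrow> 'n ctan \<Rightarrow> 'n qfib \<Rightarrow> 'n qfib" where
  "theta y Z u =
    (let \<eta> = snd u + fst u v* Nm y;
         X = fst u v* Am (fst Z) y + \<eta> v* Mm (fst Z) y
     in (X, fst u v* Gm (snd Z) y - \<eta> v* transpose (Am (fst Z) y) - X v* Nm y + fst u v* mderiv Nm y Z))"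

text \<open>The shift inside \<open>gen_metric_eq\<close> undoes the correction
  \<open>- X v* Nm y\<close> in \<open>theta\<close>, so each pairing shows one block of the
  connection, together with the derivative of the shift.\<close>

lemma gen_metric_theta:
  assumes "y \<in> V"
  shows "gen_metric g \<beta> y (theta y Z u) v =
    bilin (fst u) (Dm (fst Z) y) (cnjv (fst v)) +
    bilin (snd u + fst u v* Nm y) (transpose (Km y) ** cnj_mat (Gm (cnjv (fst Z)) y)) (cnjv (fst v)) +
    bilin (fst u) (Gm (snd Z) y ** transpose (Km y)) (cnjv (snd v + fst v v* Nm y)) -
    bilin (snd u + fst u v* Nm y) (transpose (Am (fst Z) y) ** transpose (Km y)) (cnjv (snd v + fst v v* Nm y)) +
    bilin (fst u) (mderiv Nm y Z ** transpose (Km y)) (cnjv (snd v + fst v v* Nm y))"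
  unfolding gen_metric_eq[OF assms] theta_def Let_def
  by (simp only: fst_conv snd_conv bilin_add(1) bilin_left AH[OF assms] MH[OF assms] diff_add_cancel)
    (simp add: bilin_add(1) bilin_diff(1) bilin_left AH[OF assms] MH[OF assms] algebra_simps
      del: vector_transpose_matrix)

lemma gen_metric_cnj:
  assumes "y \<in> V"
  shows "cnj (gen_metric g \<beta> y u v) = gen_metric g \<beta> y v u"
  unfolding gen_metric_eq[OF assms]
  by (simp add: bilin_cnj H_K[OF assms] bilin_transpose[of "cnjv _"])

end

lemma cderiv_bilin:
  assumes "vdiff F x" "mdiff A x" "vdiff L x"
  shows "cderiv (\<lambda>y. bilin (F y) (A y) (L y)) x Z =
    bilin (vderiv F x Z) (A x) (L x) + bilin (F x) (mderiv A x Z) (L x) + bilin (F x) (A x) (vderiv L x Z)"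
  using assms unfolding bilin_def vdiff_def mdiff_def
  by (simp add: cderiv_sum cderiv_mult differentiable_sum_finite differentiable_mult sum.distrib
      distrib_right distrib_left vderiv_def mderiv_def mult_ac)

lemma vderiv_cnjv: "vdiff F x \<Longrightarrow> vderiv (\<lambda>y. cnjv (F y)) x Z = cnjv (vderiv F x (ctan_conj Z))"
  by (simp add: vdiff_def vderiv_def cnjv_def cderiv_cnj)

lemma vdiff_cnjv: "vdiff F x \<Longrightarrow> vdiff (\<lambda>y. cnjv (F y)) x"
  by (simp add: vdiff_def cnjv_def differentiable_cnj)

lemma bilin_inject:
  assumes "A ** B = mat 1" "\<And>Y. bilin X A Y = bilin X' A Y"
  shows "X = X'"
proof -
  have "bilin X A (axis j 1) = (X v* A) $ j" for X j
    unfolding bilin_def vm_component by (simp add: axis_def if_distrib cong: if_cong)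
  then have "X v* A = X' v* A" using assms(2) by (metis vec_eq_iff)
  then have "(X v* A) v* B = (X' v* A) v* B" by simp
  then show ?thesis by (simp add: vector_matrix_mul_assoc assms(1))
qed

lemma pair_deriv_vderiv: "pair_deriv s x Z = (vderiv (\<lambda>y. fst (s y)) x Z, vderiv (\<lambda>y. snd (s y)) x Z)"
  by (simp add: pair_deriv_def vderiv_def)

lemma mm_add_left: "((A :: complex^'k^'m) + B) ** C = A ** C + B ** (C :: complex^'l^'k::finite)"
  by (simp add: matrix_matrix_mult_def vec_eq_iff distrib_right sum.distrib)

lemma mm_minus: "(- (A :: complex^'k^'m)) ** C = - (A ** (C :: complex^'l^'k::finite))" "A ** (- C) = - (A ** C)"
  by (simp_all add: matrix_matrix_mult_def vec_eq_iff sum_negf)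

lemma transpose_diff: "transpose ((A :: complex^'k^'m) - B) = transpose A - transpose B"
  by (simp add: transpose_def vec_eq_iff)

lemma transpose_minus: "transpose (- (A :: complex^'k^'m)) = - transpose A"
  by (simp add: transpose_def vec_eq_iff)

context gen_chart
begin

lemma transpose_K_H: "y \<in> V \<Longrightarrow> transpose (Km y) ** transpose (Hm y) = mat 1"
  by (simp only: matrix_transpose_mul[symmetric] H_K transpose_mat)

lemma gen_metric_nondegenerate:
  assumes "y \<in> V" "\<And>v. gen_metric g \<beta> y u v = gen_metric g \<beta> y u' v"
  shows "u = u'"
proof (rule prod_eqI)
  have c0: "cnjv (0 :: complex^'n) = 0" by (simp add: cnjv_def vec_eq_iff)
  have b0: "bilin X A 0 = 0" for X :: "complex^'n" and A by (simp add: bilin_def)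
  show f: "fst u = fst u'"
  proof (rule bilin_inject[OF H_K(1)[OF assms(1)]])
    \<comment> \<open>The test vector is chosen with vanishing shifted covector, which leaves only
      the block of g; in the other half a test vector without (1,0)-part leaves only the block of
      the inverse.\<close>
    show "bilin (fst u) (Hm y) Y = bilin (fst u') (Hm y) Y" for Y
      using assms(2)[of "(cnjv Y, - (cnjv Y v* Nm y))"] unfolding gen_metric_eq[OF assms(1)]
      by (simp add: c0 b0)
  qed
  have "snd u + fst u v* Nm y = snd u' + fst u' v* Nm y"
  proof (rule bilin_inject[OF transpose_K_H[OF assms(1)]])
    show "bilin (snd u + fst u v* Nm y) (transpose (Km y)) Y = bilin (snd u' + fst u' v* Nm y) (transpose (Km y)) Y" for Y
      using assms(2)[of "(0, cnjv Y)"] unfolding gen_metric_eq[OF assms(1)]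
      by (simp add: c0 b0)
  qed
  then show "snd u = snd u'" using f by simp
qed

lemma Dm_linear: "Dm (a + a') y = Dm a y + Dm a' y" "Dm (c *s a) y = (\<chi> i. c *s (Dm a y $ i))"
  by (simp_all add: Dm_def vec_eq_iff sum.distrib distrib_right sum_distrib_left mult_ac)

lemma Gm_linear: "Gm (a + a') y = Gm a y + Gm a' y" "Gm (c *s a) y = (\<chi> i. c *s (Gm a y $ i))"
  by (simp_all add: Gm_def vec_eq_iff sum.distrib distrib_right distrib_left sum_distrib_left mult_ac)

lemma scale_matrix:
  fixes A B :: "complex^'k::finite^'k" and X :: "complex^'k"
  shows "X v* (\<chi> i. c *s (A $ i)) = c *s (X v* A)"
    "(\<chi> i. c *s (A $ i)) ** B = (\<chi> i. c *s ((A ** B) $ i))"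
    "A ** (\<chi> i. c *s (B $ i)) = (\<chi> i. c *s ((A ** B) $ i))"
    "transpose (\<chi> i. c *s (A $ i)) = (\<chi> i. c *s (transpose A $ i))"
    "cnj_mat (\<chi> i. c *s (A $ i)) = (\<chi> i. cnj c *s (cnj_mat A $ i))"
  by (simp_all add: vec_eq_iff vm_component matrix_matrix_mult_def transpose_def cnj_mat_def sum_distrib_left mult_ac)

lemma Am_linear: "Am (a + a') y = Am a y + Am a' y" "Am (c *s a) y = (\<chi> i. c *s (Am a y $ i))"
  unfolding Am_def Dm_linear scale_matrix by (simp_all add: mm_add_left)

lemma cnjv_linear: "cnjv (a + a') = cnjv a + cnjv a'" "cnjv (c *s a) = cnj c *s cnjv a"
  by (simp_all add: cnjv_def vec_eq_iff)

lemma cnj_mat_add: "cnj_mat (A + A') = cnj_mat A + cnj_mat A'"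
  by (simp add: cnj_mat_def vec_eq_iff)

lemma transpose_add: "transpose (A + A') = transpose A + transpose (A' :: complex^'k^'k)"
  by (simp add: transpose_def vec_eq_iff)

lemma Mm_linear: "Mm (a + a') y = Mm a y + Mm a' y" "Mm (c *s a) y = (\<chi> i. c *s (Mm a y $ i))"
  unfolding Mm_def cnjv_linear Gm_linear cnj_mat_add scale_matrix
  by (simp_all add: mm_add_left matrix_add_ldistrib)

lemma mderiv_Nm_linear:
  assumes "y \<in> V"
  shows "mderiv Nm y (Z + W) = mderiv Nm y Z + mderiv Nm y W" "mderiv Nm y (pscale c Z) = (\<chi> i. c *s (mderiv Nm y Z $ i))"
  by (simp_all add: mderiv_Nm[OF assms] cderiv_lin assms vec_eq_iff algebra_simps)

lemma mderiv_Nm_scale: "y \<in> V \<Longrightarrow> mderiv Nm y (c *s a, c *s b) = (\<chi> i. c *s (mderiv Nm y (a, b) $ i))"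
  using mderiv_Nm_linear(2)[of y c "(a, b)"] by (simp add: pscale_def)

lemma theta_linear:
  assumes "y \<in> V"
  shows "clin (\<lambda>Z. theta y Z u)" "clin (theta y Z)"
proof -
  show "clin (\<lambda>Z. theta y Z u)"
    unfolding clin_def theta_def Let_def
    by (auto simp: Am_linear Mm_linear Gm_linear mderiv_Nm_linear(1)[OF assms] mderiv_Nm_linear(1)[OF assms, of "(_, _)" "(_, _)", simplified] mderiv_Nm_scale[OF assms] transpose_add scale_matrix pscale_def
        vector_matrix_left_distrib vector_matrix_mult_add_rdistrib scalar_vector_matrix_assoc
        vec.scale_right_distrib vec.scale_right_diff_distrib algebra_simps simp del: vector_transpose_matrix)
  show "clin (theta y Z)"
    unfolding clin_def theta_def Let_def
    by (auto simp: pscale_def vector_matrix_left_distrib scalar_vector_matrix_assoc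
        vec.scale_right_distrib vec.scale_right_diff_distrib algebra_simps simp del: vector_transpose_matrix)
qed

lemma zero_mats [simp]: "Dm 0 y = 0" "Am 0 y = 0" "Mm 0 y = 0" "Gm 0 y = 0"
proof -
  have "cnjv (0 :: complex^'n) = 0" "cnj_mat (0 :: complex^'n^'n) = 0"
    by (simp_all add: cnjv_def cnj_mat_def vec_eq_iff)
  then show "Dm 0 y = 0" "Am 0 y = 0" "Mm 0 y = 0" "Gm 0 y = 0"
    by (simp_all add: Am_def Mm_def Gm_def Dm_def vec_eq_iff matrix_matrix_mult_def zero_vec_def)
qed

lemma transpose_zero [simp]: "transpose (0 :: complex^'n^'n) = 0"
  by (simp add: transpose_def vec_eq_iff)

lemma theta_antiholo: "theta y (antiholo_vec b) u = (0, fst u v* Gm b y + fst u v* mderiv Nm y (antiholo_vec b))"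
  by (simp add: theta_def)

lemma theta_holo: "theta y (holo_vec a) u =
    (fst u v* Am a y + (snd u + fst u v* Nm y) v* Mm a y,
     fst u v* mderiv Nm y (holo_vec a) - (snd u + fst u v* Nm y) v* transpose (Am a y) -
       (fst u v* Am a y + (snd u + fst u v* Nm y) v* Mm a y) v* Nm y)"
  by (simp add: theta_def Let_def del: vector_transpose_matrix)

section \<open>The Dolbeault operator in the frame\<close>

lemma cderiv_beta:
  assumes "y \<in> V"
  shows "cderiv (\<lambda>y. \<beta> y [Z, W]) y T = (\<Sum>i\<in>UNIV. fst Z $ i * (\<Sum>j\<in>UNIV. fst W $ j * cderiv (bt i j) y T))"
proof -
  have "cderiv (\<lambda>y. \<beta> y [Z, W]) y T = cderiv (\<lambda>y. \<Sum>i\<in>UNIV. fst Z $ i * (\<Sum>j\<in>UNIV. fst W $ j * bt i j y)) y T"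
    by (rule cderiv_cong[OF open_V assms]) (rule beta_expand)
  then show ?thesis
    by (simp add: cderiv_sum cderiv_mult differentiable_sum_finite differentiable_mult assms)
qed

text \<open>The twist relation splits -i \<tau> into -i \<partial>\<omega>, which is
  \<open>Gm\<close>, and -i \<partial>bar \<beta>, which is the derivative of \<open>Nm\<close>. The
  latter acquires a sign because the (0,1)-vector stands in the second slot of the exterior
  derivative.\<close>

lemma tau_eq:
  assumes "y \<in> V"
  shows "- (\<i> * \<tau> y [holo_vec X, antiholo_vec b, holo_vec (axis i 1)]) =
    (X v* Gm b y) $ i + (X v* mderiv Nm y (antiholo_vec b)) $ i"
proof -
  let ?Zs = "[holo_vec X, antiholo_vec b, holo_vec (axis i 1)]"
  have t1: "\<tau> y ?Zs = delbar 2 0 \<beta> y ?Zs + del 1 1 (fund_form g) y ?Zs"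
    using twist[OF assms, of ?Zs] by simp
  have t2: "delbar 2 0 \<beta> y ?Zs = - (\<Sum>k\<in>UNIV. X $ k * cderiv (bt k i) y (antiholo_vec b))"
    unfolding delbar_def One_nat_def[symmetric] pq_part_21 ext_d_2 cderiv_beta[OF assms]
    by (simp add: sum_axis)
  have t3: "del 1 1 (fund_form g) y ?Zs = \<i> * (X v* Gm b y) $ i"
  proof -
    have 1: "dh3 y (axis i 1) X b = (\<Sum>k\<in>UNIV. \<Sum>l\<in>UNIV. dz i (hc k l) y * X $ k * b $ l)"
    proof -
      have "dh3 y (axis i 1) X b = (\<Sum>k\<in>UNIV. \<Sum>l\<in>UNIV. \<Sum>m\<in>UNIV. axis i 1 $ m * (dz m (hc k l) y * X $ k * b $ l))"
        unfolding dh3_def by (simp add: mult_ac)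
      then show ?thesis by (simp only: sum_axis)
    qed
    have 2: "dh3 y X (axis i 1) b = (\<Sum>k\<in>UNIV. \<Sum>l\<in>UNIV. dz k (hc i l) y * X $ k * b $ l)"
    proof -
      have "dh3 y X (axis i 1) b = (\<Sum>m\<in>UNIV. axis i 1 $ m * (\<Sum>l\<in>UNIV. \<Sum>k\<in>UNIV. dz k (hc m l) y * X $ k * b $ l))"
        unfolding dh3_def by (simp add: sum_distrib_left mult_ac)
      then have "dh3 y X (axis i 1) b = (\<Sum>l\<in>UNIV. \<Sum>k\<in>UNIV. dz k (hc i l) y * X $ k * b $ l)"
        by (simp only: sum_axis)
      then show ?thesis by (rule trans) (rule sum.swap)
    qed
    have "(X v* Gm b y) $ i = dh3 y (axis i 1) X b - dh3 y X (axis i 1) b"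
      unfolding 1 2 by (simp add: vm_component Gm_def tors_def sum_subtractf[symmetric] sum_distrib_right
        sum_distrib_left algebra_simps)
    then show ?thesis unfolding del_fund_form[OF assms] by simp
  qed
  have t4: "(X v* mderiv Nm y (antiholo_vec b)) $ i = \<i> * (\<Sum>k\<in>UNIV. X $ k * cderiv (bt k i) y (antiholo_vec b))"
    by (simp add: vm_component mderiv_Nm[OF assms] sum_distrib_left mult_ac)
  show ?thesis unfolding t1 t2 t3 t4 by (simp add: algebra_simps)
qed

lemma q_dbar_const:
  assumes "y \<in> V"
  shows "q_dbar \<tau> b (\<lambda>_. u) y = theta y (antiholo_vec b) u"
proof -
  have "delbar 1 0 (covec_form (\<lambda>y. snd u)) y [antiholo_vec b, holo_vec (axis i 1)] = 0" for i
    unfolding delbar_def One_nat_def[symmetric] pq_part_11 ext_d_1 by (simp add: covec_form_def)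
  then show ?thesis
    by (simp add: q_dbar_def theta_antiholo contract_def vec_eq_iff tau_eq[OF assms] zero_vec_def)
qed

section \<open>Compatibility of the connection with the metric\<close>

lemma Hm_diff [simp]: "y \<in> V \<Longrightarrow> mdiff Hm y" and Km_diff [simp]: "y \<in> V \<Longrightarrow> mdiff Km y"
  by (simp_all add: mdiff_def Hm_def Km_def)

lemma mderiv_Hm: "y \<in> V \<Longrightarrow> mderiv Hm y Z = Dm (fst Z) y + Em (snd Z) y"
  by (simp add: mderiv_def Hm_def Dm_def Em_def cderiv_expand vec_eq_iff)

lemma mderiv_Km:
  assumes "y \<in> V"
  shows "mderiv Km y Z = - (Km y ** mderiv Hm y Z ** Km y)"
proof -
  have "(\<Sum>a\<in>UNIV. \<Sum>b\<in>UNIV. hi i a y * cderiv (hc a b) y Z * hi b j y) =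
      (\<Sum>b\<in>UNIV. (\<Sum>a\<in>UNIV. hi i a y * cderiv (hc a b) y Z) * hi b j y)" for i j
    by (subst sum.swap) (simp add: sum_distrib_right)
  then show ?thesis
    by (simp add: mderiv_def Km_def Hm_def vec_eq_iff cderiv_hi[OF assms] matrix_matrix_mult_def)
qed

lemma gen_metric_cderiv:
  assumes "y \<in> V"
  shows "cderiv (\<lambda>y. gen_metric g \<beta> y u v) y Z =
    bilin (fst u) (mderiv Hm y Z) (cnjv (fst v)) +
    bilin (fst u v* mderiv Nm y Z) (transpose (Km y)) (cnjv (snd v + fst v v* Nm y)) +
    bilin (snd u + fst u v* Nm y) (transpose (mderiv Km y Z)) (cnjv (snd v + fst v v* Nm y)) +
    bilin (snd u + fst u v* Nm y) (transpose (Km y)) (cnjv (fst v v* mderiv Nm y (ctan_conj Z)))"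
proof -
  have vN: "vdiff (\<lambda>y. snd u + fst u v* Nm y) y" "vderiv (\<lambda>y. snd u + fst u v* Nm y) y Z = fst u v* mderiv Nm y Z" for u :: "'n qfib" and Z
    by (simp_all add: vdiff_add vdiff_vm vderiv_add vderiv_vm assms)
  have dbp: "(\<lambda>y. bilin (F y) (A y) (L y)) differentiable (at y)" if "vdiff F y" "mdiff A y" "vdiff L y" for F A and L :: "complex^'n \<Rightarrow> complex^'n"
    using that unfolding bilin_def vdiff_def mdiff_def
    by (simp add: differentiable_sum_finite differentiable_mult)
  have "cderiv (\<lambda>y. gen_metric g \<beta> y u v) y Z = cderiv (\<lambda>y. bilin (fst u) (Hm y) (cnjv (fst v)) +
    bilin (snd u + fst u v* Nm y) (transpose (Km y)) (cnjv (snd v + fst v v* Nm y))) y Z"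
    by (rule cderiv_cong[OF open_V assms]) (rule gen_metric_eq)
  also have "\<dots> = cderiv (\<lambda>y. bilin (fst u) (Hm y) (cnjv (fst v))) y Z +
      cderiv (\<lambda>y. bilin (snd u + fst u v* Nm y) (transpose (Km y)) (cnjv (snd v + fst v v* Nm y))) y Z"
    by (intro cderiv_add dbp vdiff_const vdiff_cnjv vN mdiff_transpose Hm_diff Km_diff assms)
  also have "cderiv (\<lambda>y. bilin (fst u) (Hm y) (cnjv (fst v))) y Z = bilin (fst u) (mderiv Hm y Z) (cnjv (fst v))"
    by (subst cderiv_bilin) (simp_all add: assms bilin_def[of _ _ 0])
  also have "cderiv (\<lambda>y. bilin (snd u + fst u v* Nm y) (transpose (Km y)) (cnjv (snd v + fst v v* Nm y))) y Z =
    bilin (fst u v* mderiv Nm y Z) (transpose (Km y)) (cnjv (snd v + fst v v* Nm y)) +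
    bilin (snd u + fst u v* Nm y) (transpose (mderiv Km y Z)) (cnjv (snd v + fst v v* Nm y)) +
    bilin (snd u + fst u v* Nm y) (transpose (Km y)) (cnjv (fst v v* mderiv Nm y (ctan_conj Z)))"
    by (subst cderiv_bilin[OF vN(1) mdiff_transpose[OF Km_diff[OF assms]] vdiff_cnjv[OF vN(1)]])
      (simp only: vN vderiv_cnjv[OF vN(1)] mderiv_transpose)
  finally show ?thesis by simp
qed

lemma cnj_mat_Gm_antisym: "transpose (cnj_mat (Gm b y)) = - cnj_mat (Gm b y)"
proof -
  have "transpose (cnj_mat (Gm b y)) = cnj_mat (transpose (Gm b y))" by simp
  also have "\<dots> = - cnj_mat (Gm b y)" unfolding Gm_antisym by (simp add: cnj_mat_def vec_eq_iff)
  finally show ?thesis .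
qed

text \<open>\<open>Mm\<close> is minus the adjoint of \<open>Gm\<close>, so the off-diagonal terms
  of the two pairings cancel. The diagonal ones add up to the derivatives of the metric and of its
  inverse, and what is left is the derivative of the shift in either argument.\<close>

lemma theta_metric:
  assumes "y \<in> V"
  shows "cderiv (\<lambda>y. gen_metric g \<beta> y u v) y Z =
    gen_metric g \<beta> y (theta y Z u) v + gen_metric g \<beta> y u (theta y (ctan_conj Z) v)"
proof -
  let ?X = "fst u" and ?Y = "cnjv (fst v)" and ?e = "snd u + fst u v* Nm y" and ?f = "cnjv (snd v + fst v v* Nm y)"
  let ?a = "fst Z" and ?b = "snd Z" and ?K = "transpose (Km y)"
  have cK: "cnj_mat (Km y) = ?K" using H_K[OF assms] by simp
  have fst_conj: "fst (ctan_conj Z) = cnjv ?b" "snd (ctan_conj Z) = cnjv ?a"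
    by (simp_all add: ctan_conj_def)
  \<comment> \<open>Hermitian symmetry reduces the second pairing to the conjugate of one that
    \<open>gen_metric_theta\<close> already computes.\<close>
  have "gen_metric g \<beta> y u (theta y (ctan_conj Z) v) = cnj (gen_metric g \<beta> y (theta y (ctan_conj Z) v) u)"
    by (simp add: gen_metric_cnj[OF assms])
  also have "\<dots> = bilin ?Y (cnj_mat (Dm (cnjv ?b) y)) ?X + bilin ?f (cnj_mat ?K ** Gm ?b y) ?X +
      bilin ?Y (cnj_mat (Gm (cnjv ?a) y) ** cnj_mat ?K) ?e - bilin ?f (transpose (cnj_mat (Am (cnjv ?b) y)) ** cnj_mat ?K) ?e +
      bilin ?Y (cnj_mat (mderiv Nm y (ctan_conj Z)) ** cnj_mat ?K) ?e"
    unfolding gen_metric_theta[OF assms] fst_conj by (simp add: bilin_cnj)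
  also have "\<dots> = bilin ?X (Em ?b y) ?Y - bilin ?X (Gm ?b y ** ?K) ?f - bilin ?e (?K ** cnj_mat (Gm (cnjv ?a) y)) ?Y
      - bilin ?e (?K ** transpose (Em ?b y) ** ?K) ?f + bilin ?e (?K ** transpose (cnj_mat (mderiv Nm y (ctan_conj Z)))) ?Y"
    unfolding bilin_transpose[of ?Y] bilin_transpose[of ?f]
    by (simp add: matrix_transpose_mul Dm_cnj_mat[OF assms] Gm_antisym cnj_mat_Gm_antisym cK Am_def mm_minus bilin_minus matrix_mul_assoc)
  finally have right: "gen_metric g \<beta> y u (theta y (ctan_conj Z) v) = \<dots>" .
  have "transpose (mderiv Km y Z) = - (?K ** transpose (Dm ?a y) ** ?K) - ?K ** transpose (Em ?b y) ** ?K"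
    unfolding mderiv_Km[OF assms] mderiv_Hm[OF assms]
    by (simp add: transpose_minus transpose_diff matrix_transpose_mul transpose_add mm_add_left matrix_add_ldistrib matrix_mul_assoc)
  then have left: "cderiv (\<lambda>y. gen_metric g \<beta> y u v) y Z =
    bilin ?X (Dm ?a y) ?Y + bilin ?X (Em ?b y) ?Y + bilin ?X (mderiv Nm y Z ** ?K) ?f
    - bilin ?e (?K ** transpose (Dm ?a y) ** ?K) ?f - bilin ?e (?K ** transpose (Em ?b y) ** ?K) ?f
    + bilin ?e (?K ** transpose (cnj_mat (mderiv Nm y (ctan_conj Z)))) ?Y"
    unfolding gen_metric_cderiv[OF assms] mderiv_Hm[OF assms] cnjv_vm[of "fst v" "mderiv _ _ _"]
    by (simp add: bilin_left bilin_right bilin_add bilin_diff bilin_minus)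
  show ?thesis
    unfolding left right gen_metric_theta[OF assms]
    by (simp add: Am_def matrix_transpose_mul)
qed

text \<open>The condition on constant sections determines the \<open>(0,1)\<close>-part; compatibility with the metric
  in the direction of a \<open>(1,0)\<close>-vector then determines the \<open>(1,0)\<close>-part.\<close>
lemma chern_form_eq:
  assumes "y \<in> V"
  shows "chern_form (q_dbar \<tau>) (gen_metric g \<beta>) y = theta y"
  unfolding chern_form_def
proof (rule the_equality)
  show "(\<forall>u. clin (\<lambda>Z. theta y Z u)) \<and> (\<forall>Z. clin (theta y Z)) \<and>
     (\<forall>b u. theta y (antiholo_vec b) u = q_dbar \<tau> b (\<lambda>_. u) y) \<and>
     (\<forall>Z u v. cderiv (\<lambda>y. gen_metric g \<beta> y u v) y Z =
        gen_metric g \<beta> y (theta y Z u) v + gen_metric g \<beta> y u (theta y (ctan_conj Z) v))"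
    using theta_linear[OF assms] q_dbar_const[OF assms] theta_metric[OF assms] by simp
next
  fix \<theta>
  assume \<theta>: "(\<forall>u. clin (\<lambda>Z. \<theta> Z u)) \<and> (\<forall>Z. clin (\<theta> Z)) \<and>
     (\<forall>b u. \<theta> (antiholo_vec b) u = q_dbar \<tau> b (\<lambda>_. u) y) \<and>
     (\<forall>Z u v. cderiv (\<lambda>y. gen_metric g \<beta> y u v) y Z =
        gen_metric g \<beta> y (\<theta> Z u) v + gen_metric g \<beta> y u (\<theta> (ctan_conj Z) v))"
  have anti: "\<theta> (antiholo_vec b) u = theta y (antiholo_vec b) u" for b u
  proof -
    have "\<theta> (antiholo_vec b) u = q_dbar \<tau> b (\<lambda>_. u) y" using \<theta> by blast
    then show ?thesis by (simp only: q_dbar_const[OF assms])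
  qed
  have holo: "\<theta> (holo_vec a) u = theta y (holo_vec a) u" for a u
  proof (rule gen_metric_nondegenerate[OF assms])
    fix v
    have cj: "ctan_conj (holo_vec a) = antiholo_vec (cnjv a)"
      by (simp add: ctan_conj_def holo_vec_def antiholo_vec_def cnjv_def vec_eq_iff)
    have "gen_metric g \<beta> y (\<theta> (holo_vec a) u) v + gen_metric g \<beta> y u (theta y (antiholo_vec (cnjv a)) v) =
        gen_metric g \<beta> y (theta y (holo_vec a) u) v + gen_metric g \<beta> y u (theta y (antiholo_vec (cnjv a)) v)"
      using \<theta> theta_metric[OF assms, of u v "holo_vec a"] unfolding cj anti[symmetric] by (metis cj)
    then show "gen_metric g \<beta> y (\<theta> (holo_vec a) u) v = gen_metric g \<beta> y (theta y (holo_vec a) u) v" by simp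
  qed
  show "\<theta> = theta y"
  proof (intro ext)
    fix Z :: "'n ctan" and u
    have Z: "Z = holo_vec (fst Z) + antiholo_vec (snd Z)"
      by (simp add: holo_vec_def antiholo_vec_def)
    have "\<theta> (Z + W) u = \<theta> Z u + \<theta> W u" for Z W
      using \<theta> unfolding clin_def by blast
    then have "\<theta> Z u = \<theta> (holo_vec (fst Z)) u + \<theta> (antiholo_vec (snd Z)) u"
      by (subst Z) (simp only:)
    moreover have "theta y (Z + W) u = theta y Z u + theta y W u" for Z W
      using theta_linear(1)[OF assms] unfolding clin_def by blast
    then have "theta y Z u = theta y (holo_vec (fst Z)) u + theta y (antiholo_vec (snd Z)) u"
      by (subst Z) (simp only:)
    ultimately show "\<theta> Z u = theta y Z u" by (simp add: anti holo)
  qed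
qed

end

section \<open>The Chern curvature\<close>

context gen_chart
begin

lemma holo_axis_mats:
  "Dm (axis k 1) y = (\<chi> i j. dz k (hc i j) y)" "Em (axis k 1) y = (\<chi> i j. dzb k (hc i j) y)"
  "Gm (axis k 1) y = (\<chi> i j. tors k i j y)"
proof -
  show "Dm (axis k 1) y = (\<chi> i j. dz k (hc i j) y)" "Em (axis k 1) y = (\<chi> i j. dzb k (hc i j) y)"
    "Gm (axis k 1) y = (\<chi> i j. tors k i j y)"
    by (simp_all add: Dm_def Em_def Gm_def sum_axis)
qed

lemma mats_diff [simp]:
  assumes "y \<in> V"
  shows "mdiff (Dm a) y" "mdiff (Gm b) y" "mdiff (Am a) y" "mdiff (Mm a) y"
proof -
  show D: "mdiff (Dm a) y" for a
    unfolding mdiff_def Dm_def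
    by (simp add: differentiable_sum_finite differentiable_mult assms)
  show G: "mdiff (Gm b) y" for b
    unfolding mdiff_def Gm_def tors_def
    by (simp add: differentiable_sum_finite differentiable_mult differentiable_diff assms)
  show "mdiff (Am a) y"
    unfolding Am_def[abs_def] by (intro mdiff_mm D Km_diff assms)
  show "mdiff (Mm a) y"
    unfolding Mm_def[abs_def] by (intro mdiff_mm mdiff_transpose mdiff_cm G Km_diff assms)
qed

lemma chern_curvature_const:
  assumes "y \<in> V"
  shows "chern_curvature (q_dbar \<tau>) (gen_metric g \<beta>) (\<lambda>_. Z) (\<lambda>_. W) (\<lambda>_. u) y =
    (pair_deriv (\<lambda>y. theta y W u) y Z + theta y Z (theta y W u)) -
    (pair_deriv (\<lambda>y. theta y Z u) y W + theta y W (theta y Z u))"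
proof -
  have pc: "pair_deriv (\<lambda>_. c) y Z = 0" for c :: "(complex^'n) \<times> (complex^'n)" and y and Z :: "'n ctan"
    by (simp add: pair_deriv_vderiv zero_prod_def)
  have once: "chern_conn (q_dbar \<tau>) (gen_metric g \<beta>) (\<lambda>_. W) (\<lambda>_. u) y = theta y W u" if "y \<in> V" for y W
    by (simp add: chern_conn_def pc chern_form_eq[OF that])
  have pcong: "pair_deriv s y Z = pair_deriv s' y Z" if "\<And>y. y \<in> V \<Longrightarrow> s y = s' y"
    for s s' :: "complex^'n \<Rightarrow> 'n qfib" and Z
  proof -
    have "cderiv (\<lambda>y. fst (s y) $ i) y Z = cderiv (\<lambda>y. fst (s' y) $ i) y Z"
      "cderiv (\<lambda>y. snd (s y) $ i) y Z = cderiv (\<lambda>y. snd (s' y) $ i) y Z" for i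
      by (rule cderiv_cong[OF open_V assms], simp add: that)+
    then show ?thesis by (simp add: pair_deriv_def)
  qed
  have br: "clie_bracket (\<lambda>_. Z) (\<lambda>_. W) = (\<lambda>_. 0)" for Z W :: "'n ctan"
    by (simp add: clie_bracket_def pc fun_eq_iff)
  have "theta y (0 + 0) u = theta y 0 u + theta y 0 u"
    using theta_linear(1)[OF assms, of u] unfolding clin_def by blast
  then have z: "theta y 0 u = 0" by simp
  have twice: "chern_conn (q_dbar \<tau>) (gen_metric g \<beta>) (\<lambda>_. Z) (chern_conn (q_dbar \<tau>) (gen_metric g \<beta>) (\<lambda>_. W) (\<lambda>_. u)) y
      = pair_deriv (\<lambda>y. theta y W u) y Z + theta y Z (theta y W u)" for Z W
    by (subst chern_conn_def) (simp only: once[OF assms] chern_form_eq[OF assms]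
        pcong[of "chern_conn (q_dbar \<tau>) (gen_metric g \<beta>) (\<lambda>_. W) (\<lambda>_. u)" "\<lambda>y. theta y W u", OF once])
  show ?thesis
    unfolding chern_curvature_def twice br once[OF assms] z by simp
qed

text \<open>The blocks of the curvature on (d_k, d_lbar) in the frame shifted by \<beta>. The first
  digit is the component that is mapped, the second the component it is mapped to, with 1 for X and
  2 for \<eta>.\<close>

definition Om11 :: "'n \<Rightarrow> 'n \<Rightarrow> complex^'n \<Rightarrow> complex^'n^'n" where
  "Om11 k l y = Gm (axis l 1) y ** Mm (axis k 1) y - mderiv (Am (axis k 1)) y (antiholo_vec (axis l 1))"
definition Om21 :: "'n \<Rightarrow> 'n \<Rightarrow> complex^'n \<Rightarrow> complex^'n^'n" where
  "Om21 k l y = - mderiv (Mm (axis k 1)) y (antiholo_vec (axis l 1))"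
definition Om12 :: "'n \<Rightarrow> 'n \<Rightarrow> complex^'n \<Rightarrow> complex^'n^'n" where
  "Om12 k l y = mderiv (Gm (axis l 1)) y (holo_vec (axis k 1)) - Gm (axis l 1) y ** transpose (Am (axis k 1) y)
    - Am (axis k 1) y ** Gm (axis l 1) y"
definition Om22 :: "'n \<Rightarrow> 'n \<Rightarrow> complex^'n \<Rightarrow> complex^'n^'n" where
  "Om22 k l y = transpose (mderiv (Am (axis k 1)) y (antiholo_vec (axis l 1))) - Mm (axis k 1) y ** Gm (axis l 1) y"

lemma vm_minus: "X v* (- A) = - (X v* (A :: complex^'k::finite^'k))"
  by (simp add: vec_eq_iff vm_component sum_negf)

lemma vm_neg: "(- X) v* A = - (X v* (A :: complex^'k::finite^'k))"
  by (simp add: vec_eq_iff vm_component sum_negf)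

text \<open>In the original frame the curvature is the shifted one conjugated by the shift. First
  derivatives of \<open>Nm\<close> cancel between the connection terms and the derivatives of
  \<eta>, and its mixed second derivatives cancel by symmetry; only the final subtraction that
  undoes the shift remains.\<close>

lemma chern_curvature_blocks:
  assumes "y \<in> V"
  defines "\<Omega> \<equiv> \<lambda>k l u. chern_curvature (q_dbar \<tau>) (gen_metric g \<beta>) (\<lambda>_. holo_vec (axis k 1)) (\<lambda>_. antiholo_vec (axis l 1)) (\<lambda>_. u) y"
  shows "fst (\<Omega> k l u) = fst u v* Om11 k l y + (snd u + fst u v* Nm y) v* Om21 k l y"
    and "snd (\<Omega> k l u) = fst u v* Om12 k l y + (snd u + fst u v* Nm y) v* Om22 k l y - fst (\<Omega> k l u) v* Nm y"
proof -
  let ?k = "holo_vec (axis k 1)" and ?l = "antiholo_vec (axis l 1)"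
  let ?X = "fst u" and ?\<eta> = "\<lambda>y. snd u + fst u v* Nm y"
  let ?A = "Am (axis k 1)" and ?M = "Mm (axis k 1)" and ?G = "Gm (axis l 1)"
  note [simp del] = vector_transpose_matrix transpose_matrix_vector
  have e: "vdiff ?\<eta> y" "vderiv ?\<eta> y Z = ?X v* mderiv Nm y Z" for Z
    by (simp_all add: vdiff_add vdiff_vm vderiv_add vderiv_vm assms(1))
  have p1: "pair_deriv (\<lambda>y. theta y ?l u) y ?k = (0, ?X v* mderiv ?G y ?k + ?X v* mderiv (\<lambda>y. mderiv Nm y ?l) y ?k)"
    unfolding pair_deriv_vderiv theta_antiholo
    by (simp add: vderiv_add vderiv_vm vdiff_vm assms(1))
  have X: "vdiff (\<lambda>y. ?X v* ?A y + ?\<eta> y v* ?M y) y"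
    "vderiv (\<lambda>y. ?X v* ?A y + ?\<eta> y v* ?M y) y ?l = ?X v* mderiv ?A y ?l + ((?X v* mderiv Nm y ?l) v* ?M y + ?\<eta> y v* mderiv ?M y ?l)"
    using e mats_diff[OF assms(1)] by (simp_all add: vdiff_add vdiff_vm vderiv_add[where F = "\<lambda>y. ?X v* ?A y"] vderiv_vm)
  have p2: "pair_deriv (\<lambda>y. theta y ?k u) y ?l = (vderiv (\<lambda>y. ?X v* ?A y + ?\<eta> y v* ?M y) y ?l,
     ?X v* mderiv (\<lambda>y. mderiv Nm y ?k) y ?l - ((?X v* mderiv Nm y ?l) v* transpose (?A y) + ?\<eta> y v* transpose (mderiv ?A y ?l))
     - (vderiv (\<lambda>y. ?X v* ?A y + ?\<eta> y v* ?M y) y ?l v* Nm y + (?X v* ?A y + ?\<eta> y v* ?M y) v* mderiv Nm y ?l))"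
  proof -
    have t: "mdiff (\<lambda>y. transpose (?A y)) y" by (simp add: mdiff_transpose assms(1))
    have "vderiv (\<lambda>y. ?X v* mderiv Nm y ?k - ?\<eta> y v* transpose (?A y) - (?X v* ?A y + ?\<eta> y v* ?M y) v* Nm y) y ?l =
      vderiv (\<lambda>y. ?X v* mderiv Nm y ?k) y ?l - vderiv (\<lambda>y. ?\<eta> y v* transpose (?A y)) y ?l
       - vderiv (\<lambda>y. (?X v* ?A y + ?\<eta> y v* ?M y) v* Nm y) y ?l"
    proof -
      have d: "vdiff (\<lambda>y. ?X v* mderiv Nm y ?k) y" "vdiff (\<lambda>y. ?\<eta> y v* transpose (?A y)) y"
        "vdiff (\<lambda>y. (?X v* ?A y + ?\<eta> y v* ?M y) v* Nm y) y"
        by (intro vdiff_vm vdiff_const mderiv_Nm_diff e X t Nm_diff assms(1))+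
      show ?thesis by (simp only: vderiv_diff[OF vdiff_diff[OF d(1,2)] d(3)] vderiv_diff[OF d(1,2)])
    qed
    also have "vderiv (\<lambda>y. ?X v* mderiv Nm y ?k) y ?l = ?X v* mderiv (\<lambda>y. mderiv Nm y ?k) y ?l"
      by (simp add: vderiv_vm assms(1))
    also have "vderiv (\<lambda>y. ?\<eta> y v* transpose (?A y)) y ?l = (?X v* mderiv Nm y ?l) v* transpose (?A y) + ?\<eta> y v* transpose (mderiv ?A y ?l)"
      by (simp only: vderiv_vm[OF e(1) t] e(2) mderiv_transpose)
    also have "vderiv (\<lambda>y. (?X v* ?A y + ?\<eta> y v* ?M y) v* Nm y) y ?l =
        vderiv (\<lambda>y. ?X v* ?A y + ?\<eta> y v* ?M y) y ?l v* Nm y + (?X v* ?A y + ?\<eta> y v* ?M y) v* mderiv Nm y ?l"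
      by (rule vderiv_vm[OF X(1) Nm_diff[OF assms(1)]])
    finally show ?thesis
      unfolding pair_deriv_vderiv theta_holo by simp
  qed
  have t1: "theta y ?k (theta y ?l u) =
     ((?X v* ?G y + ?X v* mderiv Nm y ?l) v* ?M y,
      - ((?X v* ?G y + ?X v* mderiv Nm y ?l) v* transpose (?A y)) - ((?X v* ?G y + ?X v* mderiv Nm y ?l) v* ?M y) v* Nm y)"
    unfolding theta_antiholo theta_holo by simp
  have t2: "theta y ?l (theta y ?k u) =
     (0, (?X v* ?A y + ?\<eta> y v* ?M y) v* ?G y + (?X v* ?A y + ?\<eta> y v* ?M y) v* mderiv Nm y ?l)"
    unfolding theta_antiholo theta_holo by simp
  show *: "fst (\<Omega> k l u) = fst u v* Om11 k l y + (snd u + fst u v* Nm y) v* Om21 k l y"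
    unfolding \<Omega>_def chern_curvature_const[OF assms(1)] p1 p2 t1 t2 X(2) Om11_def Om21_def
    by (simp add: vector_matrix_mult_diff_rdistrib vector_matrix_left_distrib vm_minus vector_matrix_mul_assoc)
  show "snd (\<Omega> k l u) = fst u v* Om12 k l y + (snd u + fst u v* Nm y) v* Om22 k l y - fst (\<Omega> k l u) v* Nm y"
    unfolding * unfolding \<Omega>_def chern_curvature_const[OF assms(1)] p1 p2 t1 t2 X(2) Om11_def Om21_def Om12_def Om22_def
      mderiv_mderiv_Nm[OF assms(1), of ?k ?l]
    by (simp add: vector_matrix_mult_diff_rdistrib vector_matrix_mult_add_rdistrib vector_matrix_left_distrib
        vector_matrix_mult_diff_distrib vm_minus vm_neg vector_matrix_mul_assoc[symmetric])
qed

lemma gen_metric_curvature: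
  assumes "y \<in> V"
  shows "gen_metric g \<beta> y (chern_curvature (q_dbar \<tau>) (gen_metric g \<beta>) (\<lambda>_. holo_vec (axis k 1)) (\<lambda>_. antiholo_vec (axis l 1)) (\<lambda>_. u) y) v =
    bilin (fst u) (Om11 k l y ** Hm y) (cnjv (fst v)) +
    bilin (snd u + fst u v* Nm y) (Om21 k l y ** Hm y) (cnjv (fst v)) +
    bilin (fst u) (Om12 k l y ** transpose (Km y)) (cnjv (snd v + fst v v* Nm y)) +
    bilin (snd u + fst u v* Nm y) (Om22 k l y ** transpose (Km y)) (cnjv (snd v + fst v v* Nm y))"
  unfolding gen_metric_eq[OF assms] chern_curvature_blocks(2)[OF assms] diff_add_cancel
  unfolding chern_curvature_blocks(1)[OF assms] by (simp only: bilin_add(1) bilin_left add.assoc)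

end

section \<open>The contracted curvature\<close>

context gen_chart
begin

definition contract_K :: "complex^'n \<Rightarrow> ('n \<Rightarrow> 'n \<Rightarrow> complex^'n^'n) \<Rightarrow> complex^'n^'n" where
  "contract_K y f = (\<chi> p q. \<Sum>k\<in>UNIV. \<Sum>l\<in>UNIV. hi l k y * f k l $ p $ q)"

lemma contract_mm_right: "contract_K y (\<lambda>k l. f k l ** A) = contract_K y f ** A"
proof -
  have "(\<Sum>k\<in>UNIV. \<Sum>l\<in>UNIV. hi l k y * (\<Sum>m\<in>UNIV. f k l $ p $ m * A $ m $ q)) =
      (\<Sum>m\<in>UNIV. (\<Sum>k\<in>UNIV. \<Sum>l\<in>UNIV. hi l k y * f k l $ p $ m) * A $ m $ q)" for p q
    unfolding sum_distrib_left sum_distrib_right mult.assoc by (rule sum_rotate)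
  then show ?thesis by (simp add: contract_K_def vec_eq_iff matrix_matrix_mult_def)
qed

lemma contract_mm_left: "contract_K y (\<lambda>k l. A ** f k l) = A ** contract_K y f"
proof -
  have "(\<Sum>k\<in>UNIV. \<Sum>l\<in>UNIV. hi l k y * (\<Sum>m\<in>UNIV. A $ p $ m * f k l $ m $ q)) =
      (\<Sum>k\<in>UNIV. \<Sum>l\<in>UNIV. \<Sum>m\<in>UNIV. A $ p $ m * (hi l k y * f k l $ m $ q))" for p q
    by (intro sum.cong refl) (simp add: sum_distrib_left mult_ac)
  also have "\<dots> p q = (\<Sum>m\<in>UNIV. \<Sum>k\<in>UNIV. \<Sum>l\<in>UNIV. A $ p $ m * (hi l k y * f k l $ m $ q))" for p q
    by (rule sum_rotate)
  finally show ?thesis by (simp add: contract_K_def vec_eq_iff matrix_matrix_mult_def sum_distrib_left)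
qed

lemma contract_bilin: "(\<Sum>k\<in>UNIV. \<Sum>l\<in>UNIV. hi l k y * bilin X (f k l) Y) = bilin X (contract_K y f) Y"
proof -
  have "(\<Sum>k\<in>UNIV. \<Sum>l\<in>UNIV. hi l k y * bilin X (f k l) Y) =
      (\<Sum>k\<in>UNIV. \<Sum>l\<in>UNIV. \<Sum>i\<in>UNIV. \<Sum>j\<in>UNIV. hi l k y * (f k l $ i $ j * X $ i * Y $ j))"
    by (simp only: bilin_def sum_distrib_left)
  also have "\<dots> = (\<Sum>i\<in>UNIV. \<Sum>k\<in>UNIV. \<Sum>l\<in>UNIV. \<Sum>j\<in>UNIV. hi l k y * (f k l $ i $ j * X $ i * Y $ j))"
    by (rule sum_rotate)
  also have "\<dots> = (\<Sum>i\<in>UNIV. \<Sum>j\<in>UNIV. \<Sum>k\<in>UNIV. \<Sum>l\<in>UNIV. hi l k y * (f k l $ i $ j * X $ i * Y $ j))"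
    by (rule sum.cong[OF refl], rule sum_rotate)
  finally show ?thesis by (simp add: bilin_def contract_K_def sum_distrib_right mult.assoc)
qed

text \<open>Normalized as velocities under the flow: \<open>R11\<close> is i \<rho>_B^{1,1} on (d_p,
  d_qbar), the time derivative of h, and \<open>R20\<close> is -i \<rho>_B^{2,0} on (d_p, d_q), the
  time derivative of i \<beta>.\<close>

definition R11 :: "complex^'n \<Rightarrow> complex^'n^'n" where
  "R11 y = (\<chi> p q. dzb q (bis_trace p) y - dz p (bisb_trace q) y)"

definition R20 :: "complex^'n \<Rightarrow> complex^'n^'n" where
  "R20 y = (\<chi> p q. dz p (bis_trace q) y - dz q (bis_trace p) y)"

lemma cnjv_axis: "cnjv (axis k 1) = axis k 1"
  by (simp add: cnjv_def axis_def vec_eq_iff)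

lemma Am_axis: "Am (axis k 1) y $ i $ j = chern_coeff k i j y"
  by (simp add: Am_def holo_axis_mats chern_coeff_def Km_def matrix_matrix_mult_def)

lemma Om12_entry:
  "Om12 k l y $ p $ q = dz k (tors l p q) y - (\<Sum>r\<in>UNIV. tors l p r y * chern_coeff k q r y) - (\<Sum>r\<in>UNIV. chern_coeff k p r y * tors l r q y)"
  by (simp add: Om12_def mderiv_def holo_axis_mats(3) matrix_matrix_mult_def transpose_def Am_axis dz_def)

lemma contract_Om12: "y \<in> V \<Longrightarrow> contract_K y (\<lambda>k l. Om12 k l y) = - R20 y"
  by (simp add: contract_K_def R20_def vec_eq_iff Om12_entry ricci_20_identity)

lemma Om11_H:
  assumes "y \<in> V"
  shows "(Om11 k l y ** Hm y) $ p $ q = - (dz k (dzb l (hc p q)) y - (\<Sum>r\<in>UNIV. chern_coeff k p r y * dzb l (hc r q) y)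
      - (\<Sum>s\<in>UNIV. \<Sum>c\<in>UNIV. tors l p s y * hi c s y * cnj (tors k c q y)))"
proof -
  let ?l = "antiholo_vec (axis l 1)"
  \<comment> \<open>Differentiating the relation \<open>Am ** Hm = Dm\<close> in place of the
    definition of \<open>Am\<close> keeps derivatives of the inverse metric out of the
    computation.\<close>
  have "mderiv (\<lambda>y. Am (axis k 1) y ** Hm y) y ?l = mderiv (Dm (axis k 1)) y ?l"
    by (rule mderiv_cong[OF open_V assms]) (rule AH)
  then have "mderiv (Am (axis k 1)) y ?l ** Hm y + Am (axis k 1) y ** mderiv Hm y ?l = mderiv (Dm (axis k 1)) y ?l"
    by (simp add: mderiv_mm assms)
  then have d: "mderiv (Am (axis k 1)) y ?l ** Hm y = mderiv (Dm (axis k 1)) y ?l - Am (axis k 1) y ** mderiv Hm y ?l"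
    by (simp add: eq_diff_eq)
  have E: "mderiv Hm y ?l = (\<chi> i j. dzb l (hc i j) y)"
    by (simp add: mderiv_Hm[OF assms] holo_axis_mats)
  have D: "mderiv (Dm (axis k 1)) y ?l $ p $ q = dz k (dzb l (hc p q)) y"
    by (simp add: mderiv_def holo_axis_mats dzb_def[symmetric] dz_hc_commute[OF assms])
  have M: "Gm (axis l 1) y ** (transpose (Km y) ** cnj_mat (Gm (axis k 1) y)) = (\<chi> p q.
      \<Sum>s\<in>UNIV. \<Sum>c\<in>UNIV. tors l p s y * hi c s y * cnj (tors k c q y))"
    by (simp add: holo_axis_mats matrix_matrix_mult_def transpose_def cnj_mat_def Km_def vec_eq_iff sum_distrib_left mult.assoc)
  have "Om11 k l y ** Hm y = Gm (axis l 1) y ** (Mm (axis k 1) y ** Hm y) - mderiv (Am (axis k 1)) y ?l ** Hm y"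
  proof -
    have "(A - B) ** C = A ** C - B ** C" for A B C :: "complex^'n^'n"
      by (simp add: matrix_matrix_mult_def vec_eq_iff left_diff_distrib sum_subtractf)
    then show ?thesis by (simp add: Om11_def matrix_mul_assoc)
  qed
  then show ?thesis
    unfolding MH[OF assms] cnjv_axis M d by (simp add: D) (simp add: matrix_matrix_mult_def Am_axis E)
qed

lemma contract_Om11:
  assumes "y \<in> V"
    and "\<And>k l p q. dz k (dzb l (hc p q)) y =
      dz p (dzb l (hc k q)) y + dz k (dzb q (hc p l)) y - dz p (dzb q (hc k l)) y"
  shows "contract_K y (\<lambda>k l. Om11 k l y ** Hm y) = - R11 y"
  unfolding contract_K_def R11_def Om11_H[OF assms(1)] ricci_11_identity[OF assms] mult_minus_right sum_negf
  by (simp add: vec_eq_iff del: minus_diff_eq)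

lemma Mm_antisym: "transpose (Mm a y) = - Mm a y"
  by (simp add: Mm_def matrix_transpose_mul cnj_mat_Gm_antisym mm_minus matrix_mul_assoc)

text \<open>The covector block of the connection is minus the transpose of the vector block. The
  product of the off-diagonal blocks follows suit because \<open>Gm\<close> and \<open>Mm\<close>
  are both antisymmetric, so that transposing merely reverses it.\<close>

lemma Om22_eq: "Om22 k l y = - transpose (Om11 k l y)"
  by (simp add: Om22_def Om11_def transpose_diff matrix_transpose_mul Mm_antisym Gm_antisym mm_minus)

text \<open>Skew-adjointness of the curvature, which explains the conjugate and the exchange of
  \<open>k\<close> and \<open>l\<close>. It is obtained by differentiating the relation that defines
  \<open>Mm\<close>, in the form \<open>transpose Hm ** Mm ** Hm = cnj_mat Gm\<close>.\<close>

lemma Om21_H: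
  assumes "y \<in> V"
  shows "Om21 k l y ** Hm y = - (transpose (Km y) ** cnj_mat (Om12 l k y))"
proof -
  let ?l = "antiholo_vec (axis l 1)" and ?G = "Gm (axis k 1)" and ?M = "Mm (axis k 1)"
  let ?T = "\<lambda>y. transpose (Hm y)"
  have tK: "transpose (Hm y) ** transpose (Km y) = mat 1" if "y \<in> V" for y
    by (simp only: matrix_transpose_mul[symmetric] H_K[OF that] transpose_mat)
  have "?T y ** (?M y ** Hm y) = cnj_mat (?G y)" if "y \<in> V" for y
    unfolding MH[OF that] cnjv_axis by (simp add: matrix_mul_assoc tK[OF that])
  then have "mderiv (\<lambda>y. ?T y ** (?M y ** Hm y)) y ?l = mderiv (\<lambda>y. cnj_mat (?G y)) y ?l"
    by (rule mderiv_cong[OF open_V assms])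
  moreover have "mderiv (\<lambda>y. ?T y ** (?M y ** Hm y)) y ?l =
      transpose (mderiv Hm y ?l) ** (?M y ** Hm y) + ?T y ** (mderiv ?M y ?l ** Hm y + ?M y ** mderiv Hm y ?l)"
    by (simp add: mderiv_mm mdiff_mm mdiff_transpose mderiv_transpose assms)
  moreover have "mderiv (\<lambda>y. cnj_mat (?G y)) y ?l = cnj_mat (mderiv ?G y (holo_vec (axis l 1)))"
    by (simp add: mderiv_cm assms ctan_conj_basis)
  moreover have "mderiv Hm y ?l = Em (axis l 1) y"
    by (simp add: mderiv_Hm[OF assms])
  ultimately have eq: "?T y ** (mderiv ?M y ?l ** Hm y) = cnj_mat (mderiv ?G y (holo_vec (axis l 1)))
      - transpose (Em (axis l 1) y) ** (?M y ** Hm y) - ?T y ** (?M y ** Em (axis l 1) y)"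
    by (simp add: matrix_add_ldistrib algebra_simps)
  have E: "transpose (Em (axis l 1) y) = cnj_mat (Dm (axis l 1) y)" "Em (axis l 1) y = transpose (cnj_mat (Dm (axis l 1) y))"
    using Dm_cnj_mat[OF assms, of "axis l 1"] by (simp_all add: cnjv_axis)
  have 1: "transpose (Em (axis l 1) y) ** (?M y ** Hm y) = cnj_mat (Am (axis l 1) y ** ?G y)"
    unfolding MH[OF assms] cnjv_axis E by (simp add: Am_def H_K[OF assms] matrix_mul_assoc)
  have 2: "?T y ** (?M y ** Em (axis l 1) y) = cnj_mat (?G y ** transpose (Am (axis l 1) y))"
    unfolding E(2) by (simp add: Mm_def cnjv_axis Am_def matrix_transpose_mul H_K[OF assms] matrix_mul_assoc tK[OF assms])
  have cmd: "cnj_mat (A - B) = cnj_mat A - cnj_mat B" for A B :: "complex^'n^'n"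
    by (simp add: cnj_mat_def vec_eq_iff)
  have "?T y ** (mderiv ?M y ?l ** Hm y) = cnj_mat (Om12 l k y)"
    unfolding eq 1 2 Om12_def cmd by simp
  then have "transpose (Km y) ** (?T y ** (mderiv ?M y ?l ** Hm y)) = transpose (Km y) ** cnj_mat (Om12 l k y)" by simp
  then have "mderiv ?M y ?l ** Hm y = transpose (Km y) ** cnj_mat (Om12 l k y)"
    by (simp add: matrix_mul_assoc transpose_K_H[OF assms])
  then show ?thesis by (simp add: Om21_def mm_minus)
qed

lemma contract_cnj_mat: "y \<in> V \<Longrightarrow> contract_K y (\<lambda>k l. cnj_mat (f l k)) = cnj_mat (contract_K y f)"
  unfolding contract_K_def cnj_mat_def
  by (simp add: vec_eq_iff hi_cnj) (intro allI, rule sum.swap)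

lemma contract_minus: "contract_K y (\<lambda>k l. - f k l) = - contract_K y f"
  by (simp add: contract_K_def vec_eq_iff sum_negf)

lemma contract_transpose: "contract_K y (\<lambda>k l. transpose (f k l)) = transpose (contract_K y f)"
  by (simp add: contract_K_def vec_eq_iff transpose_def)

lemma gen_metric_add: "y \<in> V \<Longrightarrow> gen_metric g \<beta> y (u + u') v = gen_metric g \<beta> y u v + gen_metric g \<beta> y u' v"
  and gen_metric_scale: "y \<in> V \<Longrightarrow> gen_metric g \<beta> y (pscale c u) v = c * gen_metric g \<beta> y u v"
proof -
  assume y: "y \<in> V"
  show "gen_metric g \<beta> y (u + u') v = gen_metric g \<beta> y u v + gen_metric g \<beta> y u' v"
    by (simp add: gen_metric_eq[OF y] bilin_add vector_matrix_left_distrib)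
  have "c *s snd u + (c *s fst u) v* Nm y = c *s (snd u + fst u v* Nm y)"
    by (simp add: scalar_vector_matrix_assoc vec.scale_right_distrib)
  then show "gen_metric g \<beta> y (pscale c u) v = c * gen_metric g \<beta> y u v"
    unfolding gen_metric_eq[OF y] pscale_def fst_conv snd_conv by (simp only: bilin_scale distrib_left)
qed

lemma gen_metric_sum:
  assumes "y \<in> V"
  shows "gen_metric g \<beta> y (\<Sum>i\<in>A. f i) v = (\<Sum>i\<in>A. gen_metric g \<beta> y (f i) v)"
proof -
  have "gen_metric g \<beta> y (0 + 0) v = gen_metric g \<beta> y 0 v + gen_metric g \<beta> y 0 v"
    by (rule gen_metric_add[OF assms])
  then have "gen_metric g \<beta> y 0 v = 0" by simp
  then show ?thesis
    by (induction A rule: infinite_finite_induct) (simp_all add: gen_metric_add[OF assms])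
qed

text \<open>The right-hand side has the shape of a product rule for \<open>gen_metric_eq\<close>:
  \<open>R11\<close> stands for the derivative of h, \<open>- Km ** R11 ** Km\<close> for that of
  its inverse and \<open>R20\<close> for that of the shift in either argument.\<close>

lemma gen_metric_S_end:
  assumes "y \<in> V"
    and plc: "\<And>k l p q. dz k (dzb l (hc p q)) y =
      dz p (dzb l (hc k q)) y + dz k (dzb q (hc p l)) y - dz p (dzb q (hc k l)) y"
  shows "gen_metric g \<beta> y (S_end \<tau> g \<beta> y u) v = - (
    bilin (fst u) (R11 y) (cnjv (fst v)) +
    bilin (fst u v* R20 y) (transpose (Km y)) (cnjv (snd v + fst v v* Nm y)) +
    bilin (snd u + fst u v* Nm y) (- transpose (Km y ** R11 y ** Km y)) (cnjv (snd v + fst v v* Nm y)) +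
    bilin (snd u + fst u v* Nm y) (transpose (Km y)) (cnjv (fst v v* R20 y)))"
proof -
  have c21: "contract_K y (\<lambda>k l. Om21 k l y ** Hm y) = transpose (Km y) ** cnj_mat (R20 y)"
    unfolding Om21_H[OF assms(1)] contract_minus contract_mm_left contract_cnj_mat[OF assms(1)] contract_Om12[OF assms(1)]
    by (simp add: cnj_mat_def vec_eq_iff matrix_matrix_mult_def sum_negf)
  have c12: "contract_K y (\<lambda>k l. Om12 k l y ** transpose (Km y)) = - (R20 y ** transpose (Km y))"
    unfolding contract_mm_right contract_Om12[OF assms(1)] by (simp add: mm_minus)
  have "contract_K y (\<lambda>k l. Om11 k l y) ** Hm y = - R11 y"
    using contract_Om11[OF assms] by (simp add: contract_mm_right)
  then have "contract_K y (\<lambda>k l. Om11 k l y) ** Hm y ** Km y = - R11 y ** Km y" by simp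
  then have "contract_K y (\<lambda>k l. Om11 k l y) = - (R11 y ** Km y)"
    by (simp add: matrix_mul_assoc[symmetric] H_K[OF assms(1)] mm_minus)
  then have c22: "contract_K y (\<lambda>k l. Om22 k l y ** transpose (Km y)) = transpose (Km y ** R11 y ** Km y)"
    unfolding contract_mm_right Om22_eq contract_minus contract_transpose
    by (simp add: transpose_minus matrix_transpose_mul matrix_mul_assoc)
  \<comment> \<open>Antisymmetry of \<open>R20\<close> supplies the sign needed to turn the block
    from covectors to vectors into the term in which \<open>R20\<close> acts on the second
    argument.\<close>
  have R: "transpose (cnj_mat (R20 y)) = - cnj_mat (R20 y)"
    by (simp add: R20_def cnj_mat_def transpose_def vec_eq_iff)
  have "gen_metric g \<beta> y (S_end \<tau> g \<beta> y u) v =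
    bilin (fst u) (- R11 y) (cnjv (fst v)) +
    bilin (snd u + fst u v* Nm y) (transpose (Km y) ** cnj_mat (R20 y)) (cnjv (fst v)) +
    bilin (fst u) (- (R20 y ** transpose (Km y))) (cnjv (snd v + fst v v* Nm y)) +
    bilin (snd u + fst u v* Nm y) (transpose (Km y ** R11 y ** Km y)) (cnjv (snd v + fst v v* Nm y))"
    unfolding S_end_def hi_def[symmetric] gen_metric_sum[OF assms(1)] gen_metric_scale[OF assms(1)]
      gen_metric_curvature[OF assms(1)] distrib_left sum.distrib contract_bilin c21 c12 c22 contract_Om11[OF assms] ..
  then show ?thesis
    by (simp add: bilin_left bilin_right cnjv_vm bilin_minus R mm_minus)
qed

text \<open>Linearity is read off the paired formula, whose right-hand side is linear in
  \<open>u\<close>, and nondegeneracy removes the pairing.\<close>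

lemma S_end_clin:
  assumes "y \<in> V"
    and plc: "\<And>k l p q. dz k (dzb l (hc p q)) y =
      dz p (dzb l (hc k q)) y + dz k (dzb q (hc p l)) y - dz p (dzb q (hc k l)) y"
  shows "clin (S_end \<tau> g \<beta> y)"
  unfolding clin_def
proof (intro conjI allI; rule gen_metric_nondegenerate[OF assms(1)])
  fix u u' v
  show "gen_metric g \<beta> y (S_end \<tau> g \<beta> y (u + u')) v = gen_metric g \<beta> y (S_end \<tau> g \<beta> y u + S_end \<tau> g \<beta> y u') v"
    unfolding gen_metric_add[OF assms(1)] gen_metric_S_end[OF assms]
    by (simp add: bilin_add(1) vector_matrix_left_distrib)
next
  fix c u v
  have e: "snd (pscale c u) + fst (pscale c u) v* Nm y = c *s (snd u + fst u v* Nm y)"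
    "fst (pscale c u) v* R20 y = c *s (fst u v* R20 y)" "fst (pscale c u) = c *s fst u"
    by (simp_all add: pscale_def scalar_vector_matrix_assoc vec.scale_right_distrib)
  show "gen_metric g \<beta> y (S_end \<tau> g \<beta> y (pscale c u)) v = gen_metric g \<beta> y (pscale c (S_end \<tau> g \<beta> y u)) v"
    unfolding gen_metric_scale[OF assms(1)] gen_metric_S_end[OF assms] e(1,2)
    unfolding e(3) bilin_scale
    by (simp add: algebra_simps)
qed

end

section \<open>The evolution of the generalized metric\<close>

lemma has_vector_derivative_bilin:
  assumes "\<And>i. ((\<lambda>s. F s $ i) has_vector_derivative F' $ i) (at t within I)"
    and "\<And>i j. ((\<lambda>s. A s $ i $ j) has_vector_derivative A' $ i $ j) (at t within I)"
    and "\<And>i. ((\<lambda>s. L s $ i) has_vector_derivative L' $ i) (at t within I)"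
  shows "((\<lambda>s. bilin (F s) (A s) (L s)) has_vector_derivative
    bilin F' (A t) (L t) + bilin (F t) A' (L t) + bilin (F t) (A t) L') (at t within I)"
proof -
  have "((\<lambda>s. bilin (F s) (A s) (L s)) has_vector_derivative (\<Sum>i\<in>UNIV. \<Sum>j\<in>UNIV.
      A t $ i $ j * F t $ i * L' $ j + (A t $ i $ j * F' $ i + A' $ i $ j * F t $ i) * L t $ j)) (at t within I)"
    unfolding bilin_def by (intro has_vector_derivative_sum has_vector_derivative_mult assms)
  then show ?thesis
    by (simp add: bilin_def sum.distrib[symmetric] algebra_simps)
qed

text \<open>A derivative within \<open>I\<close> is unique only at points that are not isolated; the
  nonempty interior excludes an interval of one point.\<close>

lemma interval_not_isolated:
  fixes I :: "real set"
  assumes "is_interval I" "interior I \<noteq> {}" "t \<in> I"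
  shows "at t within I \<noteq> bot"
proof -
  have "I \<noteq> {t}" using assms(2) by auto
  then have "t islimpt I"
    using connected_imp_perfect[of I t] is_interval_connected[OF assms(1)] assms(3) by blast
  then show ?thesis by (simp add: trivial_limit_within)
qed

lemma hermitian_chart_atlas:
  assumes "complex_atlas \<A>" "hermitian_metric \<A> g" "c \<in> \<A>"
  shows "hermitian_chart (chart_image c) (g c)"
  using assms unfolding complex_atlas_def hermitian_metric_def by unfold_locales auto

lemma pluriclosed_flow_gen_chart:
  assumes "complex_atlas \<A>" "pluriclosed_flow \<A> I g \<beta>" "c \<in> \<A>" "s \<in> I"
  shows "gen_chart (chart_image c) (g s c) (\<beta> s c) (del 1 1 (fund_form (g 0 c)))"
proof -
  have "hermitian_chart (chart_image c) (g s c)"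
    using assms by (intro hermitian_chart_atlas) (auto simp: pluriclosed_flow_def pluriclosed_metric_def)
  then show ?thesis
    using assms unfolding gen_chart_def gen_chart_axioms_def pluriclosed_flow_def form_20_def by auto
qed

context gen_chart
begin

text \<open>This is the second summand of the (1,1)-part on (d_i, d_jbar), where both arguments have
  lost their only component.\<close>

lemma bismut_ricci_form_zero: "y \<in> V \<Longrightarrow> bismut_ricci_form g y [antiholo_vec 0, holo_vec 0] = 0"
proof -
  assume y: "y \<in> V"
  have "re_tan (antiholo_vec 0) = (0 :: complex^'n)" "im_tan (antiholo_vec 0) = (0 :: complex^'n)"
    "re_tan (holo_vec 0) = (0 :: complex^'n)" "im_tan (holo_vec 0) = (0 :: complex^'n)"
    by (simp_all add: re_tan_def im_tan_def cnjv_def vec_eq_iff)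
  then show ?thesis
    by (simp add: bismut_ricci_form_def cext_def bismut_ricci_eq[OF y])
qed

lemma fund_form_axis: "y \<in> V \<Longrightarrow> hc i j y = - \<i> * fund_form g y [holo_vec (axis i 1), antiholo_vec (axis j 1)]"
proof -
  assume y: "y \<in> V"
  have "fund_form g y [holo_vec (axis i 1), antiholo_vec (axis j 1)] =
      (\<Sum>k\<in>UNIV. axis i 1 $ k * (\<Sum>l\<in>UNIV. axis j 1 $ l * (\<i> * hc k l y)))"
    unfolding fund_form_eq[OF y] by (simp add: sum_distrib_left mult_ac)
  then show ?thesis by (simp only: sum_axis) simp
qed

end

text \<open>The flow gives h, its inverse and i \<beta> the velocities \<open>R11\<close>,
  \<open>- Km ** R11 ** Km\<close> and \<open>R20\<close>; the product rule then reproduces the four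
  terms of \<open>gen_metric_S_end\<close>.\<close>

lemma gen_metric_has_vector_derivative:
  assumes "complex_atlas \<A>" "pluriclosed_flow \<A> I g \<beta>" "c \<in> \<A>" "x \<in> chart_image c" "t \<in> I"
  shows "((\<lambda>s. gen_metric (g s c) (\<beta> s c) x u v) has_vector_derivative
    - gen_metric (g t c) (\<beta> t c) x (S_end (del 1 1 (fund_form (g 0 c))) (g t c) (\<beta> t c) x u) v) (at t within I)"
proof -
  let ?V = "chart_image c" and ?\<tau> = "del 1 1 (fund_form (g 0 c))"
  note gc = pluriclosed_flow_gen_chart[OF assms(1-3)]
  have hch: "hermitian_chart ?V (g s c)" if "s \<in> I" for s
    using gc[OF that] by (simp add: gen_chart_def)
  interpret T: gen_chart ?V "g t c" "\<beta> t c" ?\<tau> by (rule gc[OF assms(5)])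
  have flow: "((\<lambda>s. fund_form (g s c) x Zs) has_vector_derivative
        - pq_part 1 1 (bismut_ricci_form (g t c)) x Zs) (at t within I)"
    "((\<lambda>s. \<beta> s c x Zs) has_vector_derivative
        - pq_part 2 0 (bismut_ricci_form (g t c)) x Zs) (at t within I)" if "length Zs = 2" for Zs
    using assms(2-5) that unfolding pluriclosed_flow_def by blast+
  have plc: "dz k (dzb l (T.hc p q)) x = dz p (dzb l (T.hc k q)) x + dz k (dzb q (T.hc p l)) x - dz p (dzb q (T.hc k l)) x" for k l p q
    by (rule T.pluriclosed_identity[OF assms(4)])
      (use assms(2-5) in \<open>auto simp: pluriclosed_flow_def pluriclosed_metric_def\<close>)
  \<comment> \<open>The locale is interpreted at the fixed time \<open>t\<close> only, so the
    matrices that vary with \<open>s\<close> are written out and identified with the locale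
    constants pointwise.\<close>
  let ?H = "\<lambda>s. metric_matrix (g s c) x"
  have inv: "invertible (?H s)" if "s \<in> I" for s
    by (rule hermitian_chart.invertible_metric_matrix[OF hch[OF that] assms(4)])
  have dH: "((\<lambda>s. ?H s $ i $ j) has_vector_derivative T.R11 x $ i $ j) (at t within I)" for i j
  proof (rule has_vector_derivative_transform[OF assms(5)])
    show "?H s $ i $ j = - \<i> * fund_form (g s c) x [holo_vec (axis i 1), antiholo_vec (axis j 1)]" if "s \<in> I" for s
      using gen_chart.fund_form_axis[OF gc[OF that] assms(4), of i j]
      by (simp add: hermitian_chart.hc_def[OF hch[OF that]])
    have "T.R11 x $ i $ j = - \<i> * - pq_part 1 1 (bismut_ricci_form (g t c)) x [holo_vec (axis i 1), antiholo_vec (axis j 1)]"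
      by (simp add: pq_part_11[simplified] T.bismut_ricci_form_11[OF assms(4)] T.bismut_ricci_form_zero[OF assms(4)] T.R11_def
          algebra_simps)
    then show "((\<lambda>s. - \<i> * fund_form (g s c) x [holo_vec (axis i 1), antiholo_vec (axis j 1)]) has_vector_derivative T.R11 x $ i $ j) (at t within I)"
      by (simp only:) (intro bounded_linear.has_vector_derivative[OF bounded_linear_mult_right] flow, simp)
  qed
  let ?K = "\<lambda>s. matrix_inv (metric_matrix (g s c) x)"
  have HK: "?H t = T.Hm x" "?K t = T.Km x"
    by (simp_all add: T.Hm_def T.Km_def T.hc_def T.hi_def vec_eq_iff)
  have dK: "((\<lambda>s. ?K s $ i $ j) has_vector_derivative (- (T.Km x ** T.R11 x ** T.Km x)) $ i $ j) (at t within I)" for i j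
  proof -
    have "((\<lambda>s. ?K s $ i $ j) has_derivative
      (\<lambda>r. - (\<Sum>a\<in>UNIV. \<Sum>b\<in>UNIV. ?K t $ i $ a * (r *\<^sub>R T.R11 x $ a $ b) * ?K t $ b $ j))) (at t within I)"
      by (rule matrix_inv_has_derivative[OF _ assms(5) inv]) (use dH in \<open>simp_all add: has_vector_derivative_def\<close>)
    moreover have "- (\<Sum>a\<in>UNIV. \<Sum>b\<in>UNIV. ?K t $ i $ a * (r *\<^sub>R T.R11 x $ a $ b) * ?K t $ b $ j) =
        r *\<^sub>R (- (T.Km x ** T.R11 x ** T.Km x)) $ i $ j" for r
    proof -
      have "(\<Sum>a\<in>UNIV. \<Sum>b\<in>UNIV. ?K t $ i $ a * (r *\<^sub>R T.R11 x $ a $ b) * ?K t $ b $ j) =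
        (\<Sum>b\<in>UNIV. \<Sum>a\<in>UNIV. r *\<^sub>R (?K t $ i $ a * T.R11 x $ a $ b * ?K t $ b $ j))"
        by (subst sum.swap) simp
      also have "\<dots> = r *\<^sub>R (\<Sum>b\<in>UNIV. (\<Sum>a\<in>UNIV. ?K t $ i $ a * T.R11 x $ a $ b) * ?K t $ b $ j)"
        by (simp only: scaleR_sum_right sum_distrib_right)
      finally show ?thesis unfolding HK(2) by (simp add: matrix_matrix_mult_def)
    qed
    ultimately show ?thesis by (simp add: has_vector_derivative_def)
  qed
  let ?N = "\<lambda>s. (\<chi> i j. \<i> * \<beta> s c x [holo_vec (axis i 1), holo_vec (axis j 1)]) :: complex^'b^'b"
  have N: "?N s = gen_chart.Nm (\<beta> s c) x" if "s \<in> I" for s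
    by (simp add: gen_chart.Nm_def[OF gc[OF that]] gen_chart.bt_def[OF gc[OF that]])
  have dN: "((\<lambda>s. ?N s $ i $ j) has_vector_derivative T.R20 x $ i $ j) (at t within I)" for i j
  proof -
    have "((\<lambda>s. \<i> * \<beta> s c x [holo_vec (axis i 1), holo_vec (axis j 1)]) has_vector_derivative
        \<i> * - pq_part 2 0 (bismut_ricci_form (g t c)) x [holo_vec (axis i 1), holo_vec (axis j 1)]) (at t within I)"
      by (intro bounded_linear.has_vector_derivative[OF bounded_linear_mult_right] flow) simp
    then show ?thesis
      by (simp add: pq_part_20 T.bismut_ricci_form_20[OF assms(4)] T.R20_def)
  qed
  have de: "((\<lambda>s. (snd u + fst u v* ?N s) $ i) has_vector_derivative (fst u v* T.R20 x) $ i) (at t within I)" for u i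
  proof -
    have "((\<lambda>s. snd u $ i + (\<Sum>m\<in>UNIV. ?N s $ m $ i * fst u $ m)) has_vector_derivative
        0 + (\<Sum>m\<in>UNIV. T.R20 x $ m $ i * fst u $ m)) (at t within I)"
      by (intro has_vector_derivative_add has_vector_derivative_const has_vector_derivative_sum
          bounded_linear.has_vector_derivative[OF bounded_linear_mult_left] dN)
    then show ?thesis by (simp add: vm_component)
  qed
  have df: "((\<lambda>s. cnjv (snd v + fst v v* ?N s) $ i) has_vector_derivative cnjv (fst v v* T.R20 x) $ i) (at t within I)" for i
    using bounded_linear.has_vector_derivative[OF bounded_linear_cnj de[of v i]] by (simp add: cnjv_def)
  have "((\<lambda>s. bilin (fst u) (?H s) (cnjv (fst v)) +
      bilin (snd u + fst u v* ?N s) (transpose (?K s)) (cnjv (snd v + fst v v* ?N s))) has_vector_derivative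
    (bilin 0 (?H t) (cnjv (fst v)) + bilin (fst u) (T.R11 x) (cnjv (fst v)) + bilin (fst u) (?H t) 0) +
    (bilin (fst u v* T.R20 x) (transpose (?K t)) (cnjv (snd v + fst v v* ?N t)) +
     bilin (snd u + fst u v* ?N t) (- transpose (T.Km x ** T.R11 x ** T.Km x)) (cnjv (snd v + fst v v* ?N t)) +
     bilin (snd u + fst u v* ?N t) (transpose (?K t)) (cnjv (fst v v* T.R20 x)))) (at t within I)"
  proof (intro has_vector_derivative_add has_vector_derivative_bilin dH de df)
    show "((\<lambda>s. transpose (?K s) $ i $ j) has_vector_derivative (- transpose (T.Km x ** T.R11 x ** T.Km x)) $ i $ j) (at t within I)" for i j
      using dK[of j i] by (simp add: transpose_def)
  qed simp_all
  moreover have "(bilin 0 (?H t) (cnjv (fst v)) + bilin (fst u) (T.R11 x) (cnjv (fst v)) + bilin (fst u) (?H t) 0) +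
    (bilin (fst u v* T.R20 x) (transpose (?K t)) (cnjv (snd v + fst v v* ?N t)) +
     bilin (snd u + fst u v* ?N t) (- transpose (T.Km x ** T.R11 x ** T.Km x)) (cnjv (snd v + fst v v* ?N t)) +
     bilin (snd u + fst u v* ?N t) (transpose (?K t)) (cnjv (fst v v* T.R20 x))) =
    - gen_metric (g t c) (\<beta> t c) x (S_end ?\<tau> (g t c) (\<beta> t c) x u) v"
    unfolding T.gen_metric_S_end[OF assms(4) plc] HK(2) N[OF assms(5)]
    by (simp add: bilin_def[of _ _ 0])
  moreover have "gen_metric (g s c) (\<beta> s c) x u v = bilin (fst u) (?H s) (cnjv (fst v)) +
      bilin (snd u + fst u v* ?N s) (transpose (?K s)) (cnjv (snd v + fst v v* ?N s))" if "s \<in> I" for s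
  proof -
    have "?H s = gen_chart.Hm (g s c) x" "?K s = gen_chart.Km (g s c) x"
      by (simp_all add: gen_chart.Hm_def[OF gc[OF that]] gen_chart.Km_def[OF gc[OF that]]
          hermitian_chart.hc_def[OF hch[OF that]] hermitian_chart.hi_def[OF hch[OF that]] vec_eq_iff)
    then show ?thesis by (simp only: gen_chart.gen_metric_eq[OF gc[OF that] assms(4)] N[OF that])
  qed
  ultimately show ?thesis
    by (simp only: has_vector_derivative_transform[OF assms(5)])
qed

text \<open>Differentiability is asserted as well because \<open>vector_derivative\<close> is
  meaningful only where a derivative exists. Equality of the two endomorphisms at every point of
  every chart is equality of the global ones.\<close>

theorem proposition5p5:
  fixes \<A> :: "('m::{t2_space, second_countable_topology}, 'n::finite) chart set"
    and I :: "real set"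
    and g :: "real \<Rightarrow> ('m, 'n) chart \<Rightarrow> 'n metric"
    and \<beta> :: "real \<Rightarrow> ('m, 'n) chart \<Rightarrow> 'n cform"
  assumes "complex_atlas \<A>"
    and "is_interval I" and "interior I \<noteq> {}" and "0 \<in> I"
    and "pluriclosed_flow \<A> I g \<beta>"
    and "c \<in> \<A>" and "x \<in> chart_image c" and "t \<in> I"
  shows "(\<forall>u v. (\<lambda>s. gen_metric (g s c) (\<beta> s c) x u v) differentiable (at t within I)) \<and>
    Ginv_dt I (\<lambda>s. gen_metric (g s c) (\<beta> s c) x) t =
      (\<lambda>u. - S_end (del 1 1 (fund_form (g 0 c))) (g t c) (\<beta> t c) x u)"
proof -
  let ?\<tau> = "del 1 1 (fund_form (g 0 c))"
  let ?S = "S_end ?\<tau> (g t c) (\<beta> t c) x"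
  interpret T: gen_chart "chart_image c" "g t c" "\<beta> t c" ?\<tau>
    by (rule pluriclosed_flow_gen_chart[OF assms(1,5,6,8)])
  note deriv = gen_metric_has_vector_derivative[OF assms(1,5,6,7,8)]
  have vector_deriv: "vector_derivative (\<lambda>s. gen_metric (g s c) (\<beta> s c) x u v) (at t within I) = - gen_metric (g t c) (\<beta> t c) x (?S u) v" for u v
    by (rule vector_derivative_within[OF interval_not_isolated[OF assms(2,3,8)] deriv])
  have plc: "dz k (dzb l (T.hc p q)) x = dz p (dzb l (T.hc k q)) x + dz k (dzb q (T.hc p l)) x - dz p (dzb q (T.hc k l)) x" for k l p q
    by (rule T.pluriclosed_identity[OF assms(7)])
      (use assms(5-8) in \<open>auto simp: pluriclosed_flow_def pluriclosed_metric_def\<close>)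
  have minus: "gen_metric (g t c) (\<beta> t c) x (- w) v = - gen_metric (g t c) (\<beta> t c) x w v" for w v
    using T.gen_metric_scale[OF assms(7), of "-1" w v] by (simp add: pscale_def uminus_prod_def)
  have "clin (\<lambda>u. - ?S u)"
    using T.S_end_clin[OF assms(7) plc] by (simp add: clin_def pscale_def prod_eq_iff)
  then have "Ginv_dt I (\<lambda>s. gen_metric (g s c) (\<beta> s c) x) t = (\<lambda>u. - ?S u)"
    unfolding Ginv_dt_def vector_deriv
  proof (intro the_equality)
    fix A
    assume A: "clin A \<and> (\<forall>u v. gen_metric (g t c) (\<beta> t c) x (A u) v = - gen_metric (g t c) (\<beta> t c) x (?S u) v)"
    \<comment> \<open>Any other solution has the same pairings with all \<open>v\<close>, and
      nondegeneracy of G identifies the two.\<close>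
    show "A = (\<lambda>u. - ?S u)"
    proof
      show "A u = - ?S u" for u
        by (rule T.gen_metric_nondegenerate[OF assms(7)]) (use A minus in metis)
    qed
  qed (simp add: minus)
  moreover have "(\<lambda>s. gen_metric (g s c) (\<beta> s c) x u v) differentiable (at t within I)" for u v
    using deriv by (rule differentiableI_vector)
  ultimately show ?thesis by blast
qed

end
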